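(* Let $m$ be a positive integer and let $A$ be an $(m,1)$-almost hereditary Artin algebra. Then $\mathrm{ind}\,A=\mathcal L_A^m\cup\mathcal R_A$.
   Context: $A$ is an Artin $k$-algebra over a commutative Artin ring $k$; modules are finitely generated left modules; $\mathrm{ind}\,A$ is a full subcategory of $\mathrm{mod}\,A$ consisting of exactly one representative of each isomorphism class of indecomposable modules; $\mathrm{pd}_A$, $\mathrm{id}_A$ denote projective and injective dimension. $A$ is $(m,1)$-almost hereditary if $\mathrm{gl.dim}\,A=m+1$ and every indecomposable $A$-module $X$ satisfies $\mathrm{pd}_A X\le m$ or $\mathrm{id}_A X\le 1$ (inclusive or). For $M,N\in\mathrm{ind}\,A$, a path from $M$ to $N$ is a sequence of nonzero morphisms $M=M_0\to M_1\to\cdots\to M_t=N$ with all $M_i\in\mathrm{ind}\,A$; then $M$ is a predecessor of $N$ and $N$ a successor of $M$ (every module is a predecessor and successor of itself). $\mathcal L_A^m$ is the class of $X\in\mathrm{ind}\,A$ all of whose predecessors in $\mathrm{ind}\,A$ have projective dimension at most $m$. $\mathcal R_A$ is the class of $X\in\mathrm{ind}\,A$ all of whose successors in $\mathrm{ind}\,A$ have injective dimension at most $1$. *)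

theory Defs
  imports "HOL-Algebra.Module" "HOL-Algebra.Ideal" "HOL-Library.Extended_Nat"
begin

section \<open>Left modules over a not necessarily commutative ring\<close>

text \<open>The library locale \<^locale>\<open>Module.module\<close> requires a commutative ring of scalars; its record type
  and its axioms are reused here. As there, the fields \<^const>\<open>mult\<close> and \<^const>\<open>one\<close> of the
  record of a module carry no meaning.\<close>

locale left_module = R?: ring R + M?: abelian_group M
  for R :: "('a, 'z) ring_scheme" (structure) and M :: "('a, 'm, 'y) module_scheme" (structure) +
  assumes smult_closed [simp, intro]:
      "\<lbrakk>a \<in> carrier R; x \<in> carrier M\<rbrakk> \<Longrightarrow> a \<odot>\<^bsub>M\<^esub> x \<in> carrier M"
    and smult_l_distr:
      "\<lbrakk>a \<in> carrier R; b \<in> carrier R; x \<in> carrier M\<rbrakk> \<Longrightarrow>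
        (a \<oplus> b) \<odot>\<^bsub>M\<^esub> x = a \<odot>\<^bsub>M\<^esub> x \<oplus>\<^bsub>M\<^esub> b \<odot>\<^bsub>M\<^esub> x"
    and smult_r_distr:
      "\<lbrakk>a \<in> carrier R; x \<in> carrier M; y \<in> carrier M\<rbrakk> \<Longrightarrow>
        a \<odot>\<^bsub>M\<^esub> (x \<oplus>\<^bsub>M\<^esub> y) = a \<odot>\<^bsub>M\<^esub> x \<oplus>\<^bsub>M\<^esub> a \<odot>\<^bsub>M\<^esub> y"
    and smult_assoc1:
      "\<lbrakk>a \<in> carrier R; b \<in> carrier R; x \<in> carrier M\<rbrakk> \<Longrightarrow>
        (a \<otimes> b) \<odot>\<^bsub>M\<^esub> x = a \<odot>\<^bsub>M\<^esub> (b \<odot>\<^bsub>M\<^esub> x)"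
    and smult_one [simp]: "x \<in> carrier M \<Longrightarrow> \<one> \<odot>\<^bsub>M\<^esub> x = x"

definition finitely_generated ::
    "('a, 'z) ring_scheme \<Rightarrow> ('a, 'm, 'y) module_scheme \<Rightarrow> bool" where
  "finitely_generated R M \<longleftrightarrow>
     (\<exists>S. finite S \<and> S \<subseteq> carrier M \<and>
        (\<forall>x\<in>carrier M. \<exists>c\<in>S \<rightarrow> carrier R. x = (\<Oplus>\<^bsub>M\<^esub>s\<in>S. c s \<odot>\<^bsub>M\<^esub> s)))"

definition lmod_hom ::
    "('a, 'z) ring_scheme \<Rightarrow> ('a, 'm, 'y) module_scheme \<Rightarrow> ('a, 'n, 'x) module_scheme
      \<Rightarrow> ('m \<Rightarrow> 'n) set" where
  "lmod_hom R M N =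
     {f. f \<in> carrier M \<rightarrow> carrier N \<and>
         (\<forall>x\<in>carrier M. \<forall>y\<in>carrier M. f (x \<oplus>\<^bsub>M\<^esub> y) = f x \<oplus>\<^bsub>N\<^esub> f y) \<and>
         (\<forall>a\<in>carrier R. \<forall>x\<in>carrier M. f (a \<odot>\<^bsub>M\<^esub> x) = a \<odot>\<^bsub>N\<^esub> f x)}"

definition lmod_iso ::
    "('a, 'z) ring_scheme \<Rightarrow> ('a, 'm, 'y) module_scheme \<Rightarrow> ('a, 'n, 'x) module_scheme \<Rightarrow> bool" where
  "lmod_iso R M N \<longleftrightarrow> (\<exists>f\<in>lmod_hom R M N. bij_betw f (carrier M) (carrier N))"

definition indecomposable ::
    "('a, 'z) ring_scheme \<Rightarrow> ('a, 'm, 'y) module_scheme \<Rightarrow> bool" where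
  "indecomposable R M \<longleftrightarrow>
     carrier M \<noteq> {\<zero>\<^bsub>M\<^esub>} \<and>
     (\<forall>U V. submodule U R M \<and> submodule V R M \<and> U \<inter> V = {\<zero>\<^bsub>M\<^esub>} \<and> U <+>\<^bsub>M\<^esub> V = carrier M
        \<longrightarrow> U = {\<zero>\<^bsub>M\<^esub>} \<or> V = {\<zero>\<^bsub>M\<^esub>})"


section \<open>Artin algebras\<close>

definition artinian_ring :: "('a, 'z) ring_scheme \<Rightarrow> bool" where
  "artinian_ring R \<longleftrightarrow> ring R \<and>
     (\<forall>I :: nat \<Rightarrow> 'a set. (\<forall>n. ideal (I n) R \<and> I (Suc n) \<subseteq> I n)
        \<longrightarrow> (\<exists>n. \<forall>j\<ge>n. I j = I n))"

text \<open>The record of a module has a multiplication and a scalar multiplication, so it can hold a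
  \<open>k\<close>-algebra, as in the library locale \<^locale>\<open>algebra\<close>, which covers only commutative algebras.
  The two associativity laws say that \<open>k\<close> acts through the centre of the algebra.
  \<^const>\<open>artinian_ring\<close> uses two-sided ideals and is applied to commutative rings only.\<close>

locale artin_algebra = Module.module k A + ring A
  for k :: "('k, 'z) ring_scheme" and A :: "('k, 'a, 'y) module_scheme" +
  assumes artinian: "artinian_ring k"
    and smult_mult_left:
      "\<lbrakk>c \<in> carrier k; x \<in> carrier A; y \<in> carrier A\<rbrakk> \<Longrightarrow>
        (c \<odot>\<^bsub>A\<^esub> x) \<otimes>\<^bsub>A\<^esub> y = c \<odot>\<^bsub>A\<^esub> (x \<otimes>\<^bsub>A\<^esub> y)"
    and smult_mult_right:
      "\<lbrakk>c \<in> carrier k; x \<in> carrier A; y \<in> carrier A\<rbrakk> \<Longrightarrow>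
        x \<otimes>\<^bsub>A\<^esub> (c \<odot>\<^bsub>A\<^esub> y) = c \<odot>\<^bsub>A\<^esub> (x \<otimes>\<^bsub>A\<^esub> y)"
    and finitely_generated: "finitely_generated k A"


section \<open>The category of finitely generated modules\<close>

text \<open>All objects of \<open>mod A\<close> must live in one type. For scalars of type \<open>'a\<close> the type \<open>'a list\<close> is
  large enough: mapping an element to a tuple of coefficients with respect to a finite generating
  set is injective, so every finitely generated module over any type has an isomorphic
  copy here (\<open>fgmod_representative\<close> below).\<close>

type_synonym 'a lmod = "('a, 'a list) module"

definition fgmod :: "('a, 'z) ring_scheme \<Rightarrow> 'a lmod set" where
  "fgmod A = {M. left_module A M \<and> finitely_generated A M}"

lemma fgmod_representative:
  fixes A :: "('a, 'z) ring_scheme" and M :: "('a, 'm, 'y) module_scheme"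
  assumes "left_module A M" and "finitely_generated A M"
  shows "\<exists>N\<in>fgmod A. lmod_iso A M N"
proof -
  interpret left_module A M by fact
  obtain S where S: "finite S" "S \<subseteq> carrier M"
    and gen: "\<And>x. x \<in> carrier M \<Longrightarrow> \<exists>c\<in>S \<rightarrow> carrier A. x = (\<Oplus>\<^bsub>M\<^esub>s\<in>S. c s \<odot>\<^bsub>M\<^esub> s)"
    using assms(2) unfolding finitely_generated_def by blast
  obtain ss where ss: "set ss = S" using finite_list S(1) by blast
  obtain c where c: "\<And>x. x \<in> carrier M \<Longrightarrow> c x \<in> S \<rightarrow> carrier A"
    "\<And>x. x \<in> carrier M \<Longrightarrow> x = (\<Oplus>\<^bsub>M\<^esub>s\<in>S. c x s \<odot>\<^bsub>M\<^esub> s)"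
    using gen by metis
  define g where "g x = map (c x) ss" for x
  have inj: "inj_on g (carrier M)"
  proof (rule inj_onI)
    fix x y assume xy: "x \<in> carrier M" "y \<in> carrier M" "g x = g y"
    have eq: "\<And>s. s \<in> S \<Longrightarrow> c x s = c y s" using xy(3) ss by (auto simp: g_def)
    have "(\<Oplus>\<^bsub>M\<^esub>s\<in>S. c x s \<odot>\<^bsub>M\<^esub> s) = (\<Oplus>\<^bsub>M\<^esub>s\<in>S. c y s \<odot>\<^bsub>M\<^esub> s)"
      by (rule M.finsum_cong') (use eq c(1)[OF xy(2)] S(2) in auto)
    then show "x = y" using c(2) xy by metis
  qed
  define h where "h = the_inv_into (carrier M) g"
  have hg: "h (g x) = x" if "x \<in> carrier M" for x
    unfolding h_def by (rule the_inv_into_f_f[OF inj that])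
  define N :: "'a lmod" where
    "N = \<lparr>carrier = g ` carrier M, mult = (\<lambda>x y. x), one = g \<zero>\<^bsub>M\<^esub>, zero = g \<zero>\<^bsub>M\<^esub>,
          add = (\<lambda>x y. g (h x \<oplus>\<^bsub>M\<^esub> h y)), smult = (\<lambda>a x. g (a \<odot>\<^bsub>M\<^esub> h x))\<rparr>"
  have N: "left_module A N"
  proof (intro left_module.intro left_module_axioms.intro)
    show "ring A" by (rule R.ring_axioms)
    show "abelian_group N"
    proof (rule abelian_groupI)
      fix x assume "x \<in> carrier N"
      then obtain u where u: "u \<in> carrier M" "x = g u" by (auto simp: N_def)
      show "\<exists>y\<in>carrier N. y \<oplus>\<^bsub>N\<^esub> x = \<zero>\<^bsub>N\<^esub>"
        by (rule bexI[of _ "g (\<ominus>\<^bsub>M\<^esub> u)"]) (use u in \<open>auto simp: N_def hg M.l_neg\<close>)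
    qed (auto simp: N_def hg M.a_ac)
  qed (auto simp: N_def hg smult_l_distr smult_r_distr smult_assoc1)
  have gh: "g \<in> lmod_hom A M N" by (auto simp: lmod_hom_def N_def hg)
  interpret N: left_module A N by fact
  have g_sum: "g (\<Oplus>\<^bsub>M\<^esub>s\<in>F. f s) = (\<Oplus>\<^bsub>N\<^esub>s\<in>F. g (f s))"
    if "finite F" "f \<in> F \<rightarrow> carrier M" for F and f :: "'m \<Rightarrow> 'm"
    using that
  proof (induction F)
    case empty
    have "\<zero>\<^bsub>N\<^esub> = g \<zero>\<^bsub>M\<^esub>" by (simp add: N_def)
    then show ?case by simp
  next
    case (insert s F)
    have "g ` f ` insert s F \<subseteq> carrier N" using insert.prems by (auto simp: N_def)
    moreover have "g (f s \<oplus>\<^bsub>M\<^esub> finsum M f F) = g (f s) \<oplus>\<^bsub>N\<^esub> g (finsum M f F)"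
      using insert.prems gh by (auto simp: lmod_hom_def Pi_iff)
    ultimately show ?case using insert
      by (subst M.finsum_insert) (auto simp: Pi_iff image_subset_iff)
  qed
  have "finitely_generated A N"
    unfolding finitely_generated_def
  proof (intro exI[of _ "g ` S"] conjI ballI)
    show "finite (g ` S)" "g ` S \<subseteq> carrier N" using S by (auto simp: N_def)
    fix y assume "y \<in> carrier N"
    then obtain x where x: "x \<in> carrier M" "y = g x" by (auto simp: N_def)
    have "y = g (\<Oplus>\<^bsub>M\<^esub>s\<in>S. c x s \<odot>\<^bsub>M\<^esub> s)" using c(2)[OF x(1)] x(2) by simp
    also have "\<dots> = (\<Oplus>\<^bsub>N\<^esub>s\<in>S. g (c x s \<odot>\<^bsub>M\<^esub> s))"
      by (rule g_sum[OF S(1)]) (use c(1)[OF x(1)] S(2) in auto)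
    also have "\<dots> = (\<Oplus>\<^bsub>N\<^esub>s\<in>S. c x (h (g s)) \<odot>\<^bsub>N\<^esub> g s)"
      by (rule N.M.finsum_cong') (use c(1)[OF x(1)] S(2) in \<open>auto simp: N_def hg subset_iff Pi_iff\<close>)
    also have "\<dots> = (\<Oplus>\<^bsub>N\<^esub>t\<in>g ` S. c x (h t) \<odot>\<^bsub>N\<^esub> t)"
      by (rule N.M.finsum_reindex[symmetric])
         (use c(1)[OF x(1)] S(2) inj in \<open>auto simp: N_def hg subset_iff Pi_iff intro: inj_on_subset\<close>)
    finally show "\<exists>d\<in>g ` S \<rightarrow> carrier A. y = (\<Oplus>\<^bsub>N\<^esub>s\<in>g ` S. d s \<odot>\<^bsub>N\<^esub> s)"
      using c(1)[OF x(1)] S(2) by (intro bexI[of _ "\<lambda>t. c x (h t)"]) (auto simp: hg subset_iff Pi_iff)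
  qed
  moreover have "bij_betw g (carrier M) (carrier N)"
    using inj by (simp add: bij_betw_def N_def)
  ultimately show ?thesis using N gh unfolding fgmod_def lmod_iso_def by blast
qed


section \<open>Homological dimensions\<close>

definition projective :: "('a, 'z) ring_scheme \<Rightarrow> 'a lmod \<Rightarrow> bool" where
  "projective A P \<longleftrightarrow> P \<in> fgmod A \<and>
     (\<forall>M\<in>fgmod A. \<forall>N\<in>fgmod A. \<forall>g\<in>lmod_hom A M N. \<forall>f\<in>lmod_hom A P N.
        g ` carrier M = carrier N \<longrightarrow>
        (\<exists>h\<in>lmod_hom A P M. \<forall>x\<in>carrier P. g (h x) = f x))"

definition injective :: "('a, 'z) ring_scheme \<Rightarrow> 'a lmod \<Rightarrow> bool" where
  "injective A E \<longleftrightarrow> E \<in> fgmod A \<and>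
     (\<forall>M\<in>fgmod A. \<forall>N\<in>fgmod A. \<forall>g\<in>lmod_hom A M N. \<forall>f\<in>lmod_hom A M E.
        inj_on g (carrier M) \<longrightarrow>
        (\<exists>h\<in>lmod_hom A N E. \<forall>x\<in>carrier M. h (g x) = f x))"

text \<open>An exact sequence \<open>0 \<rightarrow> C (n + 1) \<rightarrow> \<dots> \<rightarrow> C 1 \<rightarrow> C 0 = M \<rightarrow> 0\<close> with maps
  \<open>d i : C (i + 1) \<rightarrow> C i\<close>, so \<open>C (i + 1)\<close> is the \<open>i\<close>-th term of the resolution.\<close>

definition projective_resolution ::
    "('a, 'z) ring_scheme \<Rightarrow> 'a lmod \<Rightarrow> nat \<Rightarrow> (nat \<Rightarrow> 'a lmod) \<Rightarrow> (nat \<Rightarrow> 'a list \<Rightarrow> 'a list) \<Rightarrow> bool"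
  where
  "projective_resolution A M n C d \<longleftrightarrow>
     C 0 = M \<and>
     (\<forall>i\<le>n. projective A (C (Suc i)) \<and> d i \<in> lmod_hom A (C (Suc i)) (C i)) \<and>
     d 0 ` carrier (C 1) = carrier (C 0) \<and>
     (\<forall>i<n. d (Suc i) ` carrier (C (Suc (Suc i))) = a_kernel (C (Suc i)) (C i) (d i)) \<and>
     inj_on (d n) (carrier (C (Suc n)))"

text \<open>Dually, an exact sequence \<open>0 \<rightarrow> M = C 0 \<rightarrow> C 1 \<rightarrow> \<dots> \<rightarrow> C (n + 1) \<rightarrow> 0\<close> with maps
  \<open>d i : C i \<rightarrow> C (i + 1)\<close>.\<close>

definition injective_resolution ::
    "('a, 'z) ring_scheme \<Rightarrow> 'a lmod \<Rightarrow> nat \<Rightarrow> (nat \<Rightarrow> 'a lmod) \<Rightarrow> (nat \<Rightarrow> 'a list \<Rightarrow> 'a list) \<Rightarrow> bool"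
  where
  "injective_resolution A M n C d \<longleftrightarrow>
     C 0 = M \<and>
     (\<forall>i\<le>n. injective A (C (Suc i)) \<and> d i \<in> lmod_hom A (C i) (C (Suc i))) \<and>
     inj_on (d 0) (carrier (C 0)) \<and>
     (\<forall>i<n. d i ` carrier (C i) = a_kernel (C (Suc i)) (C (Suc (Suc i))) (d (Suc i))) \<and>
     d n ` carrier (C n) = carrier (C (Suc n))"

text \<open>The infimum of the empty set is \<open>\<infinity>\<close>. The zero module gets dimension \<open>0\<close>.\<close>

definition proj_dim :: "('a, 'z) ring_scheme \<Rightarrow> 'a lmod \<Rightarrow> enat" where
  "proj_dim A M = Inf {enat n | n. \<exists>C d. projective_resolution A M n C d}"

definition inj_dim :: "('a, 'z) ring_scheme \<Rightarrow> 'a lmod \<Rightarrow> enat" where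
  "inj_dim A M = Inf {enat n | n. \<exists>C d. injective_resolution A M n C d}"

definition gl_dim :: "('a, 'z) ring_scheme \<Rightarrow> enat" where
  "gl_dim A = Sup (proj_dim A ` fgmod A)"

text \<open>This is the notion of an \<open>(m, 1)\<close>-almost hereditary algebra.\<close>

definition almost_hereditary :: "nat \<Rightarrow> ('a, 'z) ring_scheme \<Rightarrow> bool" where
  "almost_hereditary m A \<longleftrightarrow>
     gl_dim A = enat (m + 1) \<and>
     (\<forall>M\<in>fgmod A. indecomposable A M \<longrightarrow> proj_dim A M \<le> enat m \<or> inj_dim A M \<le> 1)"


section \<open>Paths between indecomposable modules\<close>

definition is_ind :: "('a, 'z) ring_scheme \<Rightarrow> 'a lmod set \<Rightarrow> bool" where
  "is_ind A ind \<longleftrightarrow>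
     ind \<subseteq> {M \<in> fgmod A. indecomposable A M} \<and>
     (\<forall>M\<in>fgmod A. indecomposable A M \<longrightarrow> (\<exists>!N. N \<in> ind \<and> lmod_iso A M N))"

definition predecessor ::
    "('a, 'z) ring_scheme \<Rightarrow> 'a lmod set \<Rightarrow> 'a lmod \<Rightarrow> 'a lmod \<Rightarrow> bool" where
  "predecessor A ind M N \<longleftrightarrow>
     (\<exists>t C f. C 0 = M \<and> C t = N \<and> (\<forall>i\<le>t. C i \<in> ind) \<and>
        (\<forall>i<t. f i \<in> lmod_hom A (C i) (C (Suc i)) \<and>
               (\<exists>x\<in>carrier (C i). f i x \<noteq> \<zero>\<^bsub>C (Suc i)\<^esub>)))"

abbreviation successor ::
    "('a, 'z) ring_scheme \<Rightarrow> 'a lmod set \<Rightarrow> 'a lmod \<Rightarrow> 'a lmod \<Rightarrow> bool" where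
  "successor A ind N M \<equiv> predecessor A ind M N"

definition left_part :: "nat \<Rightarrow> ('a, 'z) ring_scheme \<Rightarrow> 'a lmod set \<Rightarrow> 'a lmod set" where
  "left_part m A ind = {M \<in> ind. \<forall>N. predecessor A ind N M \<longrightarrow> proj_dim A N \<le> enat m}"

definition right_part :: "('a, 'z) ring_scheme \<Rightarrow> 'a lmod set \<Rightarrow> 'a lmod set" where
  "right_part A ind = {M \<in> ind. \<forall>N. successor A ind N M \<longrightarrow> inj_dim A N \<le> 1}"

end

theory Submission
  imports Defs
begin

text \<open>
  Suppose that a path starts at an indecomposable module of projective dimension \<open>m + 1\<close> and ends
  at an indecomposable module of injective dimension greater than \<open>1\<close>. The theorem says that there
  is no such path. The proof walks backwards along the path and carries a class \<open>\<Phi>\<close> of modules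
  with \<open>M \<notin> \<Phi>\<close> for the current module \<open>M\<close>, such that \<open>\<Phi>\<close> contains the zero modules, is closed under
  retracts, finite direct sums and quotients by submodules of injective dimension at most \<open>1\<close>, and
  contains every indecomposable module of projective dimension greater than \<open>m\<close> (\<open>good_class\<close>).
  At the end of the path \<open>\<Phi>\<close> is the class of modules of injective dimension at most \<open>1\<close>. One step
  back from \<open>Y\<close> leads to the class of all \<open>N\<close> with \<open>Hom(N, Y) = 0\<close>. The closure properties of
  this class are clear except for the last one, which is the key lemma \<open>hom_into_summand_free_zero\<close>:
  if \<open>X\<close> and \<open>Y\<close> are indecomposable, \<open>pd X > m\<close> and \<open>Y \<notin> \<Phi>\<close>, then \<open>Hom(X, Y) = 0\<close>.

  For the key lemma, consider all modules \<open>Y\<close> without nonzero direct summands in \<open>\<Phi>\<close>; by Fitting's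
  lemma they are closed under finite direct sums. Choose \<open>f : X \<rightarrow> Y\<close> into such a module with
  smallest kernel \<open>K\<close>, so that every map from \<open>X\<close> to a module of this kind kills \<open>K\<close>, and suppose
  that \<open>f \<noteq> 0\<close>. Since \<open>pd Y \<le> m\<close> and the global dimension is \<open>m + 1\<close>, the image \<open>f(X)\<close> has projective
  dimension at most \<open>m\<close>, so \<open>pd K > m\<close>. Hence \<open>K = K1 \<oplus> K2\<close> with \<open>id K1 \<le> 1\<close>, \<open>pd K2 \<le> m\<close> and \<open>K1 \<noteq> 0\<close>.
  Let \<open>0 \<rightarrow> K1 \<rightarrow> J0 \<rightarrow> J1 \<rightarrow> 0\<close> be an injective resolution. The map \<open>K \<rightarrow> K1 \<rightarrow> J0\<close> extends to \<open>X\<close>, the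
  induced map \<open>f(X) \<rightarrow> J1\<close> extends to \<open>Y\<close>, and the pullback of \<open>Y \<rightarrow> J1 \<leftarrow> J0\<close> is a module \<open>E\<close> with an
  exact sequence \<open>0 \<rightarrow> K1 \<rightarrow> E \<rightarrow> Y \<rightarrow> 0\<close> and a map \<open>X \<rightarrow> E\<close> over \<open>Y\<close> that is the identity on \<open>K1\<close>.
  Decompose \<open>E = B \<oplus> E'\<close> with \<open>E' \<in> \<Phi>\<close> and \<open>B\<close> without nonzero summands in \<open>\<Phi>\<close>. The map \<open>X \<rightarrow> B\<close> kills
  \<open>K\<close>, so \<open>K1\<close> lies in \<open>E'\<close>. Then \<open>E'/K1\<close> is a direct summand of \<open>Y\<close> and lies in \<open>\<Phi>\<close>, so it vanishes and
  \<open>E' = K1\<close>. The composite \<open>X \<rightarrow> E \<rightarrow> E' = K1\<close> now splits \<open>K1\<close> off the indecomposable module \<open>X\<close>,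
  so \<open>K = X\<close>, a contradiction.

  This argument needs modules of finite length. That finitely generated modules over an Artin
  algebra have this property rests on the Akizuki--Hopkins theorem for commutative artinian rings.
\<close>

section \<open>Commutative artinian rings have finite length\<close>

text \<open>A function that is strictly monotone on a family of sets. For the lattice of submodules of a
  module the existence of such a function with natural values says that the module has finite
  length, and it gives the ascending and the descending chain condition at once.\<close>

definition strict_rank :: "'b set set \<Rightarrow> ('b set \<Rightarrow> nat) \<Rightarrow> bool" where
  "strict_rank S \<rho> \<longleftrightarrow> (\<forall>U\<in>S. \<forall>V\<in>S. U \<subset> V \<longrightarrow> \<rho> U < \<rho> V)"

lemma strict_rankD: "strict_rank S \<rho> \<Longrightarrow> U \<in> S \<Longrightarrow> V \<in> S \<Longrightarrow> U \<subset> V \<Longrightarrow> \<rho> U < \<rho> V"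
  by (auto simp: strict_rank_def)

lemma strict_rank_mono:
  "strict_rank S \<rho> \<Longrightarrow> U \<in> S \<Longrightarrow> V \<in> S \<Longrightarrow> U \<subseteq> V \<Longrightarrow> \<rho> U \<le> \<rho> V"
  by (cases "U = V") (auto dest!: strict_rankD[of S \<rho> U V])

lemma artinian_chain:
  assumes "artinian_ring R" "\<And>n. ideal (I n) R" "\<And>n. I (Suc n) \<subseteq> I n"
  shows "\<exists>n. \<forall>j\<ge>n. I j = I n"
  using assms unfolding artinian_ring_def by blast

lemma artinian_minimal:
  assumes "artinian_ring R" "ideal I R" "P I"
  shows "\<exists>W. ideal W R \<and> P W \<and> (\<forall>V. ideal V R \<and> V \<subset> W \<longrightarrow> \<not> P V)"
proof (rule ccontr)
  assume no: "\<not> ?thesis"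
  have "\<exists>f. \<forall>n::nat. (ideal (f n) R \<and> P (f n)) \<and> f (Suc n) \<subset> f n"
  proof (rule dependent_nat_choice)
    show "\<exists>x. ideal x R \<and> P x" using assms by blast
    show "\<exists>y. (ideal y R \<and> P y) \<and> y \<subset> x" if "ideal x R \<and> P x" for x
      and n :: nat
      using that no by blast
  qed
  then obtain f where f: "\<And>n::nat. ideal (f n) R" "\<And>n. f (Suc n) \<subset> f n" by blast
  then obtain n where "\<forall>j\<ge>n. f j = f n"
    using assms(1) unfolding artinian_ring_def by (meson psubset_imp_subset)
  then show False using f(2)[of n] by (metis le_Suc_eq order_refl psubset_eq)
qed

context cring
begin

lemma ideal_iff:
  "ideal I R \<longleftrightarrow> I \<subseteq> carrier R \<and> \<zero> \<in> I \<and> (\<forall>x\<in>I. \<forall>y\<in>I. x \<oplus> y \<in> I)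
     \<and> (\<forall>a\<in>carrier R. \<forall>x\<in>I. a \<otimes> x \<in> I)" (is "_ \<longleftrightarrow> ?r")
proof
  assume "ideal I R"
  then interpret ideal I R .
  show ?r using a_subset I_l_closed by auto
next
  assume r: ?r
  show "ideal I R"
  proof (rule idealI)
    show "subgroup I (add_monoid R)"
    proof (rule add.subgroupI)
      fix a assume "a \<in> I"
      moreover from this have "\<ominus> \<one> \<otimes> a = \<ominus> a" using r
        by (auto simp: l_minus)
      ultimately show "\<ominus> a \<in> I" using r by (metis a_inv_closed one_closed)
    qed (use r in auto)
    show "a \<otimes> x \<in> I" "x \<otimes> a \<in> I" if "a \<in> I" "x \<in> carrier R" for a x
      using r that m_comm[of a x] by auto
  qed (rule ring_axioms)
qed

lemma ideal_add: "ideal I R \<Longrightarrow> x \<in> I \<Longrightarrow> y \<in> I \<Longrightarrow> x \<oplus> y \<in> I"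
  by (simp add: additive_subgroup.a_closed ideal.axioms(1))

lemma ideal_minus: "ideal I R \<Longrightarrow> x \<in> I \<Longrightarrow> y \<in> I \<Longrightarrow> x \<ominus> y \<in> I"
  by (simp add: a_minus_def additive_subgroup.a_closed additive_subgroup.a_inv_closed ideal.axioms(1))

text \<open>The ideals contained in the ideal \<open>W\<close> carry a strict rank; that is, \<open>W\<close> has finite length.\<close>

definition finite_height :: "'a set \<Rightarrow> bool" where
  "finite_height W \<longleftrightarrow> (\<exists>\<rho>. strict_rank {I. ideal I R \<and> I \<subseteq> W} \<rho>)"

lemma finite_heightI: "strict_rank {I. ideal I R \<and> I \<subseteq> W} \<rho> \<Longrightarrow> finite_height W"
  unfolding finite_height_def by (rule exI[of _ \<rho>])

lemma kernel_ideal: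
  assumes W: "ideal W R" and a: "a \<in> carrier R"
  shows "ideal {w \<in> W. a \<otimes> w = \<zero>} R"
proof -
  have "a \<otimes> (c \<otimes> x) = c \<otimes> (a \<otimes> x)"
    if "c \<in> carrier R" "x \<in> carrier R" for c x
    using that a by (simp add: m_lcomm)
  then show ?thesis using W a unfolding ideal_iff by (auto simp: r_distr subset_iff)
qed

lemma image_ideal:
  assumes W: "ideal W R" and a: "a \<in> carrier R"
  shows "ideal ((\<lambda>w. a \<otimes> w) ` W) R"
proof -
  have sub: "\<And>w. w \<in> W \<Longrightarrow> w \<in> carrier R" using W unfolding ideal_iff
    by blast
  have "c \<otimes> (a \<otimes> x) \<in> (\<lambda>w. a \<otimes> w) ` W"
    if "c \<in> carrier R" "x \<in> W" for c x
    using that a W sub unfolding ideal_iff by (auto simp: m_lcomm[of c a x] intro!: imageI)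
  moreover have "a \<otimes> x \<oplus> a \<otimes> y \<in> (\<lambda>w. a \<otimes> w) ` W"
    if "x \<in> W" "y \<in> W" for x y
    using that a W sub unfolding ideal_iff by (auto simp: r_distr[symmetric] intro!: imageI)
  moreover have "\<zero> \<in> (\<lambda>w. a \<otimes> w) ` W"
    using a W unfolding ideal_iff by (auto simp: image_iff intro!: bexI[of _ \<zero>])
  ultimately show ?thesis using sub a unfolding ideal_iff by auto
qed

lemma inter_ideal: "ideal U R \<Longrightarrow> ideal V R \<Longrightarrow> ideal (U \<inter> V) R"
  unfolding ideal_iff by blast

lemma mem_set_add: "x \<in> U <+> V \<longleftrightarrow> (\<exists>u\<in>U. \<exists>v\<in>V. x = u \<oplus> v)"
  by (auto simp: set_add_def')

lemma sum_ideal: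
  assumes U: "ideal U R" and V: "ideal V R"
  shows "ideal (U <+> V) R" "U \<subseteq> U <+> V" "V \<subseteq> U <+> V"
proof -
  show "ideal (U <+> V) R" by (rule add_ideals[OF U V])
  have c: "U \<subseteq> carrier R" "V \<subseteq> carrier R" "\<zero> \<in> U" "\<zero> \<in> V"
    using U V unfolding ideal_iff by auto
  show "U \<subseteq> U <+> V"
  proof
    fix u assume "u \<in> U"
    moreover from this have "u = u \<oplus> \<zero>" using c by auto
    ultimately show "u \<in> U <+> V" using c(4) mem_set_add by blast
  qed
  show "V \<subseteq> U <+> V"
  proof
    fix v assume "v \<in> V"
    moreover from this have "v = \<zero> \<oplus> v" using c by auto
    ultimately show "v \<in> U <+> V" using c(3) mem_set_add by blast
  qed
qed

lemma sum_ideal_least: "ideal W R \<Longrightarrow> U \<subseteq> W \<Longrightarrow> V \<subseteq> W \<Longrightarrow> U <+> V \<subseteq> W"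
  by (auto simp: mem_set_add subset_iff intro!: ideal_add)

text \<open>Multiplication by \<open>a\<close> is an endomorphism of \<open>W\<close>, so this is the additivity of length for its
  kernel and its image.\<close>

lemma finite_height_extension:
  assumes W: "ideal W R" and a: "a \<in> carrier R"
    and im: "finite_height ((\<lambda>w. a \<otimes> w) ` W)"
    and ker: "finite_height {w \<in> W. a \<otimes> w = \<zero>}"
  shows "finite_height W"
proof -
  obtain r where r: "strict_rank {I. ideal I R \<and> I \<subseteq> (\<lambda>w. a \<otimes> w) ` W} r"
    using im by (auto simp: finite_height_def)
  obtain s where s: "strict_rank {I. ideal I R \<and> I \<subseteq> {w \<in> W. a \<otimes> w = \<zero>}} s"
    using ker by (auto simp: finite_height_def)
  let ?K = "{w \<in> W. a \<otimes> w = \<zero>}"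
    and ?f = "\<lambda>U. (\<lambda>w. a \<otimes> w) ` U"
  have "r (?f U) + s (U \<inter> ?K) < r (?f V) + s (V \<inter> ?K)"
    if U: "ideal U R" "U \<subseteq> W" and V: "ideal V R" "V \<subseteq> W"
    and UV: "U \<subset> V" for U V
  proof -
    have 1: "?f U \<in> {I. ideal I R \<and> I \<subseteq> ?f W}" "?f V \<in> {I. ideal I R \<and> I \<subseteq> ?f W}"
      using image_ideal a U V by auto
    have 2: "U \<inter> ?K \<in> {I. ideal I R \<and> I \<subseteq> ?K}" "V \<inter> ?K \<in> {I. ideal I R \<and> I \<subseteq> ?K}"
      using inter_ideal[OF _ kernel_ideal[OF W a]] U V by auto
    have le: "r (?f U) \<le> r (?f V)" "s (U \<inter> ?K) \<le> s (V \<inter> ?K)"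
      using strict_rank_mono[OF r 1] strict_rank_mono[OF s 2] UV by auto
    have "?f U \<noteq> ?f V \<or> U \<inter> ?K \<noteq> V \<inter> ?K"
    proof (rule ccontr)
      assume "\<not> ?thesis"
      then have eq: "?f U = ?f V" "U \<inter> ?K = V \<inter> ?K" by auto
      have "V \<subseteq> U"
      proof
        fix v assume v: "v \<in> V"
        have c: "\<And>z. z \<in> V \<Longrightarrow> z \<in> carrier R" using V unfolding ideal_iff
          by auto
        obtain u where u: "u \<in> U" "a \<otimes> v = a \<otimes> u" using eq(1) v by blast
        have uv: "u \<in> carrier R" "v \<in> carrier R" using u v UV c by auto
        have "v \<ominus> u \<in> V" using ideal_minus[OF V(1)] u v UV by blast
        moreover have "a \<otimes> (v \<ominus> u) = \<zero>" using u(2) uv a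
          by (simp add: r_distr a_minus_def r_minus r_neg)
        ultimately have "v \<ominus> u \<in> U" using eq(2) V(2) by blast
        then have "(v \<ominus> u) \<oplus> u \<in> U" using U(1) u(1) unfolding ideal_iff by blast
        then show "v \<in> U" using uv by (simp add: a_minus_def a_assoc l_neg)
      qed
      then show False using UV by blast
    qed
    moreover have "?f U \<subseteq> ?f V" "U \<inter> ?K \<subseteq> V \<inter> ?K" using UV by auto
    ultimately have "r (?f U) < r (?f V) \<or> s (U \<inter> ?K) < s (V \<inter> ?K)"
      using strict_rankD[OF r 1] strict_rankD[OF s 2] by blast
    then show ?thesis using le by linarith
  qed
  then have "strict_rank {I. ideal I R \<and> I \<subseteq> W} (\<lambda>U. r (?f U) + s (U \<inter> ?K))"
    unfolding strict_rank_def by blast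
  then show ?thesis by (rule finite_heightI)
qed

text \<open>The Akizuki--Hopkins theorem. Take a minimal ideal \<open>W\<close> of infinite length. By minimality every
  ring element acts on \<open>W\<close> as zero or surjectively,
    and in the second case invertibly, by the
  descending chain condition for its powers. So \<open>W\<close> is a vector space over a residue field. A
  hyperplane of \<open>W\<close> has finite length by minimality, hence so has \<open>W\<close>.\<close>

theorem artinian_imp_finite_height:
  assumes art: "artinian_ring R"
  shows "finite_height (carrier R)"
proof (rule ccontr)
  assume "\<not> ?thesis"
  then obtain W where W: "ideal W R" "\<not> finite_height W"
    and min: "\<And>V. ideal V R \<Longrightarrow> V \<subset> W \<Longrightarrow> finite_height V"
    using artinian_minimal[OF art, of "carrier R" "\<lambda>I. \<not> finite_height I"] oneideal
    by blast
  have Wc: "\<And>w. w \<in> W \<Longrightarrow> w \<in> carrier R" using W unfolding ideal_iff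
    by auto
  \<comment> \<open>by minimality of \<open>W\<close>, image and kernel of \<open>a\<close> on \<open>W\<close> cannot both be proper\<close>
  have dich: "(\<forall>w\<in>W. a \<otimes> w = \<zero>) \<or> (\<lambda>w. a \<otimes> w) ` W = W"
    if a: "a \<in> carrier R" for a
  proof (rule ccontr)
    assume c: "\<not> ?thesis"
    have "(\<lambda>w. a \<otimes> w) ` W \<subset> W" using c W a unfolding ideal_iff by auto
    moreover have "{w \<in> W. a \<otimes> w = \<zero>} \<subset> W" using c by auto
    ultimately show False
      using finite_height_extension[OF W(1) a] min image_ideal[OF W(1) a] kernel_ideal[OF W(1) a] W(2)
      by blast
  qed
  have inv: "\<exists>b\<in>carrier R. \<forall>w\<in>W. b \<otimes> (a \<otimes> w) = w"
    if a: "a \<in> carrier R" and nz: "\<not> (\<forall>w\<in>W. a \<otimes> w = \<zero>)" for a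
  proof -
    have sur: "(\<lambda>w. a \<otimes> w) ` W = W" using dich[OF a] nz by blast
    have pw: "\<exists>w'\<in>W. w = a [^] n \<otimes> w'" if "w \<in> W" for w and n :: nat
      using that
    proof (induction n arbitrary: w)
      case 0 then show ?case using Wc by auto
    next
      case (Suc n)
      then obtain w' where w': "w' \<in> W" "w = a [^] n \<otimes> w'" by blast
      obtain w'' where "w'' \<in> W" "w' = a \<otimes> w''" using w'(1) sur by blast
      then show ?case using w' a Wc by (auto simp: m_assoc intro!: bexI[of _ w''])
    qed
    define J where "J n = (\<lambda>r. a [^] n \<otimes> r) ` carrier R" for n :: nat
    have "\<And>n. ideal (J n) R" unfolding J_def using image_ideal[OF oneideal] a by simp
    moreover have "\<And>n. J (Suc n) \<subseteq> J n" unfolding J_def using a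
      by (auto simp: m_assoc intro!: imageI)
    ultimately have "\<exists>n. \<forall>j\<ge>n. J j = J n" by (rule artinian_chain[OF art])
    then obtain n where n: "J (Suc n) = J n" using le_Suc_eq by blast
    have "a [^] n \<in> J n" unfolding J_def using a
      by (auto simp: image_iff intro!: bexI[of _ \<one>])
    then have "a [^] n \<in> (\<lambda>r. a [^] Suc n \<otimes> r) ` carrier R" using n unfolding J_def
      by metis
    then obtain b where b: "b \<in> carrier R" "a [^] n = a [^] Suc n \<otimes> b" by blast
    have "b \<otimes> (a \<otimes> w) = w" if w: "w \<in> W" for w
    proof -
      obtain w' where w': "w' \<in> W" "w = a [^] n \<otimes> w'" using pw[OF w] by blast
      have c: "w' \<in> carrier R" using w' Wc by auto
      have "b \<otimes> (a \<otimes> w) = (a [^] Suc n \<otimes> b) \<otimes> w'"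
        using w' a b(1) c by (simp add: m_ac)
      also have "\<dots> = w" by (simp only: b(2)[symmetric] w'(2))
      finally show ?thesis .
    qed
    then show ?thesis using b by blast
  qed
  have "W \<noteq> {\<zero>}"
  proof
    assume "W = {\<zero>}"
    then have "strict_rank {I. ideal I R \<and> I \<subseteq> W} (\<lambda>_. 0)"
      unfolding strict_rank_def ideal_iff by blast
    then have "finite_height W" by (rule finite_heightI)
    then show False using W(2) by simp
  qed
  then obtain x where x: "x \<in> W" "x \<noteq> \<zero>" using W unfolding ideal_iff by blast
  let ?S = "{I. ideal I R \<and> I \<subseteq> W \<and> x \<notin> I}"
  \<comment> \<open>\<open>W\<close> is a vector space over a residue field; \<open>H\<close> is a hyperplane in it.\<close>
  obtain H where H: "H \<in> ?S"
    and Hmax: "\<And>X. X \<in> ?S \<Longrightarrow> H \<subseteq> X \<Longrightarrow> X = H"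
  proof -
    have "\<exists>M\<in>?S. \<forall>X\<in>?S. M \<subseteq> X \<longrightarrow> X = M"
    proof (rule subset_Zorn_nonempty)
      have "{\<zero>} \<in> ?S" using x W zeroideal unfolding ideal_iff by auto
      then show "?S \<noteq> {}" by blast
      show "\<Union>C \<in> ?S" if "C \<noteq> {}" and ch: "subset.chain ?S C" for C
      proof -
        have CS: "\<And>U. U \<in> C \<Longrightarrow> U \<in> ?S"
          and tot: "\<And>U V. U \<in> C \<Longrightarrow> V \<in> C \<Longrightarrow> U \<subseteq> V \<or> V \<subseteq> U"
          using ch unfolding subset.chain_def by auto
        have "u \<oplus> v \<in> \<Union>C"
          if uv: "u \<in> U" "U \<in> C" "v \<in> V" "V \<in> C" for u v U V
        proof -
          obtain T where T: "T \<in> C" "u \<in> T" "v \<in> T" using tot[OF uv(2,4)] uv by blast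
          then have "u \<oplus> v \<in> T" using CS[OF T(1)] unfolding ideal_iff by simp
          then show ?thesis using T(1) by blast
        qed
        moreover have "\<zero> \<in> \<Union>C" using CS \<open>C \<noteq> {}\<close> unfolding ideal_iff
          by auto
        moreover have "c \<otimes> u \<in> \<Union>C"
          if "c \<in> carrier R" "u \<in> U" "U \<in> C" for c u U
          using CS[OF that(3)] that(1,2,3) ideal.I_l_closed[of U R u c] by auto
        moreover have "\<Union>C \<subseteq> carrier R" using CS unfolding ideal_iff by blast
        ultimately have "ideal (\<Union>C) R" unfolding ideal_iff by blast
        moreover have "\<Union>C \<subseteq> W" "x \<notin> \<Union>C" using CS by auto
        ultimately show ?thesis by simp
      qed
    qed
    then show thesis using that by (elim bexE) simp
  qed
  have HI: "ideal H R" "H \<subseteq> W" "x \<notin> H" using H by auto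
  have sumW: "W \<subseteq> U <+> H" (is "_ \<subseteq> ?T")
    if U: "ideal U R" "U \<subseteq> W" "\<not> U \<subseteq> H" for U
  proof
    fix w assume w: "w \<in> W"
    have T: "ideal ?T R" using sum_ideal(1)[OF U(1) HI(1)] .
    have Uc: "\<And>z. z \<in> U \<Longrightarrow> z \<in> carrier R"
      and Hc: "\<And>z. z \<in> H \<Longrightarrow> z \<in> carrier R"
      using U(2) HI(2) Wc by auto
    have UT: "U \<subseteq> ?T" and HT: "H \<subseteq> ?T"
      using sum_ideal(2,3)[OF U(1) HI(1)] by auto
    have TW: "?T \<subseteq> W" by (rule sum_ideal_least[OF W(1) U(2) HI(2)])
    have xT: "x \<in> ?T"
    proof (rule ccontr)
      assume "x \<notin> ?T"
      then have "?T = H" using T TW HT by (intro Hmax) auto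
      then show False using UT U(3) by simp
    qed
    show "w \<in> ?T"
    proof (cases "w \<in> H")
      case True then show ?thesis using HT by blast
    next
      case False
      let ?P = "(\<lambda>c. w \<otimes> c) ` carrier R"
      have P: "ideal ?P R" using image_ideal[OF oneideal] w Wc by auto
      let ?Q = "?P <+>\<^bsub>R\<^esub> H"
      have Q: "ideal ?Q R" using sum_ideal(1)[OF P HI(1)] .
      have wc: "w \<in> carrier R" using w Wc by auto
      have PW: "?P \<subseteq> W" using W(1) w wc unfolding ideal_iff by (auto simp: m_comm)
      have QW: "?Q \<subseteq> W" by (rule sum_ideal_least[OF W(1) PW HI(2)])
      have "w \<in> ?P" using wc by (auto simp: image_iff intro!: bexI[of _ \<one>])
      then have wQ: "w \<in> ?Q" and HQ: "H \<subseteq> ?Q" using sum_ideal(2,3)[OF P HI(1)] by auto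
      have "x \<in> ?Q"
      proof (rule ccontr)
        assume "x \<notin> ?Q"
        then have "?Q = H" using Q QW HQ by (intro Hmax) auto
        then show False using wQ False by simp
      qed
      then obtain a h where ah: "a \<in> carrier R" "h \<in> H" "x = w \<otimes> a \<oplus> h"
        by (auto simp: mem_set_add)
      have hc: "h \<in> carrier R" using ah Hc by auto
      have "w \<otimes> a \<noteq> \<zero>" using ah(2,3) hc HI(3) by auto
      then have "\<not> (\<forall>w\<in>W. a \<otimes> w = \<zero>)" using w m_comm[OF wc ah(1)]
        by auto
      then obtain b where b: "b \<in> carrier R" "\<forall>w\<in>W. b \<otimes> (a \<otimes> w) = w"
        using inv ah(1) by blast
      have "w = b \<otimes> (x \<ominus> h)"
        using b w wc ah hc by (auto simp: a_minus_def a_assoc r_neg m_comm[of w a])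
      moreover have "x \<ominus> h \<in> ?T" using ideal_minus[OF T xT] HT ah(2) by blast
      ultimately show ?thesis using T b(1) unfolding ideal_iff by blast
    qed
  qed
  obtain r where r: "strict_rank {I. ideal I R \<and> I \<subseteq> H} r"
    using min[OF HI(1)] HI x by (auto simp: finite_height_def)
  have "r (U \<inter> H) + (if U \<subseteq> H then 0 else 1) < r (V \<inter> H) + (if V \<subseteq> H then 0 else 1 :: nat)"
    if U: "ideal U R" "U \<subseteq> W" and V: "ideal V R" "V \<subseteq> W"
    and UV: "U \<subset> V" for U V
  proof -
    have 1: "U \<inter> H \<in> {I. ideal I R \<and> I \<subseteq> H}" "V \<inter> H \<in> {I. ideal I R \<and> I \<subseteq> H}"
      using inter_ideal HI U V by auto
    show ?thesis
    proof (cases "U \<inter> H = V \<inter> H")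
      case False
      then have "r (U \<inter> H) < r (V \<inter> H)" using strict_rankD[OF r 1] UV by blast
      then show ?thesis using UV by auto
    next
      case True
      have "U \<subseteq> H"
      proof (rule ccontr)
        assume n: "\<not> U \<subseteq> H"
        have "V \<subseteq> U"
        proof
          fix v assume v: "v \<in> V"
          then obtain u h where uh: "u \<in> U" "h \<in> H" "v = u \<oplus> h"
            using sumW[OF U n] V(2) mem_set_add by blast
          have c: "u \<in> carrier R" "h \<in> carrier R" using uh U(2) HI(2) Wc by auto
          have "v \<ominus> u \<in> V" using ideal_minus[OF V(1)] v uh UV by blast
          moreover have "v \<ominus> u = h" using c uh
            by (simp add: a_minus_def a_comm[of u h] a_assoc r_neg)
          ultimately have "h \<in> U" using uh True by blast
          then show "v \<in> U" using uh U(1) unfolding ideal_iff by blast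
        qed
        then show False using UV by blast
      qed
      moreover from this have "\<not> V \<subseteq> H" using True UV by blast
      ultimately show ?thesis using True by simp
    qed
  qed
  then have "strict_rank {I. ideal I R \<and> I \<subseteq> W} (\<lambda>U. r (U \<inter> H) + (if U \<subseteq> H then 0 else 1))"
    unfolding strict_rank_def by blast
  then have "finite_height W" by (rule finite_heightI)
  then show False using W(2) by simp
qed

end

section \<open>Modules over an Artin algebra have finite length\<close>

context left_module
begin

lemma smult_l_null [simp]: "x \<in> carrier M \<Longrightarrow> \<zero> \<odot>\<^bsub>M\<^esub> x = \<zero>\<^bsub>M\<^esub>"
  using smult_l_distr[of \<zero> \<zero> x]
  by (metis M.add.r_cancel_one' R.r_zero R.zero_closed smult_closed)

lemma smult_r_null [simp]: "a \<in> carrier R \<Longrightarrow> a \<odot>\<^bsub>M\<^esub> \<zero>\<^bsub>M\<^esub> = \<zero>\<^bsub>M\<^esub>"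
  using smult_r_distr[of a "\<zero>\<^bsub>M\<^esub>" "\<zero>\<^bsub>M\<^esub>"]
  by (metis M.add.r_cancel_one' M.r_zero M.zero_closed smult_closed)

lemma smult_minus_one: "x \<in> carrier M \<Longrightarrow> (\<ominus> \<one>) \<odot>\<^bsub>M\<^esub> x = \<ominus>\<^bsub>M\<^esub> x"
  using smult_l_distr[of "\<ominus> \<one>" \<one> x] by (simp add: R.l_neg M.minus_equality)

lemma submodule_iff:
  "submodule U R M \<longleftrightarrow> U \<subseteq> carrier M \<and> \<zero>\<^bsub>M\<^esub> \<in> U \<and> (\<forall>x\<in>U. \<forall>y\<in>U. x \<oplus>\<^bsub>M\<^esub> y \<in> U)
     \<and> (\<forall>a\<in>carrier R. \<forall>x\<in>U. a \<odot>\<^bsub>M\<^esub> x \<in> U)" (is "_ \<longleftrightarrow> ?r")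
proof
  assume "submodule U R M"
  then interpret submodule U R M .
  show ?r using subset one_closed m_closed smult_closed by auto
next
  assume r: ?r
  show "submodule U R M"
  proof (intro submodule.intro submodule_axioms.intro)
    show "subgroup U (add_monoid M)"
    proof (rule M.add.subgroupI)
      fix a assume "a \<in> U"
      moreover from this have "\<ominus>\<^bsub>M\<^esub> a = \<ominus> \<one> \<odot>\<^bsub>M\<^esub> a"
        using r smult_minus_one by auto
      ultimately show "\<ominus>\<^bsub>M\<^esub> a \<in> U" using r by simp
    qed (use r in auto)
  qed (use r in simp)
qed

end

lemma (in abelian_monoid) finsum_mem:
  assumes "finite F" "f \<in> F \<rightarrow> P" "P \<subseteq> carrier G" "\<zero> \<in> P" "\<And>x y. x \<in> P \<Longrightarrow> y \<in> P \<Longrightarrow> x \<oplus> y \<in> P"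
  shows "finsum G f F \<in> P"
  using assms(1,2)
proof (induction F)
  case empty then show ?case using assms by simp
next
  case (insert x F)
  moreover from this have "f \<in> F \<rightarrow> carrier G" "f x \<in> carrier G" using assms(3)
    by auto
  ultimately show ?case using assms(5) by auto
qed

text \<open>Finite generation in terms of submodules instead of linear combinations.\<close>

lemma (in left_module) finitely_generated_iff:
  "finitely_generated R M \<longleftrightarrow>
     (\<exists>S. finite S \<and> S \<subseteq> carrier M \<and> (\<forall>U. submodule U R M \<longrightarrow> S \<subseteq> U \<longrightarrow> U = carrier M))"
  (is "?l \<longleftrightarrow> ?r")
proof
  assume ?l
  then obtain S where S: "finite S" "S \<subseteq> carrier M"
    and gen: "\<And>x. x \<in> carrier M \<Longrightarrow> \<exists>c\<in>S \<rightarrow> carrier R. x = (\<Oplus>\<^bsub>M\<^esub>s\<in>S. c s \<odot>\<^bsub>M\<^esub> s)"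
    unfolding finitely_generated_def by blast
  have "x \<in> U" if U: "submodule U R M" "S \<subseteq> U" and x: "x \<in> carrier M" for U x
  proof -
    obtain c where c: "c \<in> S \<rightarrow> carrier R" "x = (\<Oplus>\<^bsub>M\<^esub>s\<in>S. c s \<odot>\<^bsub>M\<^esub> s)" using gen[OF x]
      by blast
    show ?thesis unfolding c(2)
    proof (rule M.finsum_mem[OF S(1)])
      show "(\<lambda>s. c s \<odot>\<^bsub>M\<^esub> s) \<in> S \<rightarrow> U"
        using c(1) U by (fastforce simp: submodule_iff)
    qed (use U in \<open>auto simp: submodule_iff\<close>)
  qed
  moreover have "U \<subseteq> carrier M" if "submodule U R M" for U using that
    by (simp add: submodule_iff)
  ultimately show ?r using S by (intro exI[of _ S]) blast
next
  assume ?r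
  then obtain S where S: "finite S" "S \<subseteq> carrier M"
    and gen: "\<And>U. submodule U R M \<Longrightarrow> S \<subseteq> U \<Longrightarrow> U = carrier M"
    by blast
  define U where "U = {\<Oplus>\<^bsub>M\<^esub>s\<in>S. c s \<odot>\<^bsub>M\<^esub> s |c. c \<in> S \<rightarrow> carrier R}"
  have UI: "(\<Oplus>\<^bsub>M\<^esub>s\<in>S. c s \<odot>\<^bsub>M\<^esub> s) \<in> U"
    if "c \<in> S \<rightarrow> carrier R" for c
    using that unfolding U_def by blast
  have cl: "(\<lambda>s. c s \<odot>\<^bsub>M\<^esub> s) \<in> S \<rightarrow> carrier M"
    if "c \<in> S \<rightarrow> carrier R" for c
    using that S(2) by auto
  have sm: "a \<odot>\<^bsub>M\<^esub> (\<Oplus>\<^bsub>M\<^esub>s\<in>F. c s \<odot>\<^bsub>M\<^esub> s) = (\<Oplus>\<^bsub>M\<^esub>s\<in>F. (a \<otimes> c s) \<odot>\<^bsub>M\<^esub> s)"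
    if "finite F" "F \<subseteq> S" "a \<in> carrier R" "c \<in> S \<rightarrow> carrier R" for a c F
    using that(1,2)
  proof (induction F)
    case empty then show ?case using that by simp
  next
    case (insert s F)
    have "(\<lambda>s. c s \<odot>\<^bsub>M\<^esub> s) \<in> F \<rightarrow> carrier M" "(\<lambda>s. (a \<otimes> c s) \<odot>\<^bsub>M\<^esub> s) \<in> F \<rightarrow> carrier M"
      "s \<in> carrier M" "c s \<in> carrier R"
      using that(3,4) insert.prems S(2) by (auto simp: Pi_iff subset_iff)
    then show ?case using insert that(3) by (simp add: smult_r_distr smult_assoc1)
  qed
  have "submodule U R M"
    unfolding submodule_iff
  proof (intro conjI ballI)
    show "U \<subseteq> carrier M" unfolding U_def using M.finsum_closed[OF cl] by blast
    have "(\<Oplus>\<^bsub>M\<^esub>s\<in>S. \<zero> \<odot>\<^bsub>M\<^esub> s) = \<zero>\<^bsub>M\<^esub>"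
      using S(2)
      by (subst M.finsum_cong'[of S S "\<lambda>_. \<zero>\<^bsub>M\<^esub>"]) (auto simp: subset_iff)
    then show "\<zero>\<^bsub>M\<^esub> \<in> U" using UI[of "\<lambda>_. \<zero>"] by simp
  next
    fix x y assume "x \<in> U" "y \<in> U"
    then obtain c d where c: "c \<in> S \<rightarrow> carrier R" "x = (\<Oplus>\<^bsub>M\<^esub>s\<in>S. c s \<odot>\<^bsub>M\<^esub> s)"
      and d: "d \<in> S \<rightarrow> carrier R" "y = (\<Oplus>\<^bsub>M\<^esub>s\<in>S. d s \<odot>\<^bsub>M\<^esub> s)" unfolding U_def
      by blast
    have "x \<oplus>\<^bsub>M\<^esub> y = (\<Oplus>\<^bsub>M\<^esub>s\<in>S. c s \<odot>\<^bsub>M\<^esub> s \<oplus>\<^bsub>M\<^esub> d s \<odot>\<^bsub>M\<^esub> s)"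
      unfolding c d by (rule M.finsum_addf[symmetric]) (use cl c d in auto)
    also have "\<dots> = (\<Oplus>\<^bsub>M\<^esub>s\<in>S. (c s \<oplus> d s) \<odot>\<^bsub>M\<^esub> s)"
      by (rule M.finsum_cong') (use c d S(2) in \<open>auto simp: smult_l_distr Pi_iff subset_iff\<close>)
    finally show "x \<oplus>\<^bsub>M\<^esub> y \<in> U" using UI[of "\<lambda>s. c s \<oplus> d s"] c d
      by auto
  next
    fix a x assume a: "a \<in> carrier R" and "x \<in> U"
    then obtain c where c: "c \<in> S \<rightarrow> carrier R" "x = (\<Oplus>\<^bsub>M\<^esub>s\<in>S. c s \<odot>\<^bsub>M\<^esub> s)"
      unfolding U_def by blast
    show "a \<odot>\<^bsub>M\<^esub> x \<in> U"
      using sm[OF S(1) subset_refl a c(1)] UI[of "\<lambda>s. a \<otimes> c s"] a c by auto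
  qed
  moreover have "S \<subseteq> U"
  proof
    fix s assume s: "s \<in> S"
    have "s = (\<Oplus>\<^bsub>M\<^esub>t\<in>S. if s = t then t else \<zero>\<^bsub>M\<^esub>)"
      using M.finsum_singleton[OF s S(1), of "\<lambda>t. t"] S(2) by (auto simp: Pi_def subset_iff)
    also have "\<dots> = (\<Oplus>\<^bsub>M\<^esub>t\<in>S. (if s = t then \<one> else \<zero>) \<odot>\<^bsub>M\<^esub> t)"
      by (rule M.finsum_cong') (use S(2) in auto)
    finally show "s \<in> U" using UI[of "\<lambda>t. if s = t then \<one> else \<zero>"] by auto
  qed
  ultimately have "U = carrier M" by (rule gen)
  then show ?l unfolding finitely_generated_def U_def using S by (intro exI[of _ S]) blast
qed

text \<open>A module that is finitely generated over the algebra is finitely generated over \<open>k\<close>. For generators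
  \<open>x\<^sub>1, \<dots>, x\<^sub>n\<close> over \<open>k\<close>, a submodule \<open>U\<close> gets the sum of the ranks of the ideals
  \<open>{c. c x\<^sub>i \<in> U + span(x\<^sub>1, \<dots>, x\<^sub>i\<^sub>-\<^sub>1)}\<close>.\<close>

lemma artin_algebra_finite_height:
  fixes k :: "('k, 'z) ring_scheme" and A :: "('k, 'a, 'y) module_scheme"
    and M :: "('a, 'm, 'x) module_scheme"
  assumes alg: "artin_algebra k A" and M: "left_module A M" and fg: "finitely_generated A M"
  shows "\<exists>\<rho>. strict_rank {U. submodule U A M} \<rho>"
proof -
  interpret k: cring k using alg by (simp add: artin_algebra_def Module.module_def)
  interpret artin_algebra k A by (rule alg)
  interpret M: left_module A M by (rule M)
  obtain r where r: "strict_rank {I. ideal I k \<and> I \<subseteq> carrier k} r"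
    using k.artinian_imp_finite_height[OF artinian] unfolding k.finite_height_def by blast
  \<comment> \<open>the action of \<open>k\<close> on \<open>M\<close>; \<open>ksub\<close> below singles out the \<open>k\<close>-submodules\<close>
  define act where "act c x = (c \<odot>\<^bsub>A\<^esub> \<one>\<^bsub>A\<^esub>) \<odot>\<^bsub>M\<^esub> x" for c x
  have act_closed [simp]: "act c x \<in> carrier M"
    if "c \<in> carrier k" "x \<in> carrier M" for c x
    using that by (simp add: act_def)
  have act_add: "act (c \<oplus>\<^bsub>k\<^esub> d) x = act c x \<oplus>\<^bsub>M\<^esub> act d x"
    if "c \<in> carrier k" "d \<in> carrier k" "x \<in> carrier M" for c d x
    using that by (simp add: act_def smult_l_distr M.smult_l_distr)
  have act_add2: "act c (x \<oplus>\<^bsub>M\<^esub> y) = act c x \<oplus>\<^bsub>M\<^esub> act c y"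
    if "c \<in> carrier k" "x \<in> carrier M" "y \<in> carrier M" for c x y
    using that by (simp add: act_def M.smult_r_distr)
  have act_act: "act c (act d x) = act (c \<otimes>\<^bsub>k\<^esub> d) x"
    if "c \<in> carrier k" "d \<in> carrier k" "x \<in> carrier M" for c d x
    using that by (simp add: act_def smult_assoc1 smult_mult_left M.smult_assoc1[symmetric])
  have act_one: "act \<one>\<^bsub>k\<^esub> x = x" if "x \<in> carrier M" for x using that
    by (simp add: act_def)
  have act_zero: "act \<zero>\<^bsub>k\<^esub> x = \<zero>\<^bsub>M\<^esub>" if "x \<in> carrier M" for x
    using that by (simp add: act_def)
  have act_zero2: "act c \<zero>\<^bsub>M\<^esub> = \<zero>\<^bsub>M\<^esub>" if "c \<in> carrier k" for c
    using that by (simp add: act_def)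
  define ksub where "ksub P \<longleftrightarrow> P \<subseteq> carrier M \<and> \<zero>\<^bsub>M\<^esub> \<in> P \<and> (\<forall>x\<in>P. \<forall>y\<in>P. x \<oplus>\<^bsub>M\<^esub> y \<in> P)
    \<and> (\<forall>c\<in>carrier k. \<forall>x\<in>P. act c x \<in> P)" for P
  have ksub_sub: "\<And>P x. ksub P \<Longrightarrow> x \<in> P \<Longrightarrow> x \<in> carrier M"
    and ksub_zero: "\<And>P. ksub P \<Longrightarrow> \<zero>\<^bsub>M\<^esub> \<in> P"
    and ksub_add: "\<And>P x y. ksub P \<Longrightarrow> x \<in> P \<Longrightarrow> y \<in> P \<Longrightarrow> x \<oplus>\<^bsub>M\<^esub> y \<in> P"
    and ksub_act: "\<And>P c x. ksub P \<Longrightarrow> c \<in> carrier k \<Longrightarrow> x \<in> P \<Longrightarrow> act c x \<in> P"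
    unfolding ksub_def by auto
  have act_minus: "act (\<ominus>\<^bsub>k\<^esub> \<one>\<^bsub>k\<^esub>) x \<oplus>\<^bsub>M\<^esub> x = \<zero>\<^bsub>M\<^esub>"
    if "x \<in> carrier M" for x
    using act_add[of "\<ominus>\<^bsub>k\<^esub> \<one>\<^bsub>k\<^esub>" "\<one>\<^bsub>k\<^esub>" x] that
    by (simp add: act_one act_zero k.l_neg)
  have ksub_neg: "\<ominus>\<^bsub>M\<^esub> x \<in> P" if "ksub P" "x \<in> P" for P x
  proof -
    have x: "x \<in> carrier M" using ksub_sub that by blast
    have "\<ominus>\<^bsub>M\<^esub> x = act (\<ominus>\<^bsub>k\<^esub> \<one>\<^bsub>k\<^esub>) x"
      by (rule M.M.minus_equality) (use act_minus x in auto)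
    then show ?thesis
      using ksub_act[OF that(1), of "\<ominus>\<^bsub>k\<^esub> \<one>\<^bsub>k\<^esub>" x] that
      by simp
  qed
  have sub_ksub: "ksub U" if "submodule U A M" for U
    using that unfolding M.submodule_iff ksub_def act_def by auto
  \<comment> \<open>\<open>P\<close> contains the \<open>k\<close>-span of the list \<open>xs\<close>, and \<open>\<rho>\<close> detects the difference of submodules inside \<open>P\<close>\<close>
  have main: "\<exists>P \<rho>. ksub P \<and> set xs \<subseteq> P \<and> (\<forall>U V. ksub U \<longrightarrow> ksub V \<longrightarrow> U \<subseteq> V \<longrightarrow>
      \<rho> U \<le> \<rho> V \<and> (\<not> V \<inter> P \<subseteq> U \<longrightarrow> \<rho> U < (\<rho> V :: nat)))"
    if "set xs \<subseteq> carrier M" for xs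
    using that
  proof (induction xs)
    case Nil
    show ?case
      by (rule exI[of _ "{\<zero>\<^bsub>M\<^esub>}"], rule exI[of _ "\<lambda>_. 0"])
         (auto simp: ksub_def act_zero2)
  next
    case (Cons x xs)
    then obtain P \<rho> where P: "ksub P" "set xs \<subseteq> P"
      and \<rho>0: "\<forall>U V. ksub U \<longrightarrow> ksub V \<longrightarrow> U \<subseteq> V \<longrightarrow>
        \<rho> U \<le> \<rho> V \<and> (\<not> V \<inter> P \<subseteq> U \<longrightarrow> \<rho> U < (\<rho> V :: nat))"
      by auto
    have \<rho>: "\<And>U V. ksub U \<Longrightarrow> ksub V \<Longrightarrow> U \<subseteq> V \<Longrightarrow> \<rho> U \<le> \<rho> V"
        "\<And>U V. ksub U \<Longrightarrow> ksub V \<Longrightarrow> U \<subseteq> V \<Longrightarrow> \<not> V \<inter> P \<subseteq> U \<Longrightarrow> \<rho> U < (\<rho> V :: nat)"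
      using \<rho>0 by blast+
    have x: "x \<in> carrier M" using Cons.prems by simp
    define Q where "Q = {act c x \<oplus>\<^bsub>M\<^esub> p |c p. c \<in> carrier k \<and> p \<in> P}"
    have QI: "act c x \<oplus>\<^bsub>M\<^esub> p \<in> Q" if "c \<in> carrier k" "p \<in> P" for c p
      using that unfolding Q_def by blast
    have PM: "\<And>p. p \<in> P \<Longrightarrow> p \<in> carrier M" using ksub_sub[OF P(1)] .
    have sum_eq: "(act c x \<oplus>\<^bsub>M\<^esub> p) \<oplus>\<^bsub>M\<^esub> (act d x \<oplus>\<^bsub>M\<^esub> q) = act (c \<oplus>\<^bsub>k\<^esub> d) x \<oplus>\<^bsub>M\<^esub> (p \<oplus>\<^bsub>M\<^esub> q)"
      if "c \<in> carrier k" "d \<in> carrier k" "p \<in> P" "q \<in> P" for c d p q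
      using that x PM by (simp add: act_add M.M.a_ac)
    have act_eq: "act e (act c x \<oplus>\<^bsub>M\<^esub> p) = act (e \<otimes>\<^bsub>k\<^esub> c) x \<oplus>\<^bsub>M\<^esub> act e p"
      if "c \<in> carrier k" "e \<in> carrier k" "p \<in> P" for c e p
      using that x PM by (simp add: act_add2 act_act)
    have Q: "ksub Q"
      unfolding ksub_def
    proof (intro conjI ballI)
      show "Q \<subseteq> carrier M" unfolding Q_def using x PM by auto
      show "\<zero>\<^bsub>M\<^esub> \<in> Q"
        using QI[of "\<zero>\<^bsub>k\<^esub>" "\<zero>\<^bsub>M\<^esub>"] ksub_zero[OF P(1)] x
        by (simp add: act_zero)
    next
      fix u v assume "u \<in> Q" "v \<in> Q"
      then show "u \<oplus>\<^bsub>M\<^esub> v \<in> Q"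
        unfolding Q_def using sum_eq ksub_add[OF P(1)] k.add.m_closed by blast
    next
      fix e u assume "e \<in> carrier k" "u \<in> Q"
      then show "act e u \<in> Q"
        unfolding Q_def using act_eq ksub_act[OF P(1)] k.m_closed by blast
    qed
    define I where "I U = {c \<in> carrier k. \<exists>p\<in>P. act c x \<oplus>\<^bsub>M\<^esub> p \<in> U}" for U
    have I: "ideal (I U) k" if U: "ksub U" for U
      unfolding k.ideal_iff
    proof (intro conjI ballI)
      show "I U \<subseteq> carrier k" unfolding I_def by blast
      show "\<zero>\<^bsub>k\<^esub> \<in> I U" unfolding I_def
        using ksub_zero[OF U] ksub_zero[OF P(1)] x
        by (auto simp: act_zero intro!: bexI[of _ "\<zero>\<^bsub>M\<^esub>"])
    next
      fix c d assume "c \<in> I U" "d \<in> I U"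
      then obtain p q where "c \<in> carrier k" "d \<in> carrier k" "p \<in> P" "q \<in> P"
        "act c x \<oplus>\<^bsub>M\<^esub> p \<in> U" "act d x \<oplus>\<^bsub>M\<^esub> q \<in> U"
          unfolding I_def by blast
      then show "c \<oplus>\<^bsub>k\<^esub> d \<in> I U"
        unfolding I_def using ksub_add[OF U] sum_eq ksub_add[OF P(1), of p q]
        by (auto intro!: bexI[of _ "p \<oplus>\<^bsub>M\<^esub> q"]) metis
    next
      fix e c assume e: "e \<in> carrier k" and "c \<in> I U"
      then obtain p where "c \<in> carrier k" "p \<in> P" "act c x \<oplus>\<^bsub>M\<^esub> p \<in> U"
        unfolding I_def by blast
      then show "e \<otimes>\<^bsub>k\<^esub> c \<in> I U"
        unfolding I_def using e ksub_act[OF U e] act_eq ksub_act[OF P(1) e, of p]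
        by (auto intro!: bexI[of _ "act e p"]) metis
    qed
    have Isub: "I U \<in> {I. ideal I k \<and> I \<subseteq> carrier k}" if "ksub U" for U
      using I[OF that] unfolding I_def by auto
    have Imono: "I U \<subseteq> I V" if "U \<subseteq> V" for U V using that unfolding I_def
      by blast
    have "\<rho> U + r (I U) \<le> \<rho> V + r (I V) \<and> (\<not> V \<inter> Q \<subseteq> U \<longrightarrow> \<rho> U + r (I U) < \<rho> V + r (I V))"
      if U: "ksub U" and V: "ksub V" and UV: "U \<subseteq> V" for U V
    proof -
      have le: "\<rho> U \<le> \<rho> V" "r (I U) \<le> r (I V)"
        using \<rho>(1)[OF U V UV] strict_rank_mono[OF r Isub[OF U] Isub[OF V] Imono[OF UV]] by auto
      have "\<rho> U < \<rho> V \<or> r (I U) < r (I V)" if n: "\<not> V \<inter> Q \<subseteq> U"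
      proof (rule ccontr)
        assume c: "\<not> ?thesis"
        then have VP: "V \<inter> P \<subseteq> U" using \<rho>(2)[OF U V UV] by blast
        have eq: "I U = I V"
          using strict_rankD[OF r Isub[OF U] Isub[OF V]] Imono[OF UV] c by blast
        have "v \<in> U" if v: "v \<in> V" "v \<in> Q" for v
        proof -
          obtain d p where dp: "d \<in> carrier k" "p \<in> P" "v = act d x \<oplus>\<^bsub>M\<^esub> p"
            using v(2) unfolding Q_def by blast
          then have "d \<in> I V" using v(1) unfolding I_def by blast
          then have "d \<in> I U" using eq by simp
          then obtain q where q: "q \<in> P" "act d x \<oplus>\<^bsub>M\<^esub> q \<in> U" unfolding I_def
            by blast
          let ?u = "act d x \<oplus>\<^bsub>M\<^esub> q"
          have car: "act d x \<in> carrier M" "p \<in> carrier M" "q \<in> carrier M" using dp q x PM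
            by auto
          have e1: "v \<oplus>\<^bsub>M\<^esub> \<ominus>\<^bsub>M\<^esub> ?u = p \<oplus>\<^bsub>M\<^esub> \<ominus>\<^bsub>M\<^esub> q"
            using car unfolding dp(3)
            by (simp add: M.M.minus_add M.M.a_ac M.M.r_neg M.M.r_neg1 M.M.r_neg2)
          have "v \<oplus>\<^bsub>M\<^esub> \<ominus>\<^bsub>M\<^esub> ?u \<in> V"
            using ksub_add[OF V v(1)] ksub_neg[OF V] q(2) UV by blast
          moreover have "p \<oplus>\<^bsub>M\<^esub> \<ominus>\<^bsub>M\<^esub> q \<in> P"
            using ksub_add[OF P(1) dp(2)] ksub_neg[OF P(1) q(1)] by blast
          ultimately have "v \<oplus>\<^bsub>M\<^esub> \<ominus>\<^bsub>M\<^esub> ?u \<in> U" using VP e1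
            by auto
          then have "(v \<oplus>\<^bsub>M\<^esub> \<ominus>\<^bsub>M\<^esub> ?u) \<oplus>\<^bsub>M\<^esub> ?u \<in> U" using ksub_add[OF U] q(2)
            by blast
          moreover have "v \<in> carrier M" "?u \<in> carrier M" using car dp(3) by auto
          ultimately show "v \<in> U" by (simp add: M.M.a_assoc M.M.l_neg)
        qed
        then show False using n by blast
      qed
      then show ?thesis using le by linarith
    qed
    moreover have "set (x # xs) \<subseteq> Q"
    proof -
      have "x \<in> Q" using QI[of "\<one>\<^bsub>k\<^esub>" "\<zero>\<^bsub>M\<^esub>"] ksub_zero[OF P(1)] x
        by (simp add: act_one)
      moreover have "p \<in> Q" if "p \<in> P" for p
        using QI[of "\<zero>\<^bsub>k\<^esub>" p] that x PM by (simp add: act_zero)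
      ultimately show ?thesis using P(2) by auto
    qed
    ultimately show ?case using Q
      by (intro exI[of _ Q] exI[of _ "\<lambda>U. \<rho> U + r (I U)"]) simp
  qed
  obtain T where T: "finite T" "T \<subseteq> carrier A"
    and Tgen: "\<And>a. a \<in> carrier A \<Longrightarrow> \<exists>c\<in>T \<rightarrow> carrier k. a = (\<Oplus>\<^bsub>A\<^esub>t\<in>T. c t \<odot>\<^bsub>A\<^esub> t)"
    using finitely_generated unfolding finitely_generated_def by blast
  obtain S where S: "finite S" "S \<subseteq> carrier M"
    and Sgen: "\<And>x. x \<in> carrier M \<Longrightarrow> \<exists>c\<in>S \<rightarrow> carrier A. x = (\<Oplus>\<^bsub>M\<^esub>s\<in>S. c s \<odot>\<^bsub>M\<^esub> s)"
    using fg unfolding finitely_generated_def by blast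
  let ?X = "(\<lambda>(t, s). t \<odot>\<^bsub>M\<^esub> s) ` (T \<times> S)"
  have "finite ?X" using T S by simp
  then obtain xs where xs: "set xs = ?X" using finite_list by blast
  have "set xs \<subseteq> carrier M" unfolding xs using T S by auto
  then obtain P \<rho> where P: "ksub P" "set xs \<subseteq> P"
    and \<rho>: "\<And>U V. ksub U \<Longrightarrow> ksub V \<Longrightarrow> U \<subseteq> V \<Longrightarrow> \<not> V \<inter> P \<subseteq> U \<Longrightarrow> \<rho> U < (\<rho> V :: nat)"
    using main by metis
  have PM: "P \<subseteq> carrier M" using ksub_sub[OF P(1)] by blast
  have as: "a \<odot>\<^bsub>M\<^esub> s \<in> P" if a: "a \<in> carrier A"
    and s: "s \<in> S" for a s
  proof -
    have sM: "s \<in> carrier M" using s S by auto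
    let ?B = "{b \<in> carrier A. b \<odot>\<^bsub>M\<^esub> s \<in> P}"
    obtain c where c: "c \<in> T \<rightarrow> carrier k" "a = (\<Oplus>\<^bsub>A\<^esub>t\<in>T. c t \<odot>\<^bsub>A\<^esub> t)" using Tgen[OF a]
      by blast
    have "(c t \<odot>\<^bsub>A\<^esub> t) \<odot>\<^bsub>M\<^esub> s \<in> P"
      if t: "t \<in> T" for t
    proof -
      have ct: "c t \<in> carrier k" "t \<in> carrier A" using c(1) t T by auto
      have "act (c t) (t \<odot>\<^bsub>M\<^esub> s) = (c t \<odot>\<^bsub>A\<^esub> t) \<odot>\<^bsub>M\<^esub> s"
        using ct sM by (simp add: act_def smult_mult_left M.smult_assoc1[symmetric])
      moreover have "t \<odot>\<^bsub>M\<^esub> s \<in> P" using P(2) t s unfolding xs by auto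
      ultimately show ?thesis using ksub_act[OF P(1) ct(1)] by metis
    qed
    then have "(\<lambda>t. c t \<odot>\<^bsub>A\<^esub> t) \<in> T \<rightarrow> ?B" using c(1) T
      by auto
    then have "a \<in> ?B" unfolding c(2)
      by (rule finsum_mem[OF T(1)])
         (use sM ksub_zero[OF P(1)] ksub_add[OF P(1)] in \<open>auto simp: M.smult_l_distr\<close>)
    then show ?thesis by simp
  qed
  have MP: "carrier M \<subseteq> P"
  proof
    fix x assume "x \<in> carrier M"
    then obtain c where c: "c \<in> S \<rightarrow> carrier A" "x = (\<Oplus>\<^bsub>M\<^esub>s\<in>S. c s \<odot>\<^bsub>M\<^esub> s)" using Sgen
      by blast
    show "x \<in> P" unfolding c(2)
      by (rule M.M.finsum_mem[OF S(1)])
         (use c(1) as PM ksub_zero[OF P(1)] ksub_add[OF P(1)] in auto)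
  qed
  have "strict_rank {U. submodule U A M} \<rho>"
    unfolding strict_rank_def
  proof (intro ballI impI)
    fix U V assume "U \<in> {U. submodule U A M}" "V \<in> {U. submodule U A M}"
      and UV: "U \<subset> V"
    then have U: "ksub U" and V: "ksub V" using sub_ksub by auto
    have "V \<subseteq> P" using ksub_sub[OF V] MP by blast
    then show "\<rho> U < \<rho> V" using \<rho>[OF U V] UV by blast
  qed
  then show ?thesis by blast
qed

section \<open>Homomorphisms, submodules, biproducts and retracts\<close>

lemma fgmod_left_module: "M \<in> fgmod A \<Longrightarrow> left_module A M"
  by (simp add: fgmod_def)

lemma fgmod_abelian_group: "M \<in> fgmod A \<Longrightarrow> abelian_group M"
  by (simp add: fgmod_def left_module_def)

lemma fgmod_abelian_monoid: "M \<in> fgmod A \<Longrightarrow> abelian_monoid M"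
  using fgmod_abelian_group by (auto simp: abelian_group_def)

lemmas fgmod_closed [simp] =
  abelian_monoid.a_closed[OF fgmod_abelian_monoid] abelian_monoid.zero_closed[OF fgmod_abelian_monoid]
  abelian_group.a_inv_closed[OF fgmod_abelian_group] left_module.smult_closed[OF fgmod_left_module]

lemmas fgmod_zero [simp] =
  abelian_monoid.l_zero[OF fgmod_abelian_monoid] abelian_monoid.r_zero[OF fgmod_abelian_monoid]
  left_module.smult_r_null[OF fgmod_left_module]

lemmas fgmod_neg [simp] =
  abelian_group.l_neg[OF fgmod_abelian_group] abelian_group.r_neg[OF fgmod_abelian_group]
  abelian_group.r_neg1[OF fgmod_abelian_group] abelian_group.r_neg2[OF fgmod_abelian_group]

lemmas fgmod_assoc = abelian_monoid.a_assoc[OF fgmod_abelian_monoid]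
lemmas fgmod_comm = abelian_monoid.a_comm[OF fgmod_abelian_monoid]
lemmas fgmod_lcomm = abelian_monoid.a_lcomm[OF fgmod_abelian_monoid]
lemmas fgmod_ac = fgmod_assoc fgmod_comm fgmod_lcomm
lemmas fgmod_minus_add = abelian_group.minus_add[OF fgmod_abelian_group]
lemmas fgmod_minus_equality = abelian_group.minus_equality[OF fgmod_abelian_group]
lemmas submodule_iff = left_module.submodule_iff[OF fgmod_left_module]

lemma fgmod_diff_add [simp]:
  "M \<in> fgmod A \<Longrightarrow> x \<in> carrier M \<Longrightarrow> y \<in> carrier M \<Longrightarrow> (x \<oplus>\<^bsub>M\<^esub> \<ominus>\<^bsub>M\<^esub> y) \<oplus>\<^bsub>M\<^esub> y = x"
  by (simp add: fgmod_assoc)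

lemma fgmod_diff_zero:
  "M \<in> fgmod A \<Longrightarrow> x \<in> carrier M \<Longrightarrow> y \<in> carrier M \<Longrightarrow> x \<oplus>\<^bsub>M\<^esub> \<ominus>\<^bsub>M\<^esub> y = \<zero>\<^bsub>M\<^esub> \<longleftrightarrow> x = y"
  using fgmod_diff_add[of M A x y] by (metis fgmod_neg(2) fgmod_zero(1))

lemma homI:
  assumes "\<And>x. x \<in> carrier M \<Longrightarrow> f x \<in> carrier N"
    and "\<And>x y. x \<in> carrier M \<Longrightarrow> y \<in> carrier M \<Longrightarrow> f (x \<oplus>\<^bsub>M\<^esub> y) = f x \<oplus>\<^bsub>N\<^esub> f y"
    and "\<And>a x. a \<in> carrier A \<Longrightarrow> x \<in> carrier M \<Longrightarrow> f (a \<odot>\<^bsub>M\<^esub> x) = a \<odot>\<^bsub>N\<^esub> f x"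
  shows "f \<in> lmod_hom A M N"
  using assms by (auto simp: lmod_hom_def)

lemma hom_closed: "f \<in> lmod_hom A M N \<Longrightarrow> x \<in> carrier M \<Longrightarrow> f x \<in> carrier N"
  by (auto simp: lmod_hom_def)

lemma hom_add: "f \<in> lmod_hom A M N \<Longrightarrow> x \<in> carrier M \<Longrightarrow> y \<in> carrier M
    \<Longrightarrow> f (x \<oplus>\<^bsub>M\<^esub> y) = f x \<oplus>\<^bsub>N\<^esub> f y"
  by (auto simp: lmod_hom_def)

lemma hom_smult: "f \<in> lmod_hom A M N \<Longrightarrow> a \<in> carrier A \<Longrightarrow> x \<in> carrier M
    \<Longrightarrow> f (a \<odot>\<^bsub>M\<^esub> x) = a \<odot>\<^bsub>N\<^esub> f x"
  by (auto simp: lmod_hom_def)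

lemma hom_zero:
  assumes "f \<in> lmod_hom A M N" "M \<in> fgmod A" "N \<in> fgmod A"
  shows "f \<zero>\<^bsub>M\<^esub> = \<zero>\<^bsub>N\<^esub>"
proof -
  have "f \<zero>\<^bsub>M\<^esub> \<oplus>\<^bsub>N\<^esub> f \<zero>\<^bsub>M\<^esub> = f \<zero>\<^bsub>M\<^esub>"
    using hom_add[OF assms(1), of "\<zero>\<^bsub>M\<^esub>" "\<zero>\<^bsub>M\<^esub>"] assms
    by simp
  then show ?thesis
    using fgmod_neg(4)[OF assms(3), of "f \<zero>\<^bsub>M\<^esub>" "f \<zero>\<^bsub>M\<^esub>"] fgmod_neg(3)[OF assms(3), of "f \<zero>\<^bsub>M\<^esub>" "f \<zero>\<^bsub>M\<^esub>"]
      hom_closed[OF assms(1), of "\<zero>\<^bsub>M\<^esub>"] assms by simp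
qed

lemma hom_neg:
  assumes "f \<in> lmod_hom A M N" "M \<in> fgmod A" "N \<in> fgmod A" "x \<in> carrier M"
  shows "f (\<ominus>\<^bsub>M\<^esub> x) = \<ominus>\<^bsub>N\<^esub> f x"
proof -
  have "f (\<ominus>\<^bsub>M\<^esub> x) \<oplus>\<^bsub>N\<^esub> f x = \<zero>\<^bsub>N\<^esub>"
    using hom_add[OF assms(1), of "\<ominus>\<^bsub>M\<^esub> x" x] hom_zero[OF assms(1-3)] assms
    by simp
  then have "\<ominus>\<^bsub>N\<^esub> f x = f (\<ominus>\<^bsub>M\<^esub> x)"
    by (rule fgmod_minus_equality[OF assms(3)]) (use assms hom_closed[OF assms(1)] in auto)
  then show ?thesis by simp
qed

lemma hom_diff:
  assumes "f \<in> lmod_hom A M N" "M \<in> fgmod A" "N \<in> fgmod A" "x \<in> carrier M" "y \<in> carrier M"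
  shows "f (x \<oplus>\<^bsub>M\<^esub> \<ominus>\<^bsub>M\<^esub> y) = f x \<oplus>\<^bsub>N\<^esub> \<ominus>\<^bsub>N\<^esub> f y"
  using assms by (simp add: hom_add[OF assms(1)] hom_neg[OF assms(1-3)])

lemma hom_comp:
  "f \<in> lmod_hom A M N \<Longrightarrow> g \<in> lmod_hom A N L \<Longrightarrow> (\<lambda>x. g (f x)) \<in> lmod_hom A M L"
  by (auto simp: lmod_hom_def Pi_iff)

lemma hom_id: "(\<lambda>x. x) \<in> lmod_hom A M M"
  by (auto simp: lmod_hom_def)

lemma hom_zero_map: "N \<in> fgmod A \<Longrightarrow> (\<lambda>x. \<zero>\<^bsub>N\<^esub>) \<in> lmod_hom A M N"
  by (auto simp: lmod_hom_def)

lemma hom_sum: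
  assumes f: "f \<in> lmod_hom A M N" and g: "g \<in> lmod_hom A M N" and N: "N \<in> fgmod A"
  shows "(\<lambda>x. f x \<oplus>\<^bsub>N\<^esub> g x) \<in> lmod_hom A M N"
proof (rule homI)
  fix x y assume "x \<in> carrier M" "y \<in> carrier M"
  then show "f (x \<oplus>\<^bsub>M\<^esub> y) \<oplus>\<^bsub>N\<^esub> g (x \<oplus>\<^bsub>M\<^esub> y) = (f x \<oplus>\<^bsub>N\<^esub> g x) \<oplus>\<^bsub>N\<^esub> (f y \<oplus>\<^bsub>N\<^esub> g y)"
    using N hom_closed[OF f] hom_closed[OF g] by (simp add: hom_add[OF f] hom_add[OF g] fgmod_ac)
next
  fix a x assume "a \<in> carrier A" "x \<in> carrier M"
  then show "f (a \<odot>\<^bsub>M\<^esub> x) \<oplus>\<^bsub>N\<^esub> g (a \<odot>\<^bsub>M\<^esub> x) = a \<odot>\<^bsub>N\<^esub> (f x \<oplus>\<^bsub>N\<^esub> g x)"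
    using N hom_closed[OF f] hom_closed[OF g]
    by (simp add: hom_smult[OF f] hom_smult[OF g] left_module.smult_r_distr[OF fgmod_left_module[OF N]])
qed (use N hom_closed[OF f] hom_closed[OF g] in simp)

lemma smult_neg:
  assumes M: "M \<in> fgmod A" and a: "a \<in> carrier A" and x: "x \<in> carrier M"
  shows "a \<odot>\<^bsub>M\<^esub> (\<ominus>\<^bsub>M\<^esub> x) = \<ominus>\<^bsub>M\<^esub> (a \<odot>\<^bsub>M\<^esub> x)"
proof -
  interpret left_module A M using M by (rule fgmod_left_module)
  have "a \<odot>\<^bsub>M\<^esub> (\<ominus>\<^bsub>M\<^esub> x) \<oplus>\<^bsub>M\<^esub> a \<odot>\<^bsub>M\<^esub> x = \<zero>\<^bsub>M\<^esub>"
    using a x M by (simp add: smult_r_distr[symmetric])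
  then have "\<ominus>\<^bsub>M\<^esub> (a \<odot>\<^bsub>M\<^esub> x) = a \<odot>\<^bsub>M\<^esub> (\<ominus>\<^bsub>M\<^esub> x)"
    by (rule M.minus_equality) (use a x M in auto)
  then show ?thesis by simp
qed

lemma hom_neg_map:
  assumes f: "f \<in> lmod_hom A M N" and N: "N \<in> fgmod A"
  shows "(\<lambda>x. \<ominus>\<^bsub>N\<^esub> f x) \<in> lmod_hom A M N"
  using N hom_closed[OF f]
  by (intro homI) (auto simp: hom_add[OF f] hom_smult[OF f] fgmod_minus_add[OF N] smult_neg[OF N] fgmod_comm[OF N])

lemma hom_diff_map:
  assumes "f \<in> lmod_hom A M N" "g \<in> lmod_hom A M N" "N \<in> fgmod A"
  shows "(\<lambda>x. f x \<oplus>\<^bsub>N\<^esub> \<ominus>\<^bsub>N\<^esub> g x) \<in> lmod_hom A M N"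
  by (rule hom_sum[OF assms(1) hom_neg_map[OF assms(2,3)] assms(3)])

lemma hom_inj_iff:
  assumes "f \<in> lmod_hom A M N" "M \<in> fgmod A" "N \<in> fgmod A"
  shows "inj_on f (carrier M) \<longleftrightarrow> (\<forall>x\<in>carrier M. f x = \<zero>\<^bsub>N\<^esub> \<longrightarrow> x = \<zero>\<^bsub>M\<^esub>)"
proof
  assume i: "inj_on f (carrier M)"
  show "\<forall>x\<in>carrier M. f x = \<zero>\<^bsub>N\<^esub> \<longrightarrow> x = \<zero>\<^bsub>M\<^esub>"
    using hom_zero[OF assms] inj_onD[OF i] assms(2) by force
next
  assume z: "\<forall>x\<in>carrier M. f x = \<zero>\<^bsub>N\<^esub> \<longrightarrow> x = \<zero>\<^bsub>M\<^esub>"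
  show "inj_on f (carrier M)"
  proof (rule inj_onI)
    fix x y assume xy: "x \<in> carrier M" "y \<in> carrier M" "f x = f y"
    then have "f (x \<oplus>\<^bsub>M\<^esub> \<ominus>\<^bsub>M\<^esub> y) = \<zero>\<^bsub>N\<^esub>"
      using hom_diff[OF assms xy(1,2)] hom_closed[OF assms(1)] assms(3) by simp
    then have "x \<oplus>\<^bsub>M\<^esub> \<ominus>\<^bsub>M\<^esub> y = \<zero>\<^bsub>M\<^esub>"
      using z xy assms(2) by simp
    then show "x = y" using fgmod_diff_zero[OF assms(2) xy(1,2)] by simp
  qed
qed

lemma factor_surj:
  assumes p: "p \<in> lmod_hom A E Y" "p ` carrier E = carrier Y" and h: "h \<in> lmod_hom A E Z"
    and m: "E \<in> fgmod A" "Y \<in> fgmod A" "Z \<in> fgmod A"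
    and ker: "\<And>x. x \<in> carrier E \<Longrightarrow> p x = \<zero>\<^bsub>Y\<^esub> \<Longrightarrow> h x = \<zero>\<^bsub>Z\<^esub>"
  shows "\<exists>h'\<in>lmod_hom A Y Z. \<forall>x\<in>carrier E. h' (p x) = h x"
proof -
  define s where "s y = (SOME x. x \<in> carrier E \<and> p x = y)" for y
  have s: "s y \<in> carrier E" "p (s y) = y" if "y \<in> carrier Y" for y
  proof -
    have "\<exists>x. x \<in> carrier E \<and> p x = y" using that p(2) by (metis imageE)
    then have "s y \<in> carrier E \<and> p (s y) = y" unfolding s_def by (rule someI_ex)
    then show "s y \<in> carrier E" "p (s y) = y" by auto
  qed
  have eq: "h x = h y" if "x \<in> carrier E" "y \<in> carrier E" "p x = p y" for x y
  proof -
    have "p (x \<oplus>\<^bsub>E\<^esub> \<ominus>\<^bsub>E\<^esub> y) = \<zero>\<^bsub>Y\<^esub>"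
      using that m hom_closed[OF p(1)] by (simp add: hom_diff[OF p(1) m(1,2)])
    then have "h (x \<oplus>\<^bsub>E\<^esub> \<ominus>\<^bsub>E\<^esub> y) = \<zero>\<^bsub>Z\<^esub>"
      using ker that m by simp
    then show ?thesis
      using that m hom_closed[OF h] by (simp add: hom_diff[OF h m(1,3)] fgmod_diff_zero[OF m(3)])
  qed
  have hs: "h (s (p x)) = h x" if "x \<in> carrier E" for x
    using that s[of "p x"] hom_closed[OF p(1)] by (intro eq) auto
  have "(\<lambda>y. h (s y)) \<in> lmod_hom A Y Z"
  proof (rule homI)
    fix x y assume xy: "x \<in> carrier Y" "y \<in> carrier Y"
    have "h (s (x \<oplus>\<^bsub>Y\<^esub> y)) = h (s x \<oplus>\<^bsub>E\<^esub> s y)"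
      by (rule eq) (use xy s m in \<open>auto simp: hom_add[OF p(1)]\<close>)
    then show "h (s (x \<oplus>\<^bsub>Y\<^esub> y)) = h (s x) \<oplus>\<^bsub>Z\<^esub> h (s y)"
      using xy s by (simp add: hom_add[OF h])
  next
    fix a x assume x: "a \<in> carrier A" "x \<in> carrier Y"
    have "h (s (a \<odot>\<^bsub>Y\<^esub> x)) = h (a \<odot>\<^bsub>E\<^esub> s x)"
      by (rule eq) (use x s m in \<open>auto simp: hom_smult[OF p(1)]\<close>)
    then show "h (s (a \<odot>\<^bsub>Y\<^esub> x)) = a \<odot>\<^bsub>Z\<^esub> h (s x)"
      using x s by (simp add: hom_smult[OF h])
  qed (use s hom_closed[OF h] in auto)
  then show ?thesis using hs by (intro bexI[of _ "\<lambda>y. h (s y)"]) auto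
qed

lemma factor_inj:
  assumes i: "i \<in> lmod_hom A K J" "inj_on i (carrier K)" and h: "h \<in> lmod_hom A X J"
    and m: "K \<in> fgmod A"
    and im: "\<And>x. x \<in> carrier X \<Longrightarrow> h x \<in> i ` carrier K"
  shows "\<exists>h'\<in>lmod_hom A X K. \<forall>x\<in>carrier X. i (h' x) = h x"
proof -
  define s where "s x = the_inv_into (carrier K) i (h x)" for x
  have s: "s x \<in> carrier K" "i (s x) = h x" if "x \<in> carrier X" for x
    unfolding s_def using that im[OF that] i(2)
    by (auto simp: the_inv_into_into f_the_inv_into_f)
  have "s \<in> lmod_hom A X K"
  proof (rule homI)
    fix x y assume xy: "x \<in> carrier X" "y \<in> carrier X"
    have "i (s x \<oplus>\<^bsub>K\<^esub> s y) = h (x \<oplus>\<^bsub>X\<^esub> y)"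
      using xy s by (simp add: hom_add[OF i(1)] hom_add[OF h])
    then show "s (x \<oplus>\<^bsub>X\<^esub> y) = s x \<oplus>\<^bsub>K\<^esub> s y"
      unfolding s_def[of "x \<oplus>\<^bsub>X\<^esub> y"] using s(1)[OF xy(1)] s(1)[OF xy(2)] m
      by (intro the_inv_into_f_eq[OF i(2)]) auto
  next
    fix a x assume ax: "a \<in> carrier A" "x \<in> carrier X"
    have "i (a \<odot>\<^bsub>K\<^esub> s x) = h (a \<odot>\<^bsub>X\<^esub> x)"
      using s[OF ax(2)] ax by (simp add: hom_smult[OF i(1)] hom_smult[OF h])
    then show "s (a \<odot>\<^bsub>X\<^esub> x) = a \<odot>\<^bsub>K\<^esub> s x"
      unfolding s_def[of "a \<odot>\<^bsub>X\<^esub> x"] using s(1)[OF ax(2)] ax(1) m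
      by (intro the_inv_into_f_eq[OF i(2)]) auto
  qed (use s in auto)
  then show ?thesis using s by blast
qed

lemma submodule_mem:
  assumes "submodule U A M" "M \<in> fgmod A"
  shows "U \<subseteq> carrier M" "\<zero>\<^bsub>M\<^esub> \<in> U" "\<And>x y. x \<in> U \<Longrightarrow> y \<in> U \<Longrightarrow> x \<oplus>\<^bsub>M\<^esub> y \<in> U"
    "\<And>a x. a \<in> carrier A \<Longrightarrow> x \<in> U \<Longrightarrow> a \<odot>\<^bsub>M\<^esub> x \<in> U"
    "\<And>x. x \<in> U \<Longrightarrow> \<ominus>\<^bsub>M\<^esub> x \<in> U"
proof -
  show 1: "U \<subseteq> carrier M" "\<zero>\<^bsub>M\<^esub> \<in> U" "\<And>x y. x \<in> U \<Longrightarrow> y \<in> U \<Longrightarrow> x \<oplus>\<^bsub>M\<^esub> y \<in> U"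
    "\<And>a x. a \<in> carrier A \<Longrightarrow> x \<in> U \<Longrightarrow> a \<odot>\<^bsub>M\<^esub> x \<in> U"
    using assms(1) unfolding submodule_iff[OF assms(2)] by auto
  interpret left_module A M using assms(2) by (rule fgmod_left_module)
  show "\<ominus>\<^bsub>M\<^esub> x \<in> U" if "x \<in> U" for x
    using 1(4)[OF _ that, of "\<ominus>\<^bsub>A\<^esub> \<one>\<^bsub>A\<^esub>"] smult_minus_one[of x] 1(1) that
    by auto
qed

lemma submodule_carrier: "M \<in> fgmod A \<Longrightarrow> submodule (carrier M) A M"
  by (simp add: submodule_iff)

lemma submodule_zero: "M \<in> fgmod A \<Longrightarrow> submodule {\<zero>\<^bsub>M\<^esub>} A M"
  by (simp add: submodule_iff)

lemma submodule_kernel: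
  assumes f: "f \<in> lmod_hom A M N" and m: "M \<in> fgmod A" "N \<in> fgmod A"
  shows "submodule (a_kernel M N f) A M"
  using m unfolding submodule_iff[OF m(1)] a_kernel_def'
  by (auto simp: hom_add[OF f] hom_smult[OF f] hom_zero[OF f m])

lemma submodule_image:
  assumes f: "f \<in> lmod_hom A M N" and m: "M \<in> fgmod A" "N \<in> fgmod A"
    and U: "submodule U A M"
  shows "submodule (f ` U) A N"
  unfolding submodule_iff[OF m(2)]
proof (intro conjI ballI)
  note Um = submodule_mem[OF U m(1)]
  show "f ` U \<subseteq> carrier N" using Um(1) hom_closed[OF f] by auto
  show "\<zero>\<^bsub>N\<^esub> \<in> f ` U" using Um(2) hom_zero[OF f m] by force
  show "x \<oplus>\<^bsub>N\<^esub> y \<in> f ` U" if xy: "x \<in> f ` U" "y \<in> f ` U" for x y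
  proof -
    obtain u v where "u \<in> U" "v \<in> U" "x = f u" "y = f v" using xy by blast
    then have "x \<oplus>\<^bsub>N\<^esub> y = f (u \<oplus>\<^bsub>M\<^esub> v)" "u \<oplus>\<^bsub>M\<^esub> v \<in> U"
      using Um(1,3) by (auto simp: hom_add[OF f] subset_iff)
    then show ?thesis by blast
  qed
  show "a \<odot>\<^bsub>N\<^esub> x \<in> f ` U" if ax: "a \<in> carrier A" "x \<in> f ` U" for a x
  proof -
    obtain u where "u \<in> U" "x = f u" using ax by blast
    then have "a \<odot>\<^bsub>N\<^esub> x = f (a \<odot>\<^bsub>M\<^esub> u)" "a \<odot>\<^bsub>M\<^esub> u \<in> U"
      using Um(1,4) ax by (auto simp: hom_smult[OF f] subset_iff)
    then show ?thesis by blast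
  qed
qed

lemma finitely_generated_image:
  assumes q: "q \<in> lmod_hom A M N" "q ` carrier M = carrier N" and M: "M \<in> fgmod A"
    and N: "left_module A N"
  shows "finitely_generated A N"
proof -
  interpret M: left_module A M using M by (rule fgmod_left_module)
  interpret N: left_module A N by (rule N)
  have "finitely_generated A M" using M by (simp add: fgmod_def)
  then obtain S where S: "finite S" "S \<subseteq> carrier M"
    and gen: "\<And>U. submodule U A M \<Longrightarrow> S \<subseteq> U \<Longrightarrow> U = carrier M"
    unfolding M.finitely_generated_iff by blast
  have q0: "q \<zero>\<^bsub>M\<^esub> = \<zero>\<^bsub>N\<^esub>"
    using hom_smult[OF q(1), of "\<zero>\<^bsub>A\<^esub>" "\<zero>\<^bsub>M\<^esub>"] hom_closed[OF q(1), of "\<zero>\<^bsub>M\<^esub>"]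
    by simp
  have "U = carrier N" if U: "submodule U A N" "q ` S \<subseteq> U" for U
  proof -
    have "submodule {x \<in> carrier M. q x \<in> U} A M"
      using U(1) q0 unfolding M.submodule_iff N.submodule_iff
      by (auto simp: hom_add[OF q(1)] hom_smult[OF q(1)])
    then have "{x \<in> carrier M. q x \<in> U} = carrier M" using U(2) S(2) by (intro gen) auto
    then have "q ` carrier M \<subseteq> U" by blast
    then have "carrier N \<subseteq> U" using q(2) by simp
    then show ?thesis using U(1) unfolding N.submodule_iff by blast
  qed
  moreover have "q ` S \<subseteq> carrier N" using S(2) q(2) by blast
  ultimately show ?thesis unfolding N.finitely_generated_iff using S(1)
    by (intro exI[of _ "q ` S"]) auto
qed

lemma left_module_restrict:
  assumes M: "M \<in> fgmod A" and U: "submodule U A M"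
  shows "left_module A (M\<lparr>carrier := U\<rparr>)"
proof -
  interpret left_module A M using M by (rule fgmod_left_module)
  note Um = submodule_mem[OF U M]
  have c: "\<And>x. x \<in> U \<Longrightarrow> x \<in> carrier M" using Um(1) by blast
  show ?thesis
  proof (intro left_module.intro left_module_axioms.intro)
    show "ring A" by (rule R.ring_axioms)
    show "abelian_group (M\<lparr>carrier := U\<rparr>)"
    proof (rule abelian_groupI)
      fix x assume "x \<in> carrier (M\<lparr>carrier := U\<rparr>)"
      then show "\<exists>y\<in>carrier (M\<lparr>carrier := U\<rparr>). y \<oplus>\<^bsub>M\<lparr>carrier := U\<rparr>\<^esub> x = \<zero>\<^bsub>M\<lparr>carrier := U\<rparr>\<^esub>"
        using Um(5)[of x] c
        by (auto intro!: bexI[of _ "\<ominus>\<^bsub>M\<^esub> x"] simp: M.l_neg)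
    qed (use Um c in \<open>auto simp: M.a_ac\<close>)
  qed (use Um c in \<open>auto simp: smult_l_distr smult_r_distr smult_assoc1\<close>)
qed

lemma hom_restrict_dom:
  "f \<in> lmod_hom A M N \<Longrightarrow> U \<subseteq> carrier M \<Longrightarrow> f \<in> lmod_hom A (M\<lparr>carrier := U\<rparr>) N"
  by (auto simp: lmod_hom_def Pi_iff subset_iff)

lemma hom_restrict_cod:
  "f \<in> lmod_hom A M N \<Longrightarrow> f ` carrier M \<subseteq> U \<Longrightarrow> f \<in> lmod_hom A M (N\<lparr>carrier := U\<rparr>)"
  by (auto simp: lmod_hom_def Pi_iff)

lemma hom_unrestrict_cod:
  "f \<in> lmod_hom A M (N\<lparr>carrier := U\<rparr>) \<Longrightarrow> U \<subseteq> carrier N \<Longrightarrow> f \<in> lmod_hom A M N"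
  by (auto simp: lmod_hom_def Pi_iff)

lemma hom_incl: "U \<subseteq> carrier M \<Longrightarrow> (\<lambda>x. x) \<in> lmod_hom A (M\<lparr>carrier := U\<rparr>) M"
  by (rule hom_restrict_dom[OF hom_id])

text \<open>\<open>S\<close> is the direct sum of \<open>M\<close> and \<open>N\<close> with projections \<open>p\<close>, \<open>q\<close> and pairing \<open>c\<close>. Direct sums are described
  by these maps, because the carriers of the modules in \<open>fgmod A\<close> consist of lists, not of pairs.\<close>

definition biprod where
  "biprod A S p q c M N \<longleftrightarrow> S \<in> fgmod A \<and> M \<in> fgmod A \<and> N \<in> fgmod A \<and>
     p \<in> lmod_hom A S M \<and> q \<in> lmod_hom A S N \<and>
     (\<forall>x\<in>carrier M. \<forall>y\<in>carrier N. c x y \<in> carrier S \<and> p (c x y) = x \<and> q (c x y) = y) \<and>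
     (\<forall>s\<in>carrier S. c (p s) (q s) = s)"

lemma biprodD:
  assumes "biprod A S p q c M N"
  shows "S \<in> fgmod A" "M \<in> fgmod A" "N \<in> fgmod A" "p \<in> lmod_hom A S M" "q \<in> lmod_hom A S N"
    "\<And>x y. x \<in> carrier M \<Longrightarrow> y \<in> carrier N \<Longrightarrow> c x y \<in> carrier S"
    "\<And>x y. x \<in> carrier M \<Longrightarrow> y \<in> carrier N \<Longrightarrow> p (c x y) = x"
    "\<And>x y. x \<in> carrier M \<Longrightarrow> y \<in> carrier N \<Longrightarrow> q (c x y) = y"
    "\<And>s. s \<in> carrier S \<Longrightarrow> c (p s) (q s) = s"
  using assms unfolding biprod_def by auto

lemma biprod_hom:
  assumes b: "biprod A S p q c M N" and f: "f \<in> lmod_hom A X M" and g: "g \<in> lmod_hom A X N"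
  shows "(\<lambda>x. c (f x) (g x)) \<in> lmod_hom A X S"
proof -
  note B = biprodD[OF b]
  have ext: "s = c x y" if "s \<in> carrier S" "p s = x" "q s = y" for s x y
    using B(9)[OF that(1)] that by simp
  note fc = hom_closed[OF f] and gc = hom_closed[OF g]
  show ?thesis
  proof (rule homI)
    fix x assume "x \<in> carrier X"
    then show "c (f x) (g x) \<in> carrier S" using B(6) fc gc by blast
  next
    fix x y assume "x \<in> carrier X" "y \<in> carrier X"
    then show "c (f (x \<oplus>\<^bsub>X\<^esub> y)) (g (x \<oplus>\<^bsub>X\<^esub> y)) = c (f x) (g x) \<oplus>\<^bsub>S\<^esub> c (f y) (g y)"
      using fc gc B(1,6,7,8)
      by (intro ext[symmetric]) (auto simp: hom_add[OF B(4)] hom_add[OF B(5)] hom_add[OF f] hom_add[OF g])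
  next
    fix a x assume "a \<in> carrier A" "x \<in> carrier X"
    then show "c (f (a \<odot>\<^bsub>X\<^esub> x)) (g (a \<odot>\<^bsub>X\<^esub> x)) = a \<odot>\<^bsub>S\<^esub> c (f x) (g x)"
      using fc gc B(1,6,7,8)
      by (intro ext[symmetric])
         (auto simp: hom_smult[OF B(4)] hom_smult[OF B(5)] hom_smult[OF f] hom_smult[OF g])
  qed
qed

lemma biprod_eqI:
  assumes b: "biprod A S p q c M N"
    and "s \<in> carrier S" "t \<in> carrier S" "p s = p t" "q s = q t"
  shows "s = t"
  using biprodD(9)[OF b assms(2)] biprodD(9)[OF b assms(3)] assms(4,5) by metis

lemma biprod_zero:
  assumes b: "biprod A S p q c M N" 
  shows "c \<zero>\<^bsub>M\<^esub> \<zero>\<^bsub>N\<^esub> = \<zero>\<^bsub>S\<^esub>"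
proof -
  note B = biprodD[OF b]
  show ?thesis
    by (rule biprod_eqI[OF b]) (use B in \<open>auto simp: hom_zero[OF B(4)] hom_zero[OF B(5)]\<close>)
qed

lemma biprod_inl:
  assumes b: "biprod A S p q c M N"
  shows "(\<lambda>x. c x \<zero>\<^bsub>N\<^esub>) \<in> lmod_hom A M S"
  by (rule biprod_hom[OF b hom_id hom_zero_map[OF biprodD(3)[OF b]]])

lemma biprod_inr:
  assumes b: "biprod A S p q c M N"
  shows "(\<lambda>y. c \<zero>\<^bsub>M\<^esub> y) \<in> lmod_hom A N S"
  by (rule biprod_hom[OF b hom_zero_map[OF biprodD(2)[OF b]] hom_id])

lemma biprod_split:
  assumes b: "biprod A S p q c M N" and s: "s \<in> carrier S"
  shows "s = c (p s) \<zero>\<^bsub>N\<^esub> \<oplus>\<^bsub>S\<^esub> c \<zero>\<^bsub>M\<^esub> (q s)"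
proof -
  note B = biprodD[OF b]
  have c: "p s \<in> carrier M" "q s \<in> carrier N" using s hom_closed[OF B(4)] hom_closed[OF B(5)]
    by auto
  show ?thesis
    by (rule biprod_eqI[OF b]) (use B(1-3,6-8) c s in \<open>auto simp: hom_add[OF B(4)] hom_add[OF B(5)]\<close>)
qed

lemma biprod_sym:
  "biprod A S p q c M N \<Longrightarrow> biprod A S q p (\<lambda>x y. c y x) N M"
  unfolding biprod_def by blast

lemma biprod_exists:
  fixes A :: "('a, 'z) ring_scheme"
  assumes M: "M \<in> fgmod A" and N: "N \<in> fgmod A"
  shows "\<exists>S p q c. biprod A S p q c M N"
proof -
  interpret M: left_module A M using M by (rule fgmod_left_module)
  interpret N: left_module A N using N by (rule fgmod_left_module)
  define T :: "('a, 'a list \<times> 'a list) module" where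
    "T = \<lparr>carrier = carrier M \<times> carrier N, mult = (\<lambda>x y. x), one = (\<zero>\<^bsub>M\<^esub>, \<zero>\<^bsub>N\<^esub>),
       zero = (\<zero>\<^bsub>M\<^esub>, \<zero>\<^bsub>N\<^esub>), add = (\<lambda>x y. (fst x \<oplus>\<^bsub>M\<^esub> fst y, snd x \<oplus>\<^bsub>N\<^esub> snd y)),
       smult = (\<lambda>a x. (a \<odot>\<^bsub>M\<^esub> fst x, a \<odot>\<^bsub>N\<^esub> snd x))\<rparr>"
  have T: "left_module A T"
  proof (intro left_module.intro left_module_axioms.intro)
    show "ring A" by (rule M.R.ring_axioms)
    show "abelian_group T"
    proof (rule abelian_groupI)
      fix x assume "x \<in> carrier T"
      then show "\<exists>y\<in>carrier T. y \<oplus>\<^bsub>T\<^esub> x = \<zero>\<^bsub>T\<^esub>"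
        by (intro bexI[of _ "(\<ominus>\<^bsub>M\<^esub> fst x, \<ominus>\<^bsub>N\<^esub> snd x)"]) (auto simp: T_def M.M.l_neg N.M.l_neg)
    qed (auto simp: T_def M.M.a_ac N.M.a_ac)
  qed (auto simp: T_def M.smult_l_distr M.smult_r_distr M.smult_assoc1 N.smult_l_distr N.smult_r_distr N.smult_assoc1)
  interpret T: left_module A T by (rule T)
  have "finitely_generated A M" "finitely_generated A N" using M N by (auto simp: fgmod_def)
  then obtain S1 S2 where S12: "finite S1 \<and> S1 \<subseteq> carrier M \<and> (\<forall>U. submodule U A M \<longrightarrow> S1 \<subseteq> U \<longrightarrow> U = carrier M)"
    "finite S2 \<and> S2 \<subseteq> carrier N \<and> (\<forall>U. submodule U A N \<longrightarrow> S2 \<subseteq> U \<longrightarrow> U = carrier N)"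
    unfolding M.finitely_generated_iff N.finitely_generated_iff by (elim exE) simp
  then have S1: "finite S1" "S1 \<subseteq> carrier M"
    and S2: "finite S2" "S2 \<subseteq> carrier N"
    and gen1: "\<And>U. submodule U A M \<Longrightarrow> S1 \<subseteq> U \<Longrightarrow> U = carrier M"
    and gen2: "\<And>U. submodule U A N \<Longrightarrow> S2 \<subseteq> U \<Longrightarrow> U = carrier N"
    by simp_all
  let ?S = "(\<lambda>x. (x, \<zero>\<^bsub>N\<^esub>)) ` S1 \<union> (\<lambda>y. (\<zero>\<^bsub>M\<^esub>, y)) ` S2"
  have "U = carrier T" if U: "submodule U A T" "?S \<subseteq> U" for U
  proof -
    have Ua: "\<And>x y. x \<in> U \<Longrightarrow> y \<in> U \<Longrightarrow> x \<oplus>\<^bsub>T\<^esub> y \<in> U"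
      and Us: "\<And>a x. a \<in> carrier A \<Longrightarrow> x \<in> U \<Longrightarrow> a \<odot>\<^bsub>T\<^esub> x \<in> U"
      and U0: "\<zero>\<^bsub>T\<^esub> \<in> U" and Uc: "U \<subseteq> carrier T"
      using U(1) unfolding T.submodule_iff by auto
    have "submodule {x \<in> carrier M. (x, \<zero>\<^bsub>N\<^esub>) \<in> U} A M"
      unfolding M.submodule_iff
    proof (intro conjI ballI)
      show "x \<oplus>\<^bsub>M\<^esub> y \<in> {x \<in> carrier M. (x, \<zero>\<^bsub>N\<^esub>) \<in> U}"
        if "x \<in> {x \<in> carrier M. (x, \<zero>\<^bsub>N\<^esub>) \<in> U}" "y \<in> {x \<in> carrier M. (x, \<zero>\<^bsub>N\<^esub>) \<in> U}" for x y
        using that Ua[of "(x, \<zero>\<^bsub>N\<^esub>)" "(y, \<zero>\<^bsub>N\<^esub>)"]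
        by (simp add: T_def)
      show "a \<odot>\<^bsub>M\<^esub> x \<in> {x \<in> carrier M. (x, \<zero>\<^bsub>N\<^esub>) \<in> U}"
        if "a \<in> carrier A" "x \<in> {x \<in> carrier M. (x, \<zero>\<^bsub>N\<^esub>) \<in> U}" for a x
        using that Us[of a "(x, \<zero>\<^bsub>N\<^esub>)"] by (simp add: T_def)
    qed (use U0 in \<open>auto simp: T_def\<close>)
    then have 1: "{x \<in> carrier M. (x, \<zero>\<^bsub>N\<^esub>) \<in> U} = carrier M" using S1(2) U(2)
      by (intro gen1) auto
    have "submodule {y \<in> carrier N. (\<zero>\<^bsub>M\<^esub>, y) \<in> U} A N"
      unfolding N.submodule_iff
    proof (intro conjI ballI)
      show "x \<oplus>\<^bsub>N\<^esub> y \<in> {y \<in> carrier N. (\<zero>\<^bsub>M\<^esub>, y) \<in> U}"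
        if "x \<in> {y \<in> carrier N. (\<zero>\<^bsub>M\<^esub>, y) \<in> U}" "y \<in> {y \<in> carrier N. (\<zero>\<^bsub>M\<^esub>, y) \<in> U}" for x y
        using that Ua[of "(\<zero>\<^bsub>M\<^esub>, x)" "(\<zero>\<^bsub>M\<^esub>, y)"]
        by (simp add: T_def)
      show "a \<odot>\<^bsub>N\<^esub> x \<in> {y \<in> carrier N. (\<zero>\<^bsub>M\<^esub>, y) \<in> U}"
        if "a \<in> carrier A" "x \<in> {y \<in> carrier N. (\<zero>\<^bsub>M\<^esub>, y) \<in> U}" for a x
        using that Us[of a "(\<zero>\<^bsub>M\<^esub>, x)"] by (simp add: T_def)
    qed (use U0 in \<open>auto simp: T_def\<close>)
    then have 2: "{y \<in> carrier N. (\<zero>\<^bsub>M\<^esub>, y) \<in> U} = carrier N" using S2(2) U(2)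
      by (intro gen2) auto
    have "(x, y) \<in> U" if "x \<in> carrier M" "y \<in> carrier N" for x y
      using Ua[of "(x, \<zero>\<^bsub>N\<^esub>)" "(\<zero>\<^bsub>M\<^esub>, y)"] that 1 2
      by (auto simp: T_def)
    then show ?thesis using Uc by (auto simp: T_def)
  qed
  moreover have "finite ?S" "?S \<subseteq> carrier T" using S1 S2 by (auto simp: T_def)
  ultimately have "finitely_generated A T" unfolding T.finitely_generated_iff
    by (intro exI[of _ ?S]) auto
  then obtain S where S: "S \<in> fgmod A" "lmod_iso A T S" using fgmod_representative[OF T]
    by blast
  then obtain \<phi> where \<phi>: "\<phi> \<in> lmod_hom A T S" "bij_betw \<phi> (carrier T) (carrier S)"
    unfolding lmod_iso_def by blast
  define \<psi> where "\<psi> = the_inv_into (carrier T) \<phi>"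
  have \<psi>1: "\<psi> (\<phi> t) = t" if "t \<in> carrier T" for t
    unfolding \<psi>_def using that \<phi>(2) by (auto simp: bij_betw_def the_inv_into_f_f)
  have \<psi>2: "\<phi> (\<psi> s) = s" "\<psi> s \<in> carrier T" if "s \<in> carrier S" for s
    using that \<phi>(2) unfolding bij_betw_def \<psi>_def
    by (auto intro: f_the_inv_into_f the_inv_into_into)
  have \<psi>c: "fst (\<psi> s) \<in> carrier M" "snd (\<psi> s) \<in> carrier N"
    if "s \<in> carrier S" for s
    using \<psi>2(2)[OF that] by (auto simp: T_def)
  have add: "\<psi> (s \<oplus>\<^bsub>S\<^esub> t) = \<psi> s \<oplus>\<^bsub>T\<^esub> \<psi> t"
    if "s \<in> carrier S" "t \<in> carrier S" for s t
    using that \<psi>1[of "\<psi> s \<oplus>\<^bsub>T\<^esub> \<psi> t"] hom_add[OF \<phi>(1), of "\<psi> s" "\<psi> t"]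
    by (simp add: \<psi>2)
  have sm: "\<psi> (a \<odot>\<^bsub>S\<^esub> s) = a \<odot>\<^bsub>T\<^esub> \<psi> s"
    if "s \<in> carrier S" "a \<in> carrier A" for s a
    using that \<psi>1[of "a \<odot>\<^bsub>T\<^esub> \<psi> s"] hom_smult[OF \<phi>(1), of a "\<psi> s"]
    by (simp add: \<psi>2)
  have "biprod A S (\<lambda>s. fst (\<psi> s)) (\<lambda>s. snd (\<psi> s)) (\<lambda>x y. \<phi> (x, y)) M N"
    unfolding biprod_def
  proof (intro conjI ballI)
    show "(\<lambda>s. fst (\<psi> s)) \<in> lmod_hom A S M"
      using \<psi>c by (intro homI) (auto simp: add sm T_def)
    show "(\<lambda>s. snd (\<psi> s)) \<in> lmod_hom A S N"
      using \<psi>c by (intro homI) (auto simp: add sm T_def)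
    fix x y assume xy: "x \<in> carrier M" "y \<in> carrier N"
    then have t: "(x, y) \<in> carrier T" by (simp add: T_def)
    show "\<phi> (x, y) \<in> carrier S" "fst (\<psi> (\<phi> (x, y))) = x" "snd (\<psi> (\<phi> (x, y))) = y"
      using hom_closed[OF \<phi>(1) t] \<psi>1[OF t] by auto
  qed (use S M N \<psi>2 in auto)
  then show ?thesis by blast
qed

text \<open>The quotient is carried by a set of representatives of the cosets, so it stays in the type of \<open>M\<close>.\<close>

lemma quotient_exists:
  fixes A :: "('a, 'z) ring_scheme"
  assumes M: "M \<in> fgmod A" and U: "submodule U A M"
  shows "\<exists>Q\<in>fgmod A. \<exists>q\<in>lmod_hom A M Q. q ` carrier M = carrier Q \<and>
    (\<forall>x\<in>carrier M. q x = \<zero>\<^bsub>Q\<^esub> \<longleftrightarrow> x \<in> U)"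
proof -
  interpret M: left_module A M using M by (rule fgmod_left_module)
  note Um = submodule_mem[OF U M]
  have Uc: "\<And>x. x \<in> U \<Longrightarrow> x \<in> carrier M" using Um(1) by blast
  define R where "R x y \<longleftrightarrow> x \<in> carrier M \<and> y \<in> carrier M \<and> x \<oplus>\<^bsub>M\<^esub> \<ominus>\<^bsub>M\<^esub> y \<in> U" for x y
  have R_iff: "R x y \<longleftrightarrow> (\<exists>u\<in>U. x = u \<oplus>\<^bsub>M\<^esub> y)"
    if "x \<in> carrier M" "y \<in> carrier M" for x y
  proof
    assume "R x y"
    then show "\<exists>u\<in>U. x = u \<oplus>\<^bsub>M\<^esub> y"
      using that M
      by (intro bexI[of _ "x \<oplus>\<^bsub>M\<^esub> \<ominus>\<^bsub>M\<^esub> y"]) (auto simp: R_def)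
  next
    assume "\<exists>u\<in>U. x = u \<oplus>\<^bsub>M\<^esub> y"
    then show "R x y" using that M Uc by (auto simp: R_def fgmod_assoc)
  qed
  have Rrefl: "R x x" if "x \<in> carrier M" for x using that Um(2) M by (simp add: R_def)
  have Rsym: "R y x" if xy: "R x y" for x y
  proof -
    have c: "x \<in> carrier M" "y \<in> carrier M" using that by (auto simp: R_def)
    obtain u where u: "u \<in> U" "x = u \<oplus>\<^bsub>M\<^esub> y" using xy R_iff[OF c] by blast
    then have "y = \<ominus>\<^bsub>M\<^esub> u \<oplus>\<^bsub>M\<^esub> x" using c M Uc by simp
    then show ?thesis using R_iff[OF c(2,1)] Um(5)[OF u(1)] by blast
  qed
  have Rtrans: "R x z" if xyz: "R x y" "R y z" for x y z
  proof -
    have c: "x \<in> carrier M" "y \<in> carrier M" "z \<in> carrier M" using that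
      by (auto simp: R_def)
    obtain u v where u: "u \<in> U" "x = u \<oplus>\<^bsub>M\<^esub> y" "v \<in> U" "y = v \<oplus>\<^bsub>M\<^esub> z"
      using xyz(1) xyz(2) R_iff[OF c(1,2)] R_iff[OF c(2,3)] by blast
    then have "x = (u \<oplus>\<^bsub>M\<^esub> v) \<oplus>\<^bsub>M\<^esub> z" using c M Uc
      by (simp add: fgmod_assoc)
    then show ?thesis using R_iff[OF c(1,3)] Um(3)[OF u(1,3)] by blast
  qed
  have Radd: "R (x \<oplus>\<^bsub>M\<^esub> x') (y \<oplus>\<^bsub>M\<^esub> y')"
    if xy: "R x y" "R x' y'" for x y x' y'
  proof -
    have c: "x \<in> carrier M" "y \<in> carrier M" "x' \<in> carrier M" "y' \<in> carrier M" using that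
      by (auto simp: R_def)
    obtain u v where u: "u \<in> U" "x = u \<oplus>\<^bsub>M\<^esub> y" "v \<in> U" "x' = v \<oplus>\<^bsub>M\<^esub> y'"
      using xy(1) xy(2) R_iff[OF c(1,2)] R_iff[OF c(3,4)] by blast
    then have "x \<oplus>\<^bsub>M\<^esub> x' = (u \<oplus>\<^bsub>M\<^esub> v) \<oplus>\<^bsub>M\<^esub> (y \<oplus>\<^bsub>M\<^esub> y')" using c M Uc
      by (simp add: fgmod_ac)
    then show ?thesis
      using R_iff[of "x \<oplus>\<^bsub>M\<^esub> x'" "y \<oplus>\<^bsub>M\<^esub> y'"] Um(3)[OF u(1,3)] c M
      by (metis fgmod_closed(1))
  qed
  have Rsm: "R (a \<odot>\<^bsub>M\<^esub> x) (a \<odot>\<^bsub>M\<^esub> y)"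
    if xy: "R x y" "a \<in> carrier A" for x y a
  proof -
    have c: "x \<in> carrier M" "y \<in> carrier M" using that by (auto simp: R_def)
    obtain u where u: "u \<in> U" "x = u \<oplus>\<^bsub>M\<^esub> y" using xy(1) R_iff[OF c]
      by blast
    then have "a \<odot>\<^bsub>M\<^esub> x = a \<odot>\<^bsub>M\<^esub> u \<oplus>\<^bsub>M\<^esub> a \<odot>\<^bsub>M\<^esub> y" using c that M Uc
      by (simp add: M.smult_r_distr)
    then show ?thesis
      using R_iff[of "a \<odot>\<^bsub>M\<^esub> x" "a \<odot>\<^bsub>M\<^esub> y"] Um(4)[OF that(2) u(1)] c that(2)
      by (metis M.smult_closed)
  qed
  define q where "q x = (SOME y. R x y)" for x
  have q1: "R x (q x)" if "x \<in> carrier M" for x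
    unfolding q_def by (rule someI, rule Rrefl[OF that])
  have q2: "q x = q y" if "R x y" for x y
  proof -
    have "R x = R y" using that Rsym Rtrans by blast
    then show ?thesis by (simp add: q_def)
  qed
  have qc: "q x \<in> carrier M" if "x \<in> carrier M" for x using q1[OF that] by (simp add: R_def)
  have q3: "R x y" if "x \<in> carrier M" "y \<in> carrier M" "q x = q y" for x y
    using q1[OF that(1)] q1[OF that(2)] that(3) Rsym Rtrans by metis
  have qq: "q (q x) = q x" if "x \<in> carrier M" for x
    using q2[OF Rsym[OF q1[OF that]]] .
  have qadd: "q (q x \<oplus>\<^bsub>M\<^esub> q y) = q (x \<oplus>\<^bsub>M\<^esub> y)"
    if "x \<in> carrier M" "y \<in> carrier M" for x y
    using Radd[OF q1 q1, OF that] q2 by metis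
  have qadd1: "q (q x \<oplus>\<^bsub>M\<^esub> y) = q (x \<oplus>\<^bsub>M\<^esub> y)"
    if "x \<in> carrier M" "y \<in> carrier M" for x y
    using Radd[OF q1 Rrefl, OF that] q2 by metis
  have qadd2: "q (x \<oplus>\<^bsub>M\<^esub> q y) = q (x \<oplus>\<^bsub>M\<^esub> y)"
    if "x \<in> carrier M" "y \<in> carrier M" for x y
    using Radd[OF Rrefl q1, OF that] q2 by metis
  have qsm: "q (a \<odot>\<^bsub>M\<^esub> q x) = q (a \<odot>\<^bsub>M\<^esub> x)"
    if "a \<in> carrier A" "x \<in> carrier M" for a x
    using Rsm[OF q1 that(1), OF that(2)] q2 by metis
  have qlin: "q (a \<odot>\<^bsub>M\<^esub> q x \<oplus>\<^bsub>M\<^esub> b \<odot>\<^bsub>M\<^esub> q x) = q (a \<odot>\<^bsub>M\<^esub> x \<oplus>\<^bsub>M\<^esub> b \<odot>\<^bsub>M\<^esub> x)"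
    "q (a \<odot>\<^bsub>M\<^esub> (b \<odot>\<^bsub>M\<^esub> q x)) = q (a \<odot>\<^bsub>M\<^esub> (b \<odot>\<^bsub>M\<^esub> x))"
    if "a \<in> carrier A" "b \<in> carrier A" "x \<in> carrier M" for a b x
    using that by (intro q2 Radd Rsm Rsym[OF q1]; simp)+
  define Q :: "'a lmod" where
    "Q = \<lparr>carrier = q ` carrier M, mult = (\<lambda>x y. x), one = q \<zero>\<^bsub>M\<^esub>, zero = q \<zero>\<^bsub>M\<^esub>,
          add = (\<lambda>x y. q (x \<oplus>\<^bsub>M\<^esub> y)), smult = (\<lambda>a x. q (a \<odot>\<^bsub>M\<^esub> x))\<rparr>"
  have Q: "left_module A Q"
  proof (intro left_module.intro left_module_axioms.intro)
    show "ring A" by (rule M.R.ring_axioms)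
    show "abelian_group Q"
    proof (rule abelian_groupI)
      fix x assume "x \<in> carrier Q"
      then obtain u where u: "u \<in> carrier M" "x = q u" by (auto simp: Q_def)
      show "\<exists>y\<in>carrier Q. y \<oplus>\<^bsub>Q\<^esub> x = \<zero>\<^bsub>Q\<^esub>"
        by (rule bexI[of _ "q (\<ominus>\<^bsub>M\<^esub> u)"]) (use u M in \<open>auto simp: Q_def qadd\<close>)
    next
      fix x y z assume "x \<in> carrier Q" "y \<in> carrier Q" "z \<in> carrier Q"
      then show "(x \<oplus>\<^bsub>Q\<^esub> y) \<oplus>\<^bsub>Q\<^esub> z = x \<oplus>\<^bsub>Q\<^esub> (y \<oplus>\<^bsub>Q\<^esub> z)"
        using M by (auto simp: Q_def qadd1 qadd2 qc M.M.a_assoc)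
    next
      fix x y assume "x \<in> carrier Q" "y \<in> carrier Q"
      then show "x \<oplus>\<^bsub>Q\<^esub> y = y \<oplus>\<^bsub>Q\<^esub> x"
        by (auto simp: Q_def qc M.M.a_comm)
    qed (use M in \<open>auto simp: Q_def qadd qadd1 qadd2 qc qq\<close>)
  qed (use M in \<open>auto simp: Q_def qc qadd qsm qq qlin M.smult_l_distr M.smult_r_distr M.smult_assoc1\<close>)
  have h: "q \<in> lmod_hom A M Q" by (rule homI) (auto simp: Q_def qadd qsm)
  have im: "q ` carrier M = carrier Q" by (simp add: Q_def)
  have "Q \<in> fgmod A" using Q finitely_generated_image[OF h im M Q] by (simp add: fgmod_def)
  moreover have "q x = \<zero>\<^bsub>Q\<^esub> \<longleftrightarrow> x \<in> U"
    if x: "x \<in> carrier M" for x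
  proof -
    have "q x = \<zero>\<^bsub>Q\<^esub> \<longleftrightarrow> R x \<zero>\<^bsub>M\<^esub>"
      using q2 q3[OF x, of "\<zero>\<^bsub>M\<^esub>"] M by (auto simp: Q_def)
    also have "\<dots> \<longleftrightarrow> x \<in> U" using R_iff[OF x, of "\<zero>\<^bsub>M\<^esub>"] M Uc
      by auto
    finally show ?thesis .
  qed
  ultimately show ?thesis using h im by blast
qed

text \<open>\<open>s\<close> embeds \<open>N\<close> into \<open>M\<close> as a direct summand and \<open>r\<close> is a retraction. This covers both isomorphic
  copies and direct summands.\<close>

definition retract where
  "retract A N M s r \<longleftrightarrow> N \<in> fgmod A \<and> M \<in> fgmod A \<and> s \<in> lmod_hom A N M \<and> r \<in> lmod_hom A M N \<and>
     (\<forall>x\<in>carrier N. r (s x) = x)"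

lemma retractD:
  assumes "retract A N M s r"
  shows "N \<in> fgmod A" "M \<in> fgmod A" "s \<in> lmod_hom A N M" "r \<in> lmod_hom A M N"
    "\<And>x. x \<in> carrier N \<Longrightarrow> r (s x) = x"
  using assms unfolding retract_def by auto

lemma retract_trans:
  "retract A N M s r \<Longrightarrow> retract A M L s' r' \<Longrightarrow> retract A N L (\<lambda>x. s' (s x)) (\<lambda>x. r (r' x))"
  unfolding retract_def by (auto intro: hom_comp simp: hom_closed)

lemma retract_iso:
  assumes f: "f \<in> lmod_hom A M N" "bij_betw f (carrier M) (carrier N)"
    and m: "M \<in> fgmod A" "N \<in> fgmod A"
  shows "\<exists>g. retract A M N f g \<and> retract A N M g f"
proof -
  have "inj_on f (carrier M)" "f ` carrier M = carrier N" using f(2) by (auto simp: bij_betw_def)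
  then obtain g where g: "g \<in> lmod_hom A N M" "\<And>x. x \<in> carrier N \<Longrightarrow> f (g x) = x"
    using factor_inj[OF f(1) _ hom_id m(1)] by auto
  have "g (f x) = x" if "x \<in> carrier M" for x
    using inj_onD[OF \<open>inj_on f (carrier M)\<close>, of "g (f x)" x] that g hom_closed[OF f(1)] hom_closed[OF g(1)]
    by simp
  then show ?thesis using f g m unfolding retract_def by blast
qed

lemma retract_biprod:
  "biprod A S p q c M N \<Longrightarrow> retract A M S (\<lambda>x. c x \<zero>\<^bsub>N\<^esub>) p"
  "biprod A S p q c M N \<Longrightarrow> retract A N S (\<lambda>y. c \<zero>\<^bsub>M\<^esub> y) q"
proof -
  assume b: "biprod A S p q c M N"
  show "retract A M S (\<lambda>x. c x \<zero>\<^bsub>N\<^esub>) p"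
    unfolding retract_def using biprodD[OF b] biprod_inl[OF b] by simp
next
  assume b: "biprod A S p q c M N"
  show "retract A N S (\<lambda>y. c \<zero>\<^bsub>M\<^esub> y) q"
    unfolding retract_def using biprodD[OF b] biprod_inr[OF b] by simp
qed

lemma biprod_internal:
  assumes M: "M \<in> fgmod A" and U: "submodule U A M" and V: "submodule V A M"
    and UV: "U \<inter> V = {\<zero>\<^bsub>M\<^esub>}" "U <+>\<^bsub>M\<^esub> V = carrier M"
    and fg: "M\<lparr>carrier := U\<rparr> \<in> fgmod A" "M\<lparr>carrier := V\<rparr> \<in> fgmod A"
  shows "\<exists>p q. biprod A M p q (\<lambda>x y. x \<oplus>\<^bsub>M\<^esub> y) (M\<lparr>carrier := U\<rparr>) (M\<lparr>carrier := V\<rparr>)"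
proof -
  note Um = submodule_mem[OF U M] and Vm = submodule_mem[OF V M]
  obtain S p q c where b: "biprod A S p q c (M\<lparr>carrier := U\<rparr>) (M\<lparr>carrier := V\<rparr>)"
    using biprod_exists[OF fg] by blast
  note B = biprodD[OF b]
  have pc: "p s \<in> U" "q s \<in> V" "p s \<in> carrier M" "q s \<in> carrier M"
    if "s \<in> carrier S" for s
    using hom_closed[OF B(4) that] hom_closed[OF B(5) that] Um(1) Vm(1) by auto
  define f where "f s = p s \<oplus>\<^bsub>M\<^esub> q s" for s
  have f: "f \<in> lmod_hom A S M" unfolding f_def
    by (rule hom_sum[OF hom_unrestrict_cod[OF B(4) Um(1)] hom_unrestrict_cod[OF B(5) Vm(1)] M])
  have "inj_on f (carrier S)"
    unfolding hom_inj_iff[OF f B(1) M]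
  proof (intro ballI impI)
    fix s assume s: "s \<in> carrier S" and "f s = \<zero>\<^bsub>M\<^esub>"
    then have "\<ominus>\<^bsub>M\<^esub> q s = p s"
      using pc[OF s] fgmod_minus_equality[OF M, of "p s" "q s"] by (simp add: f_def)
    then have "p s \<in> U \<inter> V" using pc[OF s] Vm(5)[of "q s"] by auto
    then have p0: "p s = \<zero>\<^bsub>M\<^esub>" using UV by simp
    then have "q s = \<zero>\<^bsub>M\<^esub>" using \<open>f s = \<zero>\<^bsub>M\<^esub>\<close> pc[OF s] M
      by (simp add: f_def)
    then show "s = \<zero>\<^bsub>S\<^esub>" using p0 B(9)[OF s] biprod_zero[OF b] by simp
  qed
  moreover have "f ` carrier S = carrier M"
  proof
    show "f ` carrier S \<subseteq> carrier M" using hom_closed[OF f] by auto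
    show "carrier M \<subseteq> f ` carrier S"
    proof
      fix x assume "x \<in> carrier M"
      then obtain u v where uv: "u \<in> U" "v \<in> V" "x = u \<oplus>\<^bsub>M\<^esub> v"
        using UV(2) unfolding set_add_def' by blast
      then have "x = f (c u v)" "c u v \<in> carrier S" using B(6)[of u v] B(7)[of u v] B(8)[of u v]
        by (auto simp: f_def)
      then show "x \<in> f ` carrier S" by blast
    qed
  qed
  ultimately obtain g where g: "retract A S M f g" "retract A M S g f"
    using retract_iso[OF f _ B(1) M] by (auto simp: bij_betw_def)
  note G = retractD[OF g(1)] and G' = retractD[OF g(2)]
  have "biprod A M (\<lambda>x. p (g x)) (\<lambda>x. q (g x)) (\<lambda>x y. x \<oplus>\<^bsub>M\<^esub> y) (M\<lparr>carrier := U\<rparr>) (M\<lparr>carrier := V\<rparr>)"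
    unfolding biprod_def
  proof (intro conjI ballI)
    show "(\<lambda>x. p (g x)) \<in> lmod_hom A M (M\<lparr>carrier := U\<rparr>)"
      by (rule hom_comp[OF G(4) B(4)])
    show "(\<lambda>x. q (g x)) \<in> lmod_hom A M (M\<lparr>carrier := V\<rparr>)"
      by (rule hom_comp[OF G(4) B(5)])
    fix x y assume xy: "x \<in> carrier (M\<lparr>carrier := U\<rparr>)" "y \<in> carrier (M\<lparr>carrier := V\<rparr>)"
    have e: "x \<oplus>\<^bsub>M\<^esub> y = f (c x y)" using B(7,8)[OF xy] by (simp add: f_def)
    show "x \<oplus>\<^bsub>M\<^esub> y \<in> carrier M" using xy Um(1) Vm(1) M
      by (auto intro!: fgmod_closed(1))
    show "p (g (x \<oplus>\<^bsub>M\<^esub> y)) = x" "q (g (x \<oplus>\<^bsub>M\<^esub> y)) = y"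
      unfolding e using G(5)[OF B(6)[OF xy]] B(7,8)[OF xy] by auto
  next
    fix s assume "s \<in> carrier M"
    then show "p (g s) \<oplus>\<^bsub>M\<^esub> q (g s) = s" using G'(5)[of s] by (simp add: f_def)
  qed (use M fg in auto)
  then show ?thesis by blast
qed

text \<open>The second alternative says that \<open>s\<close> and \<open>r\<close> are mutually inverse.\<close>

lemma indecomposable_retract:
  assumes ind: "indecomposable A M" and R: "retract A N M s r"
  shows "carrier N = {\<zero>\<^bsub>N\<^esub>} \<or> (\<forall>x\<in>carrier M. s (r x) = x)"
proof -
  note R = retractD[OF R]
  let ?U = "s ` carrier N" and ?V = "a_kernel M N r"
  have U: "submodule ?U A M" by (rule submodule_image[OF R(3,1,2) submodule_carrier[OF R(1)]])
  have V: "submodule ?V A M" by (rule submodule_kernel[OF R(4,2,1)])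
  have dec: "r (x \<oplus>\<^bsub>M\<^esub> \<ominus>\<^bsub>M\<^esub> s (r x)) = \<zero>\<^bsub>N\<^esub>"
    if "x \<in> carrier M" for x
    using that R hom_closed[OF R(3)] hom_closed[OF R(4)] by (simp add: hom_diff[OF R(4,2,1)])
  have "?U \<inter> ?V = {\<zero>\<^bsub>M\<^esub>}"
  proof
    show "{\<zero>\<^bsub>M\<^esub>} \<subseteq> ?U \<inter> ?V"
      using submodule_mem(2)[OF U R(2)] submodule_mem(2)[OF V R(2)] by blast
    show "?U \<inter> ?V \<subseteq> {\<zero>\<^bsub>M\<^esub>}"
      using R(5) hom_zero[OF R(3,1,2)] by (auto simp: a_kernel_def')
  qed
  moreover have "?U <+>\<^bsub>M\<^esub> ?V = carrier M"
  proof
    show "?U <+>\<^bsub>M\<^esub> ?V \<subseteq> carrier M"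
    proof
      fix x assume "x \<in> ?U <+>\<^bsub>M\<^esub> ?V"
      then obtain u v where "u \<in> ?U" "v \<in> ?V" "x = u \<oplus>\<^bsub>M\<^esub> v"
        unfolding set_add_def' by blast
      moreover from this have "u \<in> carrier M" "v \<in> carrier M"
        using submodule_mem(1)[OF U R(2)] submodule_mem(1)[OF V R(2)] by blast+
      ultimately show "x \<in> carrier M" using R(2) by simp
    qed
    show "carrier M \<subseteq> ?U <+>\<^bsub>M\<^esub> ?V"
    proof
      fix x assume x: "x \<in> carrier M"
      let ?v = "x \<oplus>\<^bsub>M\<^esub> \<ominus>\<^bsub>M\<^esub> s (r x)"
      have c: "s (r x) \<in> carrier M" "s (r x) \<in> ?U" using x hom_closed[OF R(3)] hom_closed[OF R(4)]
        by auto
      have "x = s (r x) \<oplus>\<^bsub>M\<^esub> ?v" using x c R(2)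
        by (simp add: fgmod_lcomm[OF R(2), of "s (r x)" x])
      moreover have "?v \<in> ?V" using dec[OF x] x c R(2) by (simp add: a_kernel_def')
      ultimately show "x \<in> ?U <+>\<^bsub>M\<^esub> ?V" using c(2) unfolding set_add_def'
        by blast
    qed
  qed
  ultimately have "?U = {\<zero>\<^bsub>M\<^esub>} \<or> ?V = {\<zero>\<^bsub>M\<^esub>}" using ind U V
    unfolding indecomposable_def by blast
  then show ?thesis
  proof
    assume u: "?U = {\<zero>\<^bsub>M\<^esub>}"
    have "x = \<zero>\<^bsub>N\<^esub>" if "x \<in> carrier N" for x
    proof -
      have "s x = \<zero>\<^bsub>M\<^esub>" using u that by blast
      then show ?thesis using R(5)[OF that] hom_zero[OF R(4,2,1)] by simp
    qed
    then show ?thesis using R(1) by auto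
  next
    assume v: "?V = {\<zero>\<^bsub>M\<^esub>}"
    have "s (r x) = x" if x: "x \<in> carrier M" for x
    proof -
      have c: "s (r x) \<in> carrier M" using x hom_closed[OF R(3)] hom_closed[OF R(4)] by auto
      have "x \<oplus>\<^bsub>M\<^esub> \<ominus>\<^bsub>M\<^esub> s (r x) \<in> ?V" using dec[OF x] x c R(2)
        by (simp add: a_kernel_def')
      then show ?thesis using v fgmod_diff_zero[OF R(2) x c] by simp
    qed
    then show ?thesis by blast
  qed
qed

text \<open>Rings whose finitely generated left modules have finite length.\<close>

locale finite_height_ring = ring A for A :: "('a, 'z) ring_scheme" +
  assumes height: "M \<in> fgmod A \<Longrightarrow> \<exists>\<rho>. strict_rank {U. submodule U A M} \<rho>"
begin

lemma submodule_restrict_iff: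
  assumes "M \<in> fgmod A" "submodule U A M"
  shows "submodule W A (M\<lparr>carrier := U\<rparr>) \<longleftrightarrow> submodule W A M \<and> W \<subseteq> U"
  unfolding left_module.submodule_iff[OF left_module_restrict[OF assms]] submodule_iff[OF assms(1)]
  using submodule_mem(1)[OF assms(2,1)] by auto

lemma restrict_fgmod:
  assumes M: "M \<in> fgmod A" and U: "submodule U A M"
  shows "M\<lparr>carrier := U\<rparr> \<in> fgmod A"
proof -
  interpret M: left_module A M using M by (rule fgmod_left_module)
  note Um = submodule_mem[OF U M]
  obtain \<rho> where \<rho>: "strict_rank {U. submodule U A M} \<rho>" using height[OF M] by blast
  define fin where "fin W \<longleftrightarrow> submodule W A M \<and> W \<subseteq> U \<and>
     (\<exists>S. finite S \<and> S \<subseteq> W \<and> (\<forall>V. submodule V A M \<longrightarrow> S \<subseteq> V \<longrightarrow> W \<subseteq> V))" for W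
  have "fin {\<zero>\<^bsub>M\<^esub>}"
    unfolding fin_def using submodule_zero[OF M] Um(2) submodule_mem(2)[OF _ M]
    by (auto intro!: exI[of _ "{}"])
  moreover have "\<forall>W. fin W \<longrightarrow> \<rho> W \<le> \<rho> U"
    unfolding fin_def using strict_rank_mono[OF \<rho>] U by auto
  ultimately obtain W where W: "fin W"
    and max: "\<And>V. fin V \<Longrightarrow> \<rho> V \<le> \<rho> W"
    using ex_has_greatest_nat[of fin "{\<zero>\<^bsub>M\<^esub>}" \<rho> "Suc (\<rho> U)"]
    by (auto simp: less_Suc_eq_le)
  obtain S where Ws: "submodule W A M" "W \<subseteq> U"
    and S: "finite S" "S \<subseteq> W" "\<And>V. submodule V A M \<Longrightarrow> S \<subseteq> V \<Longrightarrow> W \<subseteq> V"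
    using W unfolding fin_def by blast
  note Wm = submodule_mem[OF Ws(1) M]
  have "U \<subseteq> W"
  proof (rule ccontr)
    \<comment> \<open>\<open>W\<close> is a finitely generated submodule of \<open>U\<close> of maximal rank\<close>
    assume "\<not> U \<subseteq> W"
    then obtain x where x: "x \<in> U" "x \<notin> W" by blast
    have xc: "x \<in> carrier M" using x Um(1) by blast
    define T where "T = {a \<odot>\<^bsub>M\<^esub> x \<oplus>\<^bsub>M\<^esub> w |a w. a \<in> carrier A \<and> w \<in> W}"
    have Wc: "\<And>w. w \<in> W \<Longrightarrow> w \<in> carrier M" using Wm(1) by blast
    have TI: "a \<odot>\<^bsub>M\<^esub> x \<oplus>\<^bsub>M\<^esub> w \<in> T"
      if "a \<in> carrier A" "w \<in> W" for a w using that unfolding T_def by blast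
    have T: "submodule T A M"
      unfolding M.submodule_iff
    proof (intro conjI ballI)
      show "T \<subseteq> carrier M" unfolding T_def using xc Wc M by auto
      show "\<zero>\<^bsub>M\<^esub> \<in> T"
        using TI[of "\<zero>\<^bsub>A\<^esub>" "\<zero>\<^bsub>M\<^esub>"] Wm(2) xc by simp
    next
      fix u v assume "u \<in> T" "v \<in> T"
      then obtain a b w w' where h: "a \<in> carrier A" "b \<in> carrier A" "w \<in> W" "w' \<in> W"
        "u = a \<odot>\<^bsub>M\<^esub> x \<oplus>\<^bsub>M\<^esub> w" "v = b \<odot>\<^bsub>M\<^esub> x \<oplus>\<^bsub>M\<^esub> w'" unfolding T_def
          by blast
      then have "u \<oplus>\<^bsub>M\<^esub> v = (a \<oplus>\<^bsub>A\<^esub> b) \<odot>\<^bsub>M\<^esub> x \<oplus>\<^bsub>M\<^esub> (w \<oplus>\<^bsub>M\<^esub> w')"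
        using xc Wc by (simp add: M.smult_l_distr M.M.a_ac)
      then show "u \<oplus>\<^bsub>M\<^esub> v \<in> T" using TI h Wm(3) by simp
    next
      fix e u assume e: "e \<in> carrier A" and "u \<in> T"
      then obtain a w where h: "a \<in> carrier A" "w \<in> W" "u = a \<odot>\<^bsub>M\<^esub> x \<oplus>\<^bsub>M\<^esub> w" unfolding T_def
        by blast
      then have "e \<odot>\<^bsub>M\<^esub> u = (e \<otimes>\<^bsub>A\<^esub> a) \<odot>\<^bsub>M\<^esub> x \<oplus>\<^bsub>M\<^esub> e \<odot>\<^bsub>M\<^esub> w"
        using xc Wc e by (simp add: M.smult_r_distr M.smult_assoc1)
      then show "e \<odot>\<^bsub>M\<^esub> u \<in> T" using TI h e Wm(4) by simp
    qed
    have xT: "x \<in> T" using TI[of "\<one>\<^bsub>A\<^esub>" "\<zero>\<^bsub>M\<^esub>"] Wm(2) xc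
      by simp
    have WT: "W \<subseteq> T" using TI[of "\<zero>\<^bsub>A\<^esub>"] xc Wc by auto
    have TU: "T \<subseteq> U" unfolding T_def using x(1) Ws(2) Um(3,4) by blast
    have "T \<subseteq> V" if V: "submodule V A M" "insert x S \<subseteq> V" for V
    proof -
      have "W \<subseteq> V" "x \<in> V" using S(3)[OF V(1)] V(2) by auto
      then show ?thesis unfolding T_def using submodule_mem(3,4)[OF V(1) M] by blast
    qed
    then have "fin T" unfolding fin_def using T TU S(1,2) xT WT
      by (intro conjI exI[of _ "insert x S"]) auto
    moreover have "\<rho> W < \<rho> T"
      by (rule strict_rankD[OF \<rho>]) (use T Ws(1) WT xT x(2) in auto)
    ultimately show False using max[of T] by simp
  qed
  then have WU: "W = U" using Ws(2) by blast
  have "finitely_generated A (M\<lparr>carrier := U\<rparr>)"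
    unfolding left_module.finitely_generated_iff[OF left_module_restrict[OF M U]]
    using S WU by (intro exI[of _ S]) (auto simp: submodule_restrict_iff[OF M U])
  then show ?thesis using left_module_restrict[OF M U] by (simp add: fgmod_def)
qed

lemma kernel_fgmod:
  "f \<in> lmod_hom A M N \<Longrightarrow> M \<in> fgmod A \<Longrightarrow> N \<in> fgmod A \<Longrightarrow> M\<lparr>carrier := a_kernel M N f\<rparr> \<in> fgmod A"
  by (rule restrict_fgmod[OF _ submodule_kernel])

lemma zero_fgmod: "M \<in> fgmod A \<Longrightarrow> M\<lparr>carrier := {\<zero>\<^bsub>M\<^esub>}\<rparr> \<in> fgmod A"
  by (rule restrict_fgmod[OF _ submodule_zero])

end

section \<open>Projective dimension\<close>

text \<open>An exact sequence \<open>0 \<rightarrow> K \<rightarrow> E \<rightarrow> Y \<rightarrow> 0\<close> with maps \<open>i\<close> and \<open>g\<close>.\<close>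

definition short_exact where
  "short_exact A K i E g Y \<longleftrightarrow> K \<in> fgmod A \<and> E \<in> fgmod A \<and> Y \<in> fgmod A \<and>
     i \<in> lmod_hom A K E \<and> g \<in> lmod_hom A E Y \<and> inj_on i (carrier K) \<and> g ` carrier E = carrier Y \<and>
     (\<forall>x\<in>carrier K. g (i x) = \<zero>\<^bsub>Y\<^esub>) \<and>
     (\<forall>e\<in>carrier E. g e = \<zero>\<^bsub>Y\<^esub> \<longrightarrow> (\<exists>x\<in>carrier K. e = i x))"

lemma short_exactD:
  assumes "short_exact A K i E g Y"
  shows "K \<in> fgmod A" "E \<in> fgmod A" "Y \<in> fgmod A" "i \<in> lmod_hom A K E" "g \<in> lmod_hom A E Y"
    "inj_on i (carrier K)" "g ` carrier E = carrier Y" "\<And>x. x \<in> carrier K \<Longrightarrow> g (i x) = \<zero>\<^bsub>Y\<^esub>"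
    "\<And>e. e \<in> carrier E \<Longrightarrow> g e = \<zero>\<^bsub>Y\<^esub> \<Longrightarrow> \<exists>x\<in>carrier K. e = i x"
  using assms unfolding short_exact_def by auto

lemma short_exact_biprod: "biprod A S p q c M N \<Longrightarrow> short_exact A M (\<lambda>x. c x \<zero>\<^bsub>N\<^esub>) S q N"
proof -
  assume b: "biprod A S p q c M N"
  note B = biprodD[OF b]
  have "inj_on (\<lambda>x. c x \<zero>\<^bsub>N\<^esub>) (carrier M)"
    by (rule inj_on_inverseI[of _ p]) (use B in auto)
  moreover have "q ` carrier S = carrier N"
  proof
    show "q ` carrier S \<subseteq> carrier N" using hom_closed[OF B(5)] by auto
    show "carrier N \<subseteq> q ` carrier S"
    proof
      fix y assume "y \<in> carrier N"
      then have "q (c \<zero>\<^bsub>M\<^esub> y) = y" "c \<zero>\<^bsub>M\<^esub> y \<in> carrier S"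
        using B(2,6,8) by auto
      then show "y \<in> q ` carrier S" by (metis image_eqI)
    qed
  qed
  moreover have "\<exists>x\<in>carrier M. e = c x \<zero>\<^bsub>N\<^esub>"
    if "e \<in> carrier S" "q e = \<zero>\<^bsub>N\<^esub>" for e
    using B(9)[OF that(1)] that hom_closed[OF B(4)] by (intro bexI[of _ "p e"]) auto
  ultimately show ?thesis unfolding short_exact_def using B biprod_inl[OF b] by simp
qed


lemma projectiveD:
  assumes "projective A P" "g \<in> lmod_hom A M N" "g ` carrier M = carrier N" "f \<in> lmod_hom A P N"
    "M \<in> fgmod A" "N \<in> fgmod A"
  shows "\<exists>h\<in>lmod_hom A P M. \<forall>x\<in>carrier P. g (h x) = f x"
  using assms unfolding projective_def by blast

lemma projective_fgmod: "projective A P \<Longrightarrow> P \<in> fgmod A"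
  by (simp add: projective_def)

lemma projectiveI:
  assumes "P \<in> fgmod A"
    "\<And>M N g f. M \<in> fgmod A \<Longrightarrow> N \<in> fgmod A \<Longrightarrow> g \<in> lmod_hom A M N \<Longrightarrow> f \<in> lmod_hom A P N \<Longrightarrow>
       g ` carrier M = carrier N \<Longrightarrow> \<exists>h\<in>lmod_hom A P M. \<forall>x\<in>carrier P. g (h x) = f x"
  shows "projective A P"
  using assms unfolding projective_def by blast

lemma injectiveD:
  assumes "injective A E" "g \<in> lmod_hom A M N" "inj_on g (carrier M)" "f \<in> lmod_hom A M E"
    "M \<in> fgmod A" "N \<in> fgmod A"
  shows "\<exists>h\<in>lmod_hom A N E. \<forall>x\<in>carrier M. h (g x) = f x"
  using assms unfolding injective_def by blast

lemma injective_fgmod: "injective A P \<Longrightarrow> P \<in> fgmod A"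
  by (simp add: injective_def)

lemma injectiveI:
  assumes "E \<in> fgmod A"
    "\<And>M N g f. M \<in> fgmod A \<Longrightarrow> N \<in> fgmod A \<Longrightarrow> g \<in> lmod_hom A M N \<Longrightarrow> f \<in> lmod_hom A M E \<Longrightarrow>
       inj_on g (carrier M) \<Longrightarrow> \<exists>h\<in>lmod_hom A N E. \<forall>x\<in>carrier M. h (g x) = f x"
  shows "injective A E"
  using assms unfolding injective_def by blast

lemma projective_retract:
  assumes P: "projective A M" and R: "retract A N M s r"
  shows "projective A N"
proof (rule projectiveI)
  note R = retractD[OF R]
  show "N \<in> fgmod A" by (rule R(1))
  fix X Y g f assume h: "X \<in> fgmod A" "Y \<in> fgmod A" "g \<in> lmod_hom A X Y" "f \<in> lmod_hom A N Y"
    "g ` carrier X = carrier Y"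
  obtain k where k: "k \<in> lmod_hom A M X" "\<And>x. x \<in> carrier M \<Longrightarrow> g (k x) = f (r x)"
    using projectiveD[OF P h(3,5) hom_comp[OF R(4) h(4)] h(1,2)] by blast
  show "\<exists>h\<in>lmod_hom A N X. \<forall>x\<in>carrier N. g (h x) = f x"
    using hom_comp[OF R(3) k(1)] k(2) R(5) hom_closed[OF R(3)]
    by (intro bexI[of _ "\<lambda>x. k (s x)"]) auto
qed

lemma injective_retract:
  assumes P: "injective A M" and R: "retract A N M s r"
  shows "injective A N"
proof (rule injectiveI)
  note R = retractD[OF R]
  show "N \<in> fgmod A" by (rule R(1))
  fix X Y g f assume h: "X \<in> fgmod A" "Y \<in> fgmod A" "g \<in> lmod_hom A X Y" "f \<in> lmod_hom A X N"
    "inj_on g (carrier X)"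
  obtain k where k: "k \<in> lmod_hom A Y M" "\<And>x. x \<in> carrier X \<Longrightarrow> k (g x) = s (f x)"
    using injectiveD[OF P h(3,5) hom_comp[OF h(4) R(3)] h(1,2)] by blast
  show "\<exists>h\<in>lmod_hom A Y N. \<forall>x\<in>carrier X. h (g x) = f x"
    using hom_comp[OF k(1) R(4)] k(2) R(5) hom_closed[OF h(4)]
    by (intro bexI[of _ "\<lambda>x. r (k x)"]) auto
qed

lemma projective_biprod:
  assumes b: "biprod A S p q c P Q" and P: "projective A P" and Q: "projective A Q"
  shows "projective A S"
proof (rule projectiveI)
  note B = biprodD[OF b]
  show "S \<in> fgmod A" by (rule B(1))
  fix X Y g f assume h: "X \<in> fgmod A" "Y \<in> fgmod A" "g \<in> lmod_hom A X Y" "f \<in> lmod_hom A S Y"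
    "g ` carrier X = carrier Y"
  obtain k where k: "k \<in> lmod_hom A P X" "\<And>x. x \<in> carrier P \<Longrightarrow> g (k x) = f (c x \<zero>\<^bsub>Q\<^esub>)"
    using projectiveD[OF P h(3,5) hom_comp[OF biprod_inl[OF b] h(4)] h(1,2)] by blast
  obtain l where l: "l \<in> lmod_hom A Q X" "\<And>x. x \<in> carrier Q \<Longrightarrow> g (l x) = f (c \<zero>\<^bsub>P\<^esub> x)"
    using projectiveD[OF Q h(3,5) hom_comp[OF biprod_inr[OF b] h(4)] h(1,2)] by blast
  let ?h = "\<lambda>x. k (p x) \<oplus>\<^bsub>X\<^esub> l (q x)"
  have "?h \<in> lmod_hom A S X"
    by (rule hom_sum[OF hom_comp[OF B(4) k(1)] hom_comp[OF B(5) l(1)] h(1)])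
  moreover have "g (?h x) = f x" if x: "x \<in> carrier S" for x
  proof -
    have px: "p x \<in> carrier P" "q x \<in> carrier Q" using x hom_closed[OF B(4)] hom_closed[OF B(5)]
      by auto
    have "g (?h x) = f (c (p x) \<zero>\<^bsub>Q\<^esub>) \<oplus>\<^bsub>Y\<^esub> f (c \<zero>\<^bsub>P\<^esub> (q x))"
      using px k l hom_closed[OF k(1)] hom_closed[OF l(1)] by (simp add: hom_add[OF h(3)])
    also have "\<dots> = f (c (p x) \<zero>\<^bsub>Q\<^esub> \<oplus>\<^bsub>S\<^esub> c \<zero>\<^bsub>P\<^esub> (q x))"
      using px B(2,3,6) by (simp add: hom_add[OF h(4)])
    also have "\<dots> = f x" using biprod_split[OF b x] by simp
    finally show ?thesis .
  qed
  ultimately show "\<exists>h\<in>lmod_hom A S X. \<forall>x\<in>carrier S. g (h x) = f x"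
    by (intro bexI[of _ ?h]) auto
qed

lemma injective_biprod:
  assumes b: "biprod A S p q c P Q" and P: "injective A P" and Q: "injective A Q"
  shows "injective A S"
proof (rule injectiveI)
  note B = biprodD[OF b]
  show "S \<in> fgmod A" by (rule B(1))
  fix X Y g f assume h: "X \<in> fgmod A" "Y \<in> fgmod A" "g \<in> lmod_hom A X Y" "f \<in> lmod_hom A X S"
    "inj_on g (carrier X)"
  obtain k where k: "k \<in> lmod_hom A Y P" "\<And>x. x \<in> carrier X \<Longrightarrow> k (g x) = p (f x)"
    using injectiveD[OF P h(3,5) hom_comp[OF h(4) B(4)] h(1,2)] by blast
  obtain l where l: "l \<in> lmod_hom A Y Q" "\<And>x. x \<in> carrier X \<Longrightarrow> l (g x) = q (f x)"
    using injectiveD[OF Q h(3,5) hom_comp[OF h(4) B(5)] h(1,2)] by blast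
  show "\<exists>h\<in>lmod_hom A Y S. \<forall>x\<in>carrier X. h (g x) = f x"
    using biprod_hom[OF b k(1) l(1)] k(2) l(2) B(9) hom_closed[OF h(4)]
    by (intro bexI[of _ "\<lambda>x. c (k x) (l x)"]) auto
qed

lemma zero_module_hom:
  assumes "f \<in> lmod_hom A N M" "carrier N = {\<zero>\<^bsub>N\<^esub>}" "N \<in> fgmod A" "M \<in> fgmod A" "x \<in> carrier N"
  shows "f x = \<zero>\<^bsub>M\<^esub>"
  using assms hom_zero[OF assms(1,3,4)] by simp

lemma projective_zero:
  assumes N: "N \<in> fgmod A" "carrier N = {\<zero>\<^bsub>N\<^esub>}"
  shows "projective A N"
proof (rule projectiveI)
  fix X Y g f assume h: "X \<in> fgmod A" "Y \<in> fgmod A" "g \<in> lmod_hom A X Y" "f \<in> lmod_hom A N Y"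
  show "\<exists>h\<in>lmod_hom A N X. \<forall>x\<in>carrier N. g (h x) = f x"
    using zero_module_hom[OF h(4) N(2,1) h(2)] hom_zero[OF h(3,1,2)] hom_zero_map[OF h(1)]
    by (intro bexI[of _ "\<lambda>x. \<zero>\<^bsub>X\<^esub>"]) auto
qed (rule N)

lemma injective_zero:
  assumes N: "N \<in> fgmod A" "carrier N = {\<zero>\<^bsub>N\<^esub>}"
  shows "injective A N"
proof (rule injectiveI)
  fix X Y g f assume h: "X \<in> fgmod A" "Y \<in> fgmod A" "g \<in> lmod_hom A X Y" "f \<in> lmod_hom A X N"
  have "\<And>x. x \<in> carrier X \<Longrightarrow> f x = \<zero>\<^bsub>N\<^esub>"
    using hom_closed[OF h(4)] N by auto
  then show "\<exists>h\<in>lmod_hom A Y N. \<forall>x\<in>carrier X. h (g x) = f x"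
    using hom_zero_map[OF N(1)] by (intro bexI[of _ "\<lambda>x. \<zero>\<^bsub>N\<^esub>"]) auto
qed (rule N)

text \<open>The regular module, with its generator \<open>e\<close>; the one-element lists serve as its carrier.\<close>

lemma (in ring) regular_module:
  "\<exists>P e. projective R P \<and> e \<in> carrier P \<and>
     (\<forall>M\<in>fgmod R. \<forall>x\<in>carrier M. \<exists>f\<in>lmod_hom R P M. f e = x)"
proof -
  define P :: "'a lmod" where
    "P = \<lparr>carrier = (\<lambda>a. [a]) ` carrier R, mult = (\<lambda>x y. x), one = [\<zero>\<^bsub>R\<^esub>], zero = [\<zero>\<^bsub>R\<^esub>],
       add = (\<lambda>x y. [hd x \<oplus>\<^bsub>R\<^esub> hd y]), smult = (\<lambda>a x. [a \<otimes>\<^bsub>R\<^esub> hd x])\<rparr>"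
  have P: "left_module R P"
  proof (intro left_module.intro left_module_axioms.intro)
    show "abelian_group P"
    proof (rule abelian_groupI)
      fix x assume "x \<in> carrier P"
      then show "\<exists>y\<in>carrier P. y \<oplus>\<^bsub>P\<^esub> x = \<zero>\<^bsub>P\<^esub>"
        by (intro bexI[of _ "[\<ominus>\<^bsub>R\<^esub> hd x]"]) (auto simp: P_def l_neg)
    qed (auto simp: P_def a_ac)
  qed (auto simp: P_def l_distr r_distr m_assoc ring_axioms)
  interpret P: left_module R P by (rule P)
  have gen: "x = hd x \<odot>\<^bsub>P\<^esub> [\<one>\<^bsub>R\<^esub>]" "hd x \<in> carrier R"
    if "x \<in> carrier P" for x
    using that by (auto simp: P_def)
  have e: "[\<one>\<^bsub>R\<^esub>] \<in> carrier P" by (simp add: P_def)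
  have "finitely_generated R P"
    unfolding P.finitely_generated_iff
  proof (intro exI[of _ "{[\<one>\<^bsub>R\<^esub>]}"] conjI allI impI)
    fix U assume U: "submodule U R P" "{[\<one>\<^bsub>R\<^esub>]} \<subseteq> U"
    have "x \<in> U" if "x \<in> carrier P" for x
      using U gen[OF that] unfolding P.submodule_iff by (metis insert_subset)
    then show "U = carrier P" using U(1) unfolding P.submodule_iff by blast
  qed (use e in auto)
  then have Pf: "P \<in> fgmod R" using P by (simp add: fgmod_def)
  have hom: "(\<lambda>y. hd y \<odot>\<^bsub>M\<^esub> x) \<in> lmod_hom R P M"
    if M: "M \<in> fgmod R" "x \<in> carrier M" for M x
  proof -
    interpret M: left_module R M using M(1) by (rule fgmod_left_module)
    show ?thesis using M(2) by (intro homI) (auto simp: P_def M.smult_l_distr M.smult_assoc1)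
  qed
  have ex: "\<exists>f\<in>lmod_hom R P M. f [\<one>\<^bsub>R\<^esub>] = x"
    if M: "M \<in> fgmod R" "x \<in> carrier M" for M x
    using hom[OF M] left_module.smult_one[OF fgmod_left_module[OF M(1)] M(2)]
    by (intro bexI[of _ "\<lambda>y. hd y \<odot>\<^bsub>M\<^esub> x"]) auto
  have "projective R P"
  proof (rule projectiveI[OF Pf])
    fix X Y g f assume h: "X \<in> fgmod R" "Y \<in> fgmod R" "g \<in> lmod_hom R X Y" "f \<in> lmod_hom R P Y"
      "g ` carrier X = carrier Y"
    have "f [\<one>\<^bsub>R\<^esub>] \<in> g ` carrier X" using hom_closed[OF h(4) e] h(5) by simp
    then obtain x where x: "x \<in> carrier X" "g x = f [\<one>\<^bsub>R\<^esub>]" by auto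
    have "g (hd y \<odot>\<^bsub>X\<^esub> x) = f y" if y: "y \<in> carrier P" for y
    proof -
      have "g (hd y \<odot>\<^bsub>X\<^esub> x) = f (hd y \<odot>\<^bsub>P\<^esub> [\<one>\<^bsub>R\<^esub>])"
        using gen(2)[OF y] x e by (simp add: hom_smult[OF h(3)] hom_smult[OF h(4)])
      then show ?thesis using gen(1)[OF y] by simp
    qed
    then show "\<exists>h\<in>lmod_hom R P X. \<forall>x\<in>carrier P. g (h x) = f x"
      using hom[OF h(1) x(1)]
      by (intro bexI[of _ "\<lambda>y. hd y \<odot>\<^bsub>X\<^esub> x"]) auto
  qed
  then show ?thesis using e ex by blast
qed

text \<open>Projective dimension at most \<open>n\<close>, by recursion over the kernels in a projective resolution.\<close>

primrec pd_le :: "('a, 'z) ring_scheme \<Rightarrow> nat \<Rightarrow> 'a lmod \<Rightarrow> bool" where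
  "pd_le A 0 M \<longleftrightarrow> projective A M"
| "pd_le A (Suc n) M \<longleftrightarrow> M \<in> fgmod A \<and> (\<exists>P p. projective A P \<and> p \<in> lmod_hom A P M \<and>
     p ` carrier P = carrier M \<and> pd_le A n (P\<lparr>carrier := a_kernel P M p\<rparr>))"

lemma pd_le_fgmod: "pd_le A n M \<Longrightarrow> M \<in> fgmod A"
  by (cases n) (auto simp: projective_fgmod)

lemma a_kernel_subset: "a_kernel M N f \<subseteq> carrier M"
  by (auto simp: a_kernel_def')

context finite_height_ring
begin

lemma enough_projectives:
  assumes M: "M \<in> fgmod A"
  shows "\<exists>P p. projective A P \<and> p \<in> lmod_hom A P M \<and> p ` carrier P = carrier M"
proof -
  interpret M: left_module A M using M by (rule fgmod_left_module)
  obtain R e where R: "projective A R" "e \<in> carrier R"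
    "\<And>M x. M \<in> fgmod A \<Longrightarrow> x \<in> carrier M \<Longrightarrow> \<exists>f\<in>lmod_hom A R M. f e = x"
    using regular_module by auto
  have step: "\<exists>P p. projective A P \<and> p \<in> lmod_hom A P M \<and> F \<subseteq> p ` carrier P"
    if "finite F" "F \<subseteq> carrier M" for F
    using that
  proof (induction F)
    case empty
    let ?Z = "M\<lparr>carrier := {\<zero>\<^bsub>M\<^esub>}\<rparr>"
    have "projective A ?Z" by (rule projective_zero[OF zero_fgmod[OF M]]) simp
    then show ?case using hom_zero_map[OF M] by blast
  next
    case (insert x F)
    then obtain P p where P: "projective A P" "p \<in> lmod_hom A P M" "F \<subseteq> p ` carrier P"
      by auto
    obtain f where f: "f \<in> lmod_hom A R M" "f e = x" using R(3)[OF M, of x] insert.prems by auto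
    obtain S u v c where b: "biprod A S u v c P R"
      using biprod_exists[OF projective_fgmod[OF P(1)] projective_fgmod[OF R(1)]] by blast
    note B = biprodD[OF b]
    let ?h = "\<lambda>s. p (u s) \<oplus>\<^bsub>M\<^esub> f (v s)"
    have h: "?h \<in> lmod_hom A S M"
      by (rule hom_sum[OF hom_comp[OF B(4) P(2)] hom_comp[OF B(5) f(1)] M])
    have 1: "p y \<in> ?h ` carrier S" if y: "y \<in> carrier P" for y
    proof -
      have "p y = ?h (c y \<zero>\<^bsub>R\<^esub>)"
        using y B(2,3,6,7,8) M hom_closed[OF P(2)] hom_zero[OF f(1) B(3) M] by simp
      then show ?thesis using B(3,6) y
        by (intro image_eqI[of _ ?h "c y \<zero>\<^bsub>R\<^esub>"]) auto
    qed
    have "x = ?h (c \<zero>\<^bsub>P\<^esub> e)"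
      using R(2) f(2) B(2,3,6,7,8) M hom_closed[OF f(1) R(2)] hom_zero[OF P(2) B(2) M] by simp
    moreover have "c \<zero>\<^bsub>P\<^esub> e \<in> carrier S" using B(2,6) R(2) by simp
    ultimately have "x \<in> ?h ` carrier S" by (rule image_eqI)
    moreover have "F \<subseteq> ?h ` carrier S" using 1 P(3) by auto
    ultimately have "insert x F \<subseteq> ?h ` carrier S" by simp
    then show ?case using h projective_biprod[OF b P(1) R(1)] by blast
  qed
  have "finitely_generated A M" using M by (simp add: fgmod_def)
  then obtain S where S: "finite S" "S \<subseteq> carrier M"
    and gen: "\<And>U. submodule U A M \<Longrightarrow> S \<subseteq> U \<Longrightarrow> U = carrier M"
    unfolding M.finitely_generated_iff by blast
  obtain P p where P: "projective A P" "p \<in> lmod_hom A P M" "S \<subseteq> p ` carrier P"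
    using step[OF S] by blast
  have "submodule (p ` carrier P) A M"
    by (rule submodule_image[OF P(2) projective_fgmod[OF P(1)] M submodule_carrier[OF projective_fgmod[OF P(1)]]])
  then have "p ` carrier P = carrier M" using P(3) gen by blast
  then show ?thesis using P by blast
qed

lemma pd_le_projective: "projective A P \<Longrightarrow> pd_le A n P"
proof (induction n arbitrary: P)
  case (Suc n)
  have P: "P \<in> fgmod A" using Suc.prems by (rule projective_fgmod)
  have z: "a_kernel P P (\<lambda>x. x) = {\<zero>\<^bsub>P\<^esub>}" using P
    by (auto simp: a_kernel_def')
  have "projective A (P\<lparr>carrier := {\<zero>\<^bsub>P\<^esub>}\<rparr>)"
    by (rule projective_zero[OF zero_fgmod[OF P]]) simp
  then have "pd_le A n (P\<lparr>carrier := a_kernel P P (\<lambda>x. x)\<rparr>)" unfolding z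
    by (rule Suc.IH)
  then show ?case using P Suc.prems hom_id by (auto intro!: exI[of _ P] exI[of _ "\<lambda>x. x"])
qed simp

lemma pd_le_Suc: "pd_le A n M \<Longrightarrow> pd_le A (Suc n) M"
proof (induction n arbitrary: M)
  case 0 then show ?case using pd_le_projective[of M "Suc 0"] by simp
next
  case (Suc n)
  obtain P p where "projective A P" "p \<in> lmod_hom A P M" "p ` carrier P = carrier M"
    "pd_le A n (P\<lparr>carrier := a_kernel P M p\<rparr>)" using Suc.prems by auto
  then show ?case using Suc.IH pd_le_fgmod[OF Suc.prems] unfolding pd_le.simps(2)[of A "Suc n"]
    by blast
qed

lemma pd_le_mono: "n \<le> m \<Longrightarrow> pd_le A n M \<Longrightarrow> pd_le A m M"
  by (induction m rule: dec_induct) (auto intro: pd_le_Suc simp del: pd_le.simps)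

text \<open>The induction step is the horseshoe lemma.\<close>

lemma pd_le_extension:
  "short_exact A K i E g Y \<Longrightarrow> pd_le A n K \<Longrightarrow> pd_le A n Y \<Longrightarrow> pd_le A n E"
proof (induction n arbitrary: K i E g Y)
  case 0
  note X = short_exactD[OF "0.prems"(1)]
  obtain \<sigma> where \<sigma>: "\<sigma> \<in> lmod_hom A Y E" "\<And>y. y \<in> carrier Y \<Longrightarrow> g (\<sigma> y) = y"
    using projectiveD[OF _ X(5,7) hom_id X(2,3)] 0 by auto
  obtain S p q c where b: "biprod A S p q c K Y" using biprod_exists X by blast
  note B = biprodD[OF b]
  have \<delta>: "(\<lambda>e. e \<oplus>\<^bsub>E\<^esub> \<ominus>\<^bsub>E\<^esub> \<sigma> (g e)) \<in> lmod_hom A E E"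
    by (rule hom_diff_map[OF hom_id hom_comp[OF X(5) \<sigma>(1)] X(2)])
  have c: "\<sigma> (g e) \<in> carrier E" "g e \<in> carrier Y" if "e \<in> carrier E" for e
    using that hom_closed[OF X(5)] hom_closed[OF \<sigma>(1)] by auto
  have "e \<oplus>\<^bsub>E\<^esub> \<ominus>\<^bsub>E\<^esub> \<sigma> (g e) \<in> i ` carrier K"
    if e: "e \<in> carrier E" for e
  proof -
    have "g (e \<oplus>\<^bsub>E\<^esub> \<ominus>\<^bsub>E\<^esub> \<sigma> (g e)) = \<zero>\<^bsub>Y\<^esub>"
      using e c X(3) by (simp add: hom_diff[OF X(5,2,3)] \<sigma>(2))
    then show ?thesis
      using X(9)[of "e \<oplus>\<^bsub>E\<^esub> \<ominus>\<^bsub>E\<^esub> \<sigma> (g e)"] e c X(2)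
      by auto
  qed
  then obtain k where k: "k \<in> lmod_hom A E K"
    "\<And>e. e \<in> carrier E \<Longrightarrow> i (k e) = e \<oplus>\<^bsub>E\<^esub> \<ominus>\<^bsub>E\<^esub> \<sigma> (g e)"
    using factor_inj[OF X(4,6) \<delta> X(1)] by blast
  have r: "(\<lambda>s. i (p s) \<oplus>\<^bsub>E\<^esub> \<sigma> (q s)) \<in> lmod_hom A S E"
    by (rule hom_sum[OF hom_comp[OF B(4) X(4)] hom_comp[OF B(5) \<sigma>(1)] X(2)])
  have "retract A E S (\<lambda>e. c (k e) (g e)) (\<lambda>s. i (p s) \<oplus>\<^bsub>E\<^esub> \<sigma> (q s))"
    unfolding retract_def
    using X(2) B(1) biprod_hom[OF b k(1) X(5)] r k(2) c B(7,8) hom_closed[OF k(1)] by simp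
  then show ?case using projective_retract projective_biprod[OF b] 0 by auto
next
  case (Suc n)
  note X = short_exactD[OF Suc.prems(1)]
  obtain P p where P: "projective A P" "p \<in> lmod_hom A P K" "p ` carrier P = carrier K"
    "pd_le A n (P\<lparr>carrier := a_kernel P K p\<rparr>)" using Suc.prems(2) by auto
  obtain Q q where Q: "projective A Q" "q \<in> lmod_hom A Q Y" "q ` carrier Q = carrier Y"
    "pd_le A n (Q\<lparr>carrier := a_kernel Q Y q\<rparr>)" using Suc.prems(3) by auto
  have Pf: "P \<in> fgmod A" and Qf: "Q \<in> fgmod A" using P Q projective_fgmod by auto
  obtain q' where q': "q' \<in> lmod_hom A Q E" "\<And>x. x \<in> carrier Q \<Longrightarrow> g (q' x) = q x"
    using projectiveD[OF Q(1) X(5,7) Q(2) X(2,3)] by blast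
  obtain S u v c where b: "biprod A S u v c P Q" using biprod_exists[OF Pf Qf] by blast
  note B = biprodD[OF b]
  define t where "t s = i (p (u s)) \<oplus>\<^bsub>E\<^esub> q' (v s)" for s
  have t: "t \<in> lmod_hom A S E" unfolding t_def
    by (rule hom_sum[OF hom_comp[OF hom_comp[OF B(4) P(2)] X(4)] hom_comp[OF B(5) q'(1)] X(2)])
  have cl: "i (p x) \<in> carrier E" "p x \<in> carrier K" if "x \<in> carrier P" for x
    using that hom_closed[OF P(2)] hom_closed[OF X(4)] by auto
  have cl2: "q' y \<in> carrier E" "q y \<in> carrier Y" if "y \<in> carrier Q" for y
    using that hom_closed[OF Q(2)] hom_closed[OF q'(1)] by auto
  have uv: "u s \<in> carrier P" "v s \<in> carrier Q" if "s \<in> carrier S" for s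
    using that hom_closed[OF B(4)] hom_closed[OF B(5)] by auto
  have tc: "t (c x y) = i (p x) \<oplus>\<^bsub>E\<^esub> q' y"
    if "x \<in> carrier P" "y \<in> carrier Q" for x y
    using that B(7,8) by (simp add: t_def)
  have gt: "g (t s) = q (v s)" if "s \<in> carrier S" for s
    using uv[OF that] cl cl2 X(3,8) by (simp add: t_def hom_add[OF X(5)] q'(2))
  have lift: "\<exists>x\<in>carrier P. e = i (p x)"
    if e: "e \<in> carrier E" "g e = \<zero>\<^bsub>Y\<^esub>" for e
  proof -
    obtain k where "k \<in> carrier K" "e = i k" using X(9)[OF e] by blast
    then show ?thesis using P(3) by (metis imageE)
  qed
  have surj: "t ` carrier S = carrier E"
  proof
    show "t ` carrier S \<subseteq> carrier E" using hom_closed[OF t] by auto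
    show "carrier E \<subseteq> t ` carrier S"
    proof
      fix e assume e: "e \<in> carrier E"
      then have "g e \<in> q ` carrier Q" using Q(3) hom_closed[OF X(5)] by simp
      then obtain y where y: "y \<in> carrier Q" "g e = q y" by blast
      have "g (e \<oplus>\<^bsub>E\<^esub> \<ominus>\<^bsub>E\<^esub> q' y) = \<zero>\<^bsub>Y\<^esub>"
        using e y cl2 X(2,3) by (simp add: hom_diff[OF X(5,2,3)] q'(2))
      then obtain x where x: "x \<in> carrier P" "e \<oplus>\<^bsub>E\<^esub> \<ominus>\<^bsub>E\<^esub> q' y = i (p x)"
        using lift[of "e \<oplus>\<^bsub>E\<^esub> \<ominus>\<^bsub>E\<^esub> q' y"] e y cl2 X(2)
        by auto
      have "e = t (c x y)" using tc[OF x(1) y(1)] x(2)[symmetric] e y cl2 X(2) by simp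
      then show "e \<in> t ` carrier S" using B(6)[OF x(1) y(1)] by blast
    qed
  qed
  let ?K = "P\<lparr>carrier := a_kernel P K p\<rparr>"
    and ?W = "S\<lparr>carrier := a_kernel S E t\<rparr>"
    and ?Y = "Q\<lparr>carrier := a_kernel Q Y q\<rparr>"
  have "short_exact A ?K (\<lambda>x. c x \<zero>\<^bsub>Q\<^esub>) ?W v ?Y"
    unfolding short_exact_def
  proof (intro conjI ballI impI)
    show "?K \<in> fgmod A" "?W \<in> fgmod A" "?Y \<in> fgmod A"
      using kernel_fgmod P(2) t Q(2) Pf Qf B(1) X by auto
    have "t (c x \<zero>\<^bsub>Q\<^esub>) = \<zero>\<^bsub>E\<^esub>"
      if "x \<in> carrier P" "p x = \<zero>\<^bsub>K\<^esub>" for x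
      using that tc[of x "\<zero>\<^bsub>Q\<^esub>"] Qf X(2) hom_zero[OF X(4,1,2)] hom_zero[OF q'(1) Qf X(2)]
      by simp
    then show "(\<lambda>x. c x \<zero>\<^bsub>Q\<^esub>) \<in> lmod_hom A ?K ?W"
      using B(6) Qf by (intro hom_restrict_cod hom_restrict_dom[OF biprod_inl[OF b]])
        (auto simp: a_kernel_def')
    have vk: "v s \<in> a_kernel Q Y q" if "s \<in> a_kernel S E t" for s
      using that gt[of s] uv[of s] hom_zero[OF X(5,2,3)] by (auto simp: a_kernel_def')
    then show "v \<in> lmod_hom A ?W ?Y"
      by (intro hom_restrict_cod hom_restrict_dom[OF B(5)]) (auto simp: a_kernel_subset)
    show "inj_on (\<lambda>x. c x \<zero>\<^bsub>Q\<^esub>) (carrier ?K)"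
      by (rule inj_on_inverseI[of _ u]) (use B Qf in \<open>auto simp: a_kernel_def'\<close>)
    show "v ` carrier ?W = carrier ?Y"
    proof
      show "v ` carrier ?W \<subseteq> carrier ?Y" using vk by auto
      show "carrier ?Y \<subseteq> v ` carrier ?W"
      proof
        fix y assume "y \<in> carrier ?Y"
        then have y: "y \<in> carrier Q" "q y = \<zero>\<^bsub>Y\<^esub>"
          by (auto simp: a_kernel_def')
        then obtain x where x: "x \<in> carrier P" "q' y = i (p x)"
          using lift[of "q' y"] q'(2) cl2 by auto
        have nx: "\<ominus>\<^bsub>P\<^esub> x \<in> carrier P" using x Pf by simp
        have "i (p (\<ominus>\<^bsub>P\<^esub> x)) = \<ominus>\<^bsub>E\<^esub> i (p x)"
          using x cl by (simp add: hom_neg[OF P(2) Pf X(1)] hom_neg[OF X(4,1,2)])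
        then have "t (c (\<ominus>\<^bsub>P\<^esub> x) y) = \<zero>\<^bsub>E\<^esub>"
          using tc[OF nx y(1)] x cl X(2) by simp
        then show "y \<in> v ` carrier ?W"
          using B(6)[OF nx y(1)] B(8)[OF nx y(1)]
          by (auto simp: a_kernel_def' image_iff intro!: bexI[of _ "c (\<ominus>\<^bsub>P\<^esub> x) y"])
      qed
    qed
    show "v (c x \<zero>\<^bsub>Q\<^esub>) = \<zero>\<^bsub>?Y\<^esub>"
      if "x \<in> carrier ?K" for x
      using that B(8) Qf by (auto simp: a_kernel_def')
    show "\<exists>x\<in>carrier ?K. s = c x \<zero>\<^bsub>Q\<^esub>"
      if "s \<in> carrier ?W" "v s = \<zero>\<^bsub>?Y\<^esub>" for s
    proof -
      have s: "s \<in> carrier S" "t s = \<zero>\<^bsub>E\<^esub>" "v s = \<zero>\<^bsub>Q\<^esub>" using that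
        by (auto simp: a_kernel_def')
      have us: "u s \<in> carrier P" using uv s by auto
      have "i (p (u s)) = \<zero>\<^bsub>E\<^esub>"
        using s us cl X(2) hom_zero[OF q'(1) Qf X(2)] by (simp add: t_def)
      then have "p (u s) = \<zero>\<^bsub>K\<^esub>" using hom_inj_iff[OF X(4,1,2)] X(6) cl[OF us]
        by blast
      then show ?thesis using us B(9)[OF s(1)] s(3)
        by (auto simp: a_kernel_def' intro!: bexI[of _ "u s"])
    qed
  qed
  then have "pd_le A n ?W" using Suc.IH P(4) Q(4) by blast
  then show ?case using X(2) projective_biprod[OF b P(1) Q(1)] t surj by auto
qed

lemma pd_le_biprod: "biprod A S p q c M N \<Longrightarrow> pd_le A n M \<Longrightarrow> pd_le A n N \<Longrightarrow> pd_le A n S"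
  by (rule pd_le_extension[OF short_exact_biprod])

text \<open>By Schanuel's lemma the kernel of \<open>q\<close> is a direct summand of \<open>ker p \<oplus> Q\<close> for any surjection \<open>p\<close>
  from a projective module to \<open>M\<close>. The closure under summands for the same \<open>n\<close> is a hypothesis, because that closure is
  in turn proved by induction with the help of this lemma.\<close>

lemma schanuel_aux:
  assumes retr: "\<And>M N s r. retract A N M s r \<Longrightarrow> pd_le A n M \<Longrightarrow> pd_le A n N"
    and M: "pd_le A (Suc n) M"
    and Q: "projective A Q" "q \<in> lmod_hom A Q M" "q ` carrier Q = carrier M"
  shows "pd_le A n (Q\<lparr>carrier := a_kernel Q M q\<rparr>)"
proof -
  obtain P p where P: "projective A P" "p \<in> lmod_hom A P M" "p ` carrier P = carrier M"
    "pd_le A n (P\<lparr>carrier := a_kernel P M p\<rparr>)" using M by auto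
  have Mf: "M \<in> fgmod A" and Pf: "P \<in> fgmod A" and Qf: "Q \<in> fgmod A"
    using pd_le_fgmod[OF M] P Q projective_fgmod by auto
  let ?K = "P\<lparr>carrier := a_kernel P M p\<rparr>"
    and ?L = "Q\<lparr>carrier := a_kernel Q M q\<rparr>"
  have Kf: "?K \<in> fgmod A" and Lf: "?L \<in> fgmod A" using kernel_fgmod P(2) Q(2) Mf Pf Qf
    by auto
  obtain \<alpha> where \<alpha>: "\<alpha> \<in> lmod_hom A Q P" "\<And>x. x \<in> carrier Q \<Longrightarrow> p (\<alpha> x) = q x"
    using projectiveD[OF Q(1) P(2,3) Q(2) Pf Mf] by blast
  obtain \<beta> where \<beta>: "\<beta> \<in> lmod_hom A P Q" "\<And>x. x \<in> carrier P \<Longrightarrow> q (\<beta> x) = p x"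
    using projectiveD[OF P(1) Q(2,3) P(2) Qf Mf] by blast
  obtain S u v c where b: "biprod A S u v c ?K Q" using biprod_exists[OF Kf Qf] by blast
  note B = biprodD[OF b]
  have S: "pd_le A n S" by (rule pd_le_biprod[OF b P(4) pd_le_projective[OF Q(1)]])
  have \<alpha>': "\<alpha> \<in> lmod_hom A ?L ?K"
    using \<alpha> hom_closed[OF \<alpha>(1)]
    by (intro hom_restrict_cod hom_restrict_dom) (auto simp: a_kernel_def')
  have \<beta>': "\<beta> \<in> lmod_hom A ?K Q"
    by (rule hom_restrict_dom[OF \<beta>(1) a_kernel_subset])
  have s: "(\<lambda>z. c (\<alpha> z) z) \<in> lmod_hom A ?L S"
    by (rule biprod_hom[OF b \<alpha>' hom_incl[OF a_kernel_subset]])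
  define r where "r w = \<beta> (u w) \<oplus>\<^bsub>Q\<^esub> (v w \<oplus>\<^bsub>Q\<^esub> \<ominus>\<^bsub>Q\<^esub> \<beta> (\<alpha> (v w)))" for w
  have r0: "r \<in> lmod_hom A S Q" unfolding r_def
    by (rule hom_sum[OF hom_comp[OF B(4) \<beta>'] hom_diff_map[OF B(5)
      hom_comp[OF hom_comp[OF B(5) \<alpha>(1)] \<beta>(1)] Qf] Qf])
  have "q (r w) = \<zero>\<^bsub>M\<^esub>" if w: "w \<in> carrier S" for w
  proof -
    have 1: "u w \<in> carrier P" "p (u w) = \<zero>\<^bsub>M\<^esub>" "v w \<in> carrier Q"
      using hom_closed[OF B(4) w] hom_closed[OF B(5) w] by (auto simp: a_kernel_def')
    have 2: "\<alpha> (v w) \<in> carrier P" "\<beta> (\<alpha> (v w)) \<in> carrier Q" "\<beta> (u w) \<in> carrier Q"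
      using 1 hom_closed[OF \<alpha>(1)] hom_closed[OF \<beta>(1)] by auto
    show ?thesis unfolding r_def
      using 1 2 Qf Mf hom_closed[OF Q(2)] \<alpha>(2) \<beta>(2)
      by (simp add: hom_add[OF Q(2)] hom_neg[OF Q(2) Qf Mf])
  qed
  then have r: "r \<in> lmod_hom A S ?L"
    using hom_closed[OF r0] by (intro hom_restrict_cod[OF r0]) (auto simp: a_kernel_def')
  have "r (c (\<alpha> z) z) = z" if z: "z \<in> carrier ?L" for z
  proof -
    have "\<alpha> z \<in> carrier ?K" "z \<in> carrier Q" "\<alpha> z \<in> carrier P"
      using z hom_closed[OF \<alpha>' z] by (auto simp: a_kernel_def')
    then show ?thesis
      unfolding r_def using B(7,8) hom_closed[OF \<beta>(1)] Qf
      by (simp add: fgmod_lcomm[OF Qf, of "\<beta> (\<alpha> z)" z])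
  qed
  then have "retract A ?L S (\<lambda>z. c (\<alpha> z) z) r"
    unfolding retract_def using Lf B(1) s r by blast
  then show ?thesis using retr S by blast
qed

lemma pd_le_retract: "retract A N M s r \<Longrightarrow> pd_le A n M \<Longrightarrow> pd_le A n N"
proof (induction n arbitrary: M N s r)
  case 0 then show ?case using projective_retract by auto
next
  case (Suc n)
  note R = retractD[OF Suc.prems(1)]
  let ?N = "M\<lparr>carrier := a_kernel M N r\<rparr>"
  have Nf: "?N \<in> fgmod A" using kernel_fgmod R by blast
  obtain Q q where Q: "projective A Q" "q \<in> lmod_hom A Q N" "q ` carrier Q = carrier N"
    using enough_projectives[OF R(1)] by blast
  obtain Q' q' where Q': "projective A Q'" "q' \<in> lmod_hom A Q' ?N" "q' ` carrier Q' = carrier ?N"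
    using enough_projectives[OF Nf] by blast
  have Qf: "Q \<in> fgmod A" "Q' \<in> fgmod A" using Q Q' projective_fgmod by auto
  have q'M: "q' \<in> lmod_hom A Q' M" by (rule hom_unrestrict_cod[OF Q'(2) a_kernel_subset])
  have q'0: "r (q' y) = \<zero>\<^bsub>N\<^esub>" if "y \<in> carrier Q'" for y
    using hom_closed[OF Q'(2) that] by (simp add: a_kernel_def')
  obtain S u v c where b: "biprod A S u v c Q Q'" using biprod_exists[OF Qf] by blast
  note B = biprodD[OF b]
  define t where "t w = s (q (u w)) \<oplus>\<^bsub>M\<^esub> q' (v w)" for w
  have t: "t \<in> lmod_hom A S M" unfolding t_def
    by (rule hom_sum[OF hom_comp[OF hom_comp[OF B(4) Q(2)] R(3)] hom_comp[OF B(5) q'M] R(2)])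
  have cl: "q x \<in> carrier N" "s (q x) \<in> carrier M" if "x \<in> carrier Q" for x
    using that hom_closed[OF Q(2)] hom_closed[OF R(3)] by auto
  have uv: "u w \<in> carrier Q" "v w \<in> carrier Q'" if "w \<in> carrier S" for w
    using that hom_closed[OF B(4)] hom_closed[OF B(5)] by auto
  have surj: "t ` carrier S = carrier M"
  proof
    show "t ` carrier S \<subseteq> carrier M" using hom_closed[OF t] by auto
    show "carrier M \<subseteq> t ` carrier S"
    proof
      fix m assume m: "m \<in> carrier M"
      have rm: "r m \<in> carrier N" "s (r m) \<in> carrier M" using m hom_closed[OF R(4)] hom_closed[OF R(3)]
        by auto
      then have "r m \<in> q ` carrier Q" using Q(3) by simp
      then obtain x where x: "x \<in> carrier Q" "r m = q x" by blast
      have "r (m \<oplus>\<^bsub>M\<^esub> \<ominus>\<^bsub>M\<^esub> s (r m)) = \<zero>\<^bsub>N\<^esub>"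
        using m rm R by (simp add: hom_diff[OF R(4,2,1)])
      then have "m \<oplus>\<^bsub>M\<^esub> \<ominus>\<^bsub>M\<^esub> s (r m) \<in> q' ` carrier Q'"
        unfolding Q'(3) using m rm R(2) by (simp add: a_kernel_def')
      then obtain y where y: "y \<in> carrier Q'" "m \<oplus>\<^bsub>M\<^esub> \<ominus>\<^bsub>M\<^esub> s (r m) = q' y"
        by blast
      have "t (c x y) = s (r m) \<oplus>\<^bsub>M\<^esub> (m \<oplus>\<^bsub>M\<^esub> \<ominus>\<^bsub>M\<^esub> s (r m))"
        using B(7,8) x y by (simp add: t_def)
      also have "\<dots> = m" using m rm R(2) by (simp add: fgmod_lcomm[OF R(2), of "s (r m)" m])
      finally show "m \<in> t ` carrier S" using B(6)[OF x(1) y(1)] by force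
    qed
  qed
  let ?T = "S\<lparr>carrier := a_kernel S M t\<rparr>"
    and ?L = "Q\<lparr>carrier := a_kernel Q N q\<rparr>"
  have T: "pd_le A n ?T"
    by (rule schanuel_aux[OF Suc.IH Suc.prems(2) projective_biprod[OF b Q(1) Q'(1)] t surj])
  have "retract A ?L ?T (\<lambda>x. c x \<zero>\<^bsub>Q'\<^esub>) u"
    unfolding retract_def
  proof (intro conjI ballI)
    show "?L \<in> fgmod A" "?T \<in> fgmod A" using kernel_fgmod Q(2) t Qf R B(1) by auto
    have "t (c x \<zero>\<^bsub>Q'\<^esub>) = \<zero>\<^bsub>M\<^esub>"
      if "x \<in> carrier Q" "q x = \<zero>\<^bsub>N\<^esub>" for x
      using that B(7,8) Qf R(2) hom_zero[OF R(3,1,2)] hom_zero[OF q'M Qf(2) R(2)]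
      by (simp add: t_def)
    then show "(\<lambda>x. c x \<zero>\<^bsub>Q'\<^esub>) \<in> lmod_hom A ?L ?T"
      using B(6) Qf by (intro hom_restrict_cod hom_restrict_dom[OF biprod_inl[OF b]])
        (auto simp: a_kernel_def')
    have "q (u w) = \<zero>\<^bsub>N\<^esub>"
      if w: "w \<in> carrier S" "t w = \<zero>\<^bsub>M\<^esub>" for w
    proof -
      have "r (t w) = q (u w)"
        using uv[OF w(1)] cl hom_closed[OF q'M] q'0 R by (simp add: t_def hom_add[OF R(4)])
      then show ?thesis using w hom_zero[OF R(4,2,1)] by simp
    qed
    then show "u \<in> lmod_hom A ?T ?L"
      using uv by (intro hom_restrict_cod hom_restrict_dom[OF B(4)]) (auto simp: a_kernel_def')
    show "u (c x \<zero>\<^bsub>Q'\<^esub>) = x" if "x \<in> carrier ?L" for x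
      using that B(7) Qf by (auto simp: a_kernel_def')
  qed
  then have "pd_le A n ?L" using Suc.IH T by blast
  then show ?case using R(1) Q by auto
qed

lemma schanuel:
  assumes "pd_le A (Suc n) M" "projective A Q" "q \<in> lmod_hom A Q M" "q ` carrier Q = carrier M"
  shows "pd_le A n (Q\<lparr>carrier := a_kernel Q M q\<rparr>)"
  by (rule schanuel_aux[OF pd_le_retract assms])

lemma short_exact_kernels:
  assumes X: "short_exact A K i W g I" and p: "p \<in> lmod_hom A P W" "p ` carrier P = carrier W"
    and P: "P \<in> fgmod A"
  shows "\<exists>f. short_exact A (P\<lparr>carrier := a_kernel P W p\<rparr>) (\<lambda>x. x) (P\<lparr>carrier := a_kernel P I (\<lambda>x. g (p x))\<rparr>) f K"
proof -
  note X = short_exactD[OF X]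
  let ?W = "P\<lparr>carrier := a_kernel P W p\<rparr>"
    and ?V = "P\<lparr>carrier := a_kernel P I (\<lambda>x. g (p x))\<rparr>"
  have gp: "(\<lambda>x. g (p x)) \<in> lmod_hom A P I" by (rule hom_comp[OF p(1) X(5)])
  have f: "?W \<in> fgmod A" "?V \<in> fgmod A" using kernel_fgmod[OF p(1) P X(2)] kernel_fgmod[OF gp P X(3)]
    by auto
  have pV: "p \<in> lmod_hom A ?V W" by (rule hom_restrict_dom[OF p(1) a_kernel_subset])
  have "p x \<in> i ` carrier K" if "x \<in> carrier ?V" for x
    using that X(9)[of "p x"] hom_closed[OF p(1)] by (auto simp: a_kernel_def')
  then obtain f where F: "f \<in> lmod_hom A ?V K" "\<And>x. x \<in> carrier ?V \<Longrightarrow> i (f x) = p x"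
    using factor_inj[OF X(4,6) pV X(1)] by blast
  have sub: "a_kernel P W p \<subseteq> a_kernel P I (\<lambda>x. g (p x))"
    using hom_zero[OF X(5,2,3)] by (auto simp: a_kernel_def')
  have inj: "\<And>x. x \<in> carrier K \<Longrightarrow> i x = \<zero>\<^bsub>W\<^esub> \<Longrightarrow> x = \<zero>\<^bsub>K\<^esub>"
    using hom_inj_iff[OF X(4,1,2)] X(6) by blast
  have "short_exact A ?W (\<lambda>x. x) ?V f K"
    unfolding short_exact_def
  proof (intro conjI ballI impI)
    show "(\<lambda>x. x) \<in> lmod_hom A ?W ?V"
      using sub by (intro hom_restrict_cod hom_incl) (auto simp: a_kernel_subset)
    show "f ` carrier ?V = carrier K"
    proof
      show "f ` carrier ?V \<subseteq> carrier K" using hom_closed[OF F(1)] by auto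
      show "carrier K \<subseteq> f ` carrier ?V"
      proof
        fix k assume k: "k \<in> carrier K"
        then have "i k \<in> p ` carrier P" using p(2) hom_closed[OF X(4)] by simp
        then obtain x where x: "x \<in> carrier P" "i k = p x" by blast
        then have xV: "x \<in> carrier ?V" using X(8)[OF k] by (auto simp: a_kernel_def')
        then have "f x = k" using inj_onD[OF X(6), of "f x" k] F(2) hom_closed[OF F(1)] k x by auto
        then show "k \<in> f ` carrier ?V" using xV by blast
      qed
    qed
    show "f x = \<zero>\<^bsub>K\<^esub>" if "x \<in> carrier ?W" for x
    proof -
      have "x \<in> carrier ?V" using sub that by auto
      then show ?thesis using inj[of "f x"] F(2)[of x] hom_closed[OF F(1)] that
        by (auto simp: a_kernel_def')
    qed
    show "\<exists>y\<in>carrier ?W. x = y"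
      if "x \<in> carrier ?V" "f x = \<zero>\<^bsub>K\<^esub>" for x
      using F(2)[OF that(1)] that hom_zero[OF X(4,1,2)] by (auto simp: a_kernel_def')
  qed (use f X F in auto)
  then show ?thesis by blast
qed

lemma pd_le_quotient:
  assumes X: "short_exact A K i W g I" and K: "pd_le A n K" and W: "pd_le A (Suc n) W"
  shows "pd_le A (Suc n) I"
proof -
  obtain P p where P: "projective A P" "p \<in> lmod_hom A P W" "p ` carrier P = carrier W"
    "pd_le A n (P\<lparr>carrier := a_kernel P W p\<rparr>)" using W by auto
  obtain f where f: "short_exact A (P\<lparr>carrier := a_kernel P W p\<rparr>) (\<lambda>x. x)
      (P\<lparr>carrier := a_kernel P I (\<lambda>x. g (p x))\<rparr>) f K"
    using short_exact_kernels[OF X P(2,3) projective_fgmod[OF P(1)]] by blast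
  note X = short_exactD[OF X]
  have "(\<lambda>x. g (p x)) ` carrier P = carrier I" using P(3) X(7) by (metis image_image)
  then show ?thesis using pd_le_extension[OF f P(4) K] P(1) hom_comp[OF P(2) X(5)] X(3) by auto
qed

text \<open>In a ring of global dimension at most \<open>n + 1\<close>, submodules of modules of projective dimension at most
  \<open>n\<close> have projective dimension at most \<open>n\<close>.\<close>

lemma pd_le_submodule:
  assumes X: "short_exact A I i Y g C" and Y: "pd_le A n Y" and C: "pd_le A (Suc n) C"
  shows "pd_le A n I"
proof (cases n)
  case 0
  note S = short_exactD[OF X]
  let ?K = "Y\<lparr>carrier := a_kernel Y C g\<rparr>"
  have K: "pd_le A 0 ?K" using schanuel[OF C[unfolded 0] _ S(5,7)] Y 0 by simp
  have im: "i ` carrier I = a_kernel Y C g"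
    using S(8) S(9) hom_closed[OF S(4)] by (auto simp: a_kernel_def')
  have "i \<in> lmod_hom A I ?K" by (rule hom_restrict_cod[OF S(4)]) (use im in simp)
  moreover have "bij_betw i (carrier I) (carrier ?K)" using S(6) im by (simp add: bij_betw_def)
  ultimately obtain h where "retract A I ?K i h"
    using retract_iso[of i A I ?K] S(1) pd_le_fgmod[OF K] by auto
  then show ?thesis using pd_le_retract K 0 by blast
next
  case (Suc k)
  obtain P p where P: "projective A P" "p \<in> lmod_hom A P Y" "p ` carrier P = carrier Y"
    "pd_le A k (P\<lparr>carrier := a_kernel P Y p\<rparr>)" using Y Suc by auto
  obtain f where f: "short_exact A (P\<lparr>carrier := a_kernel P Y p\<rparr>) (\<lambda>x. x)
      (P\<lparr>carrier := a_kernel P C (\<lambda>x. g (p x))\<rparr>) f I"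
    using short_exact_kernels[OF X P(2,3) projective_fgmod[OF P(1)]] by blast
  note X = short_exactD[OF X]
  have "(\<lambda>x. g (p x)) ` carrier P = carrier C" using P(3) X(7) by (metis image_image)
  then have "pd_le A n (P\<lparr>carrier := a_kernel P C (\<lambda>x. g (p x))\<rparr>)"
    using schanuel[OF C P(1) hom_comp[OF P(2) X(5)]] by blast
  then show ?thesis using pd_le_quotient[OF f P(4)] Suc by simp
qed

lemma resolution_imp_pd_le:
  "M \<in> fgmod A \<Longrightarrow> projective_resolution A M n C d \<Longrightarrow> pd_le A n M"
proof (induction n arbitrary: M C d)
  case 0
  then have h: "C 0 = M" "projective A (C (Suc 0))" "d 0 \<in> lmod_hom A (C (Suc 0)) (C 0)"
    "d 0 ` carrier (C (Suc 0)) = carrier (C 0)" "inj_on (d 0) (carrier (C (Suc 0)))"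
    unfolding projective_resolution_def by auto
  have "bij_betw (d 0) (carrier (C (Suc 0))) (carrier M)" using h by (simp add: bij_betw_def)
  then obtain g where "retract A M (C (Suc 0)) g (d 0)"
    using retract_iso[of "d 0" A "C (Suc 0)" M] h 0 projective_fgmod by blast
  then show ?case using projective_retract h by auto
next
  case (Suc n)
  note r = Suc.prems(2)[unfolded projective_resolution_def]
  have C0: "C 0 = M"
    and pr: "\<And>i. i \<le> Suc n \<Longrightarrow> projective A (C (Suc i)) \<and> d i \<in> lmod_hom A (C (Suc i)) (C i)"
    and su: "d 0 ` carrier (C (Suc 0)) = carrier (C 0)"
    and ex: "\<And>i. i < Suc n \<Longrightarrow> d (Suc i) ` carrier (C (Suc (Suc i))) = a_kernel (C (Suc i)) (C i) (d i)"
    and inj: "inj_on (d (Suc n)) (carrier (C (Suc (Suc n))))"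
    using r by auto
  let ?N = "(C (Suc 0))\<lparr>carrier := a_kernel (C (Suc 0)) (C 0) (d 0)\<rparr>"
  define C' where "C' = case_nat ?N (\<lambda>i. C (Suc (Suc i)))"
  have C': "C' 0 = ?N" "\<And>i. C' (Suc i) = C (Suc (Suc i))" by (auto simp: C'_def)
  have p1: "projective A (C (Suc 0))" "d 0 \<in> lmod_hom A (C (Suc 0)) (C 0)" using pr[of 0]
    by auto
  have Nf: "?N \<in> fgmod A" using kernel_fgmod[OF p1(2) projective_fgmod[OF p1(1)]] C0 Suc.prems
    by simp
  have ker: "a_kernel (C (Suc (Suc i))) (C' i) (d (Suc i)) = a_kernel (C (Suc (Suc i))) (C (Suc i)) (d (Suc i))" for i
    by (cases i) (auto simp: C' a_kernel_def')
  have "projective_resolution A ?N n C' (\<lambda>i. d (Suc i))"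
    unfolding projective_resolution_def
  proof (intro conjI allI impI)
    show "projective A (C' (Suc i))" if "i \<le> n" for i using pr[of "Suc i"] that
      by (simp add: C')
    show "d (Suc i) \<in> lmod_hom A (C' (Suc i)) (C' i)" if "i \<le> n" for i
    proof (cases i)
      case 0
      have "d (Suc 0) ` carrier (C (Suc (Suc 0))) \<subseteq> a_kernel (C (Suc 0)) (C 0) (d 0)" using ex[of 0]
        by simp
      then show ?thesis using pr[of 1] unfolding 0 C' by (intro hom_restrict_cod) auto
    next
      case (Suc j) then show ?thesis using pr[of "Suc i"] that by (simp add: C')
    qed
    show "d (Suc 0) ` carrier (C' 1) = carrier (C' 0)" using ex[of 0] by (simp add: C')
    show "d (Suc (Suc i)) ` carrier (C' (Suc (Suc i))) = a_kernel (C' (Suc i)) (C' i) (d (Suc i))"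
      if "i < n" for i using ex[of "Suc i"] that by (simp add: C' ker)
    show "inj_on (d (Suc n)) (carrier (C' (Suc n)))" using inj by (simp add: C')
  qed (simp add: C')
  then have "pd_le A n ?N" using Suc.IH[OF Nf] by blast
  then show ?case using Suc.prems(1) p1 su C0 by auto
qed

lemma pd_le_imp_resolution:
  "pd_le A n M \<Longrightarrow> \<exists>C d. projective_resolution A M n C d"
proof (induction n arbitrary: M)
  case 0
  then have M: "M \<in> fgmod A" by (rule pd_le_fgmod)
  have "projective_resolution A M 0 (\<lambda>i. M) (\<lambda>i x. x)"
    unfolding projective_resolution_def using 0 hom_id by auto
  then show ?case by blast
next
  case (Suc n)
  obtain P p where P: "projective A P" "p \<in> lmod_hom A P M" "p ` carrier P = carrier M"
    "pd_le A n (P\<lparr>carrier := a_kernel P M p\<rparr>)" using Suc.prems by auto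
  let ?N = "P\<lparr>carrier := a_kernel P M p\<rparr>"
  obtain C d where r: "projective_resolution A ?N n C d" using Suc.IH[OF P(4)] by blast
  have C0: "C 0 = ?N"
    and pr: "\<And>i. i \<le> n \<Longrightarrow> projective A (C (Suc i)) \<and> d i \<in> lmod_hom A (C (Suc i)) (C i)"
    and su: "d 0 ` carrier (C (Suc 0)) = carrier (C 0)"
    and ex: "\<And>i. i < n \<Longrightarrow> d (Suc i) ` carrier (C (Suc (Suc i))) = a_kernel (C (Suc i)) (C i) (d i)"
    and inj: "inj_on (d n) (carrier (C (Suc n)))"
    using r unfolding projective_resolution_def by auto
  define C' where "C' = case_nat M (case_nat P (\<lambda>i. C (Suc i)))"
  define d' where "d' = case_nat p d"
  have C': "C' 0 = M" "C' (Suc 0) = P" "\<And>i. C' (Suc (Suc i)) = C (Suc i)"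
    by (auto simp: C'_def)
  have d': "d' 0 = p" "\<And>i. d' (Suc i) = d i" by (auto simp: d'_def)
  have ker: "a_kernel (C (Suc i)) (C' (Suc i)) (d i) = a_kernel (C (Suc i)) (C i) (d i)" for i
    by (cases i) (auto simp: C' C0 a_kernel_def')
  have "projective_resolution A M (Suc n) C' d'"
    unfolding projective_resolution_def
  proof (intro conjI allI impI)
    show "projective A (C' (Suc i))" if "i \<le> Suc n" for i
      using that P(1) pr by (cases i) (auto simp: C')
    show "d' i \<in> lmod_hom A (C' (Suc i)) (C' i)" if "i \<le> Suc n" for i
    proof (cases i)
      case 0 then show ?thesis using P by (simp add: C' d')
    next
      case (Suc j)
      have dj: "d j \<in> lmod_hom A (C (Suc j)) (C j)" using pr Suc that by simp
      show ?thesis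
      proof (cases j)
        case 0
        have "d 0 \<in> lmod_hom A (C (Suc 0)) P"
          by (rule hom_unrestrict_cod[OF _ a_kernel_subset]) (use dj 0 C0 in simp)
        then show ?thesis using Suc 0 by (simp add: C' d')
      next
        case (Suc l) then show ?thesis using \<open>i = Suc j\<close> dj by (simp add: C' d')
      qed
    qed
    show "d' 0 ` carrier (C' 1) = carrier (C' 0)" using P by (simp add: C' d')
    show "d' (Suc i) ` carrier (C' (Suc (Suc i))) = a_kernel (C' (Suc i)) (C' i) (d' i)"
      if "i < Suc n" for i
      using that su ex by (cases i) (auto simp: C' d' C0 ker)
    show "inj_on (d' (Suc n)) (carrier (C' (Suc (Suc n))))" using inj by (simp add: C' d')
  qed (simp add: C')
  then show ?case by blast
qed

lemma proj_dim_le_iff: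
  assumes M: "M \<in> fgmod A"
  shows "proj_dim A M \<le> enat n \<longleftrightarrow> pd_le A n M"
proof
  let ?X = "{enat n |n. \<exists>C d. projective_resolution A M n C d}"
  assume le: "proj_dim A M \<le> enat n"
  have "?X \<noteq> {}"
  proof
    assume e: "?X = {}"
    have "proj_dim A M = \<infinity>" unfolding proj_dim_def e by (simp add: top_enat_def)
    then show False using le by simp
  qed
  then obtain x where "x \<in> ?X" by auto
  then have "proj_dim A M \<in> ?X" unfolding proj_dim_def by (rule wellorder_InfI)
  then obtain k where k: "proj_dim A M = enat k" "\<exists>C d. projective_resolution A M k C d"
    by blast
  then have "pd_le A k M" using resolution_imp_pd_le[OF M] by blast
  then show "pd_le A n M" using pd_le_mono[of k n] le k(1) by simp
next
  assume "pd_le A n M"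
  then show "proj_dim A M \<le> enat n"
    unfolding proj_dim_def using pd_le_imp_resolution by (intro Inf_lower) blast
qed

end

section \<open>Injective dimension at most one\<close>

text \<open>Injective dimension at most one, as the existence of a short injective resolution.\<close>

definition id_le_one :: "('a, 'z) ring_scheme \<Rightarrow> 'a lmod \<Rightarrow> bool" where
  "id_le_one A M \<longleftrightarrow> (\<exists>i J0 g J1. injective A J0 \<and> injective A J1 \<and> short_exact A M i J0 g J1)"

lemma id_le_one_biprod:
  assumes b: "biprod A S p q c M N" and M: "id_le_one A M" and N: "id_le_one A N"
  shows "id_le_one A S"
proof -
  note B = biprodD[OF b]
  obtain i J0 g J1 where iM: "injective A J0" "injective A J1" and sM: "short_exact A M i J0 g J1"
    using M unfolding id_le_one_def by blast
  obtain e L0 l L1 where iN: "injective A L0" "injective A L1" and sN: "short_exact A N e L0 l L1"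
    using N unfolding id_le_one_def by blast
  note X = short_exactD[OF sM] and Y = short_exactD[OF sN]
  obtain T u v d where t: "biprod A T u v d J0 L0" using biprod_exists[OF X(2) Y(2)] by blast
  obtain T' u' v' d' where t': "biprod A T' u' v' d' J1 L1" using biprod_exists[OF X(3) Y(3)]
    by blast
  note T = biprodD[OF t] and T' = biprodD[OF t']
  let ?f = "\<lambda>s. d (i (p s)) (e (q s))" and ?h = "\<lambda>s. d' (g (u s)) (l (v s))"
  have f: "?f \<in> lmod_hom A S T"
    by (rule biprod_hom[OF t hom_comp[OF B(4) X(4)] hom_comp[OF B(5) Y(4)]])
  have h: "?h \<in> lmod_hom A T T'"
    by (rule biprod_hom[OF t' hom_comp[OF T(4) X(5)] hom_comp[OF T(5) Y(5)]])
  have pq: "p s \<in> carrier M" "q s \<in> carrier N" "i (p s) \<in> carrier J0" "e (q s) \<in> carrier L0"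
    if "s \<in> carrier S" for s
    using that hom_closed[OF B(4)] hom_closed[OF B(5)] hom_closed[OF X(4)] hom_closed[OF Y(4)]
    by auto
  have uv: "u s \<in> carrier J0" "v s \<in> carrier L0" "g (u s) \<in> carrier J1" "l (v s) \<in> carrier L1"
    if "s \<in> carrier T" for s
    using that hom_closed[OF T(4)] hom_closed[OF T(5)] hom_closed[OF X(5)] hom_closed[OF Y(5)]
    by auto
  have "short_exact A S ?f T ?h T'"
    unfolding short_exact_def
  proof (intro conjI ballI impI)
    show "S \<in> fgmod A" "T \<in> fgmod A" "T' \<in> fgmod A" using B T T' by auto
    show "?f \<in> lmod_hom A S T" "?h \<in> lmod_hom A T T'" using f h .
    show "inj_on ?f (carrier S)"
    proof (rule inj_onI)
      fix s s' assume s: "s \<in> carrier S" "s' \<in> carrier S" "?f s = ?f s'"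
      have "u (?f s) = u (?f s')" "v (?f s) = v (?f s')" using s(3) by auto
      then have "i (p s) = i (p s')" "e (q s) = e (q s')" using s(1,2) pq T(7,8) by auto
      then have "p s = p s'" "q s = q s'"
        using pq(1,2)[OF s(1)] pq(1,2)[OF s(2)] inj_onD[OF X(6), of "p s" "p s'"] inj_onD[OF Y(6), of "q s" "q s'"]
        by blast+
      then show "s = s'" using biprod_eqI[OF b] s by blast
    qed
    show "?h ` carrier T = carrier T'"
    proof
      show "?h ` carrier T \<subseteq> carrier T'" using hom_closed[OF h] by auto
      show "carrier T' \<subseteq> ?h ` carrier T"
      proof
        fix w assume w: "w \<in> carrier T'"
        have "u' w \<in> g ` carrier J0" "v' w \<in> l ` carrier L0"
          using w hom_closed[OF T'(4)] hom_closed[OF T'(5)] X(7) Y(7) by auto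
        then obtain x y where xy: "x \<in> carrier J0" "y \<in> carrier L0" "u' w = g x" "v' w = l y"
          by blast
        have "w = ?h (d x y)" using T'(9)[OF w] T(7,8) xy by simp
        then show "w \<in> ?h ` carrier T" using T(6) xy by blast
      qed
    qed
    show "?h (?f s) = \<zero>\<^bsub>T'\<^esub>" if "s \<in> carrier S" for s
      using pq[OF that] T(7,8) X(8) Y(8) biprod_zero[OF t'] by simp
    show "\<exists>s\<in>carrier S. w = ?f s"
      if w: "w \<in> carrier T" "?h w = \<zero>\<^bsub>T'\<^esub>" for w
    proof -
      have "u' (?h w) = \<zero>\<^bsub>J1\<^esub>" "v' (?h w) = \<zero>\<^bsub>L1\<^esub>"
        using w(2) hom_zero[OF T'(4) T'(1,2)] hom_zero[OF T'(5) T'(1,3)] by auto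
      then have "g (u w) = \<zero>\<^bsub>J1\<^esub>" "l (v w) = \<zero>\<^bsub>L1\<^esub>"
        using uv[OF w(1)] T'(7,8) by auto
      then obtain x y where xy: "x \<in> carrier M" "y \<in> carrier N" "u w = i x" "v w = e y"
        using X(9) Y(9) uv[OF w(1)] by metis
      have "w = ?f (c x y)" using T(9)[OF w(1)] B(7,8) xy by simp
      then show ?thesis using B(6) xy by blast
    qed
  qed
  then show ?thesis unfolding id_le_one_def
    using injective_biprod[OF t iM(1) iN(1)] injective_biprod[OF t' iM(2) iN(2)] by blast
qed

text \<open>If \<open>0 \<rightarrow> M \<rightarrow> J0 \<rightarrow> J1 \<rightarrow> 0\<close> is an injective resolution and \<open>N\<close> is a summand of \<open>M\<close>, then \<open>J0/N\<close> is a summand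
  of \<open>J0 \<oplus> J1\<close>. Hence it is injective.\<close>

lemma id_le_one_retract:
  assumes M: "id_le_one A M" and R: "retract A N M s r"
  shows "id_le_one A N"
proof -
  note R = retractD[OF R]
  obtain i J0 g J1 where I: "injective A J0" "injective A J1" and sM: "short_exact A M i J0 g J1"
    using M unfolding id_le_one_def by blast
  note X = short_exactD[OF sM]
  have emb: "(\<lambda>x. i (s x)) \<in> lmod_hom A N J0" by (rule hom_comp[OF R(3) X(4)])
  define U where "U = (\<lambda>x. i (s x)) ` carrier N"
  have U: "submodule U A J0" unfolding U_def
    by (rule submodule_image[OF emb R(1) X(2) submodule_carrier[OF R(1)]])
  obtain Q q where Q: "Q \<in> fgmod A" "q \<in> lmod_hom A J0 Q" "q ` carrier J0 = carrier Q"
    "\<And>x. x \<in> carrier J0 \<Longrightarrow> q x = \<zero>\<^bsub>Q\<^esub> \<longleftrightarrow> x \<in> U"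
    using quotient_exists[OF X(2) U] by blast
  note Q4 = Q(4)[unfolded U_def]
  \<comment> \<open>\<open>e0\<close> extends the idempotent \<open>s \<circ> r\<close> of \<open>M\<close> to \<open>J0\<close>\<close>
  obtain e0 where e0: "e0 \<in> lmod_hom A J0 J0" "\<And>x. x \<in> carrier M \<Longrightarrow> e0 (i x) = i (s (r x))"
    using injectiveD[OF I(1) X(4,6) hom_comp[OF hom_comp[OF R(4) R(3)] X(4)] X(1,2)] by blast
  have \<sigma>0: "(\<lambda>x. x \<oplus>\<^bsub>J0\<^esub> \<ominus>\<^bsub>J0\<^esub> e0 x) \<in> lmod_hom A J0 J0"
    by (rule hom_diff_map[OF hom_id e0(1) X(2)])
  have "x \<oplus>\<^bsub>J0\<^esub> \<ominus>\<^bsub>J0\<^esub> e0 x = \<zero>\<^bsub>J0\<^esub>"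
    if x: "x \<in> carrier J0" "q x = \<zero>\<^bsub>Q\<^esub>" for x
  proof -
    obtain n where n: "n \<in> carrier N" "x = i (s n)" using Q4[OF x(1)] x(2) by blast
    then have "e0 x = x" using e0(2) hom_closed[OF R(3)] R(5) by simp
    then show ?thesis using x(1) X(2) by simp
  qed
  then obtain \<sigma> where \<sigma>: "\<sigma> \<in> lmod_hom A Q J0"
    "\<And>x. x \<in> carrier J0 \<Longrightarrow> \<sigma> (q x) = x \<oplus>\<^bsub>J0\<^esub> \<ominus>\<^bsub>J0\<^esub> e0 x"
    using factor_surj[OF Q(2,3) \<sigma>0 X(2) Q(1) X(2)] by blast
  have "g x = \<zero>\<^bsub>J1\<^esub>"
    if x: "x \<in> carrier J0" "q x = \<zero>\<^bsub>Q\<^esub>" for x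
    using Q4[OF x(1)] x(2) X(8) hom_closed[OF R(3)] by auto
  then obtain g' where g': "g' \<in> lmod_hom A Q J1" "\<And>x. x \<in> carrier J0 \<Longrightarrow> g' (q x) = g x"
    using factor_surj[OF Q(2,3) X(5) X(2) Q(1) X(3)] by blast
  have "q (e0 x) = \<zero>\<^bsub>Q\<^esub>"
    if x: "x \<in> carrier J0" "g x = \<zero>\<^bsub>J1\<^esub>" for x
  proof -
    obtain m where m: "m \<in> carrier M" "x = i m" using X(9)[OF x] by blast
    then have "e0 x = i (s (r m))" "r m \<in> carrier N" using e0(2) hom_closed[OF R(4)] by auto
    then show ?thesis using Q4[of "e0 x"] hom_closed[OF e0(1) x(1)] by auto
  qed
  then obtain \<tau> where \<tau>: "\<tau> \<in> lmod_hom A J1 Q" "\<And>x. x \<in> carrier J0 \<Longrightarrow> \<tau> (g x) = q (e0 x)"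
    using factor_surj[OF X(5,7) hom_comp[OF e0(1) Q(2)] X(2,3) Q(1)] by blast
  obtain T u v d where t: "biprod A T u v d J0 J1" using biprod_exists[OF X(2,3)] by blast
  note T = biprodD[OF t]
  let ?s = "\<lambda>x. d (\<sigma> x) (g' x)"
    and ?r = "\<lambda>w. q (u w) \<oplus>\<^bsub>Q\<^esub> \<tau> (v w)"
  have "retract A Q T ?s ?r"
    unfolding retract_def
  proof (intro conjI ballI)
    show "?s \<in> lmod_hom A Q T" by (rule biprod_hom[OF t \<sigma>(1) g'(1)])
    show "?r \<in> lmod_hom A T Q"
      by (rule hom_sum[OF hom_comp[OF T(4) Q(2)] hom_comp[OF T(5) \<tau>(1)] Q(1)])
    show "?r (?s x) = x" if xQ: "x \<in> carrier Q" for x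
    proof -
      have "x \<in> q ` carrier J0" using Q(3) xQ by simp
      then obtain y where y: "y \<in> carrier J0" "x = q y" by blast
      have c: "e0 y \<in> carrier J0" "q y \<in> carrier Q" "q (e0 y) \<in> carrier Q" "g y \<in> carrier J1"
        using y hom_closed[OF e0(1)] hom_closed[OF Q(2)] hom_closed[OF X(5)] by auto
      have "?r (?s x) = (q y \<oplus>\<^bsub>Q\<^esub> \<ominus>\<^bsub>Q\<^esub> q (e0 y)) \<oplus>\<^bsub>Q\<^esub> q (e0 y)"
        using T(7,8) y c X(2) Q(1)
        by (simp add: \<sigma>(2) g'(2) \<tau>(2) hom_diff[OF Q(2) X(2) Q(1)])
      then show ?thesis using y c Q(1) by simp
    qed
  qed (use Q T in auto)
  then have "injective A Q" using injective_retract injective_biprod[OF t I] by blast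
  moreover have "short_exact A N (\<lambda>x. i (s x)) J0 q Q"
    unfolding short_exact_def
  proof (intro conjI ballI impI)
    show "inj_on (\<lambda>x. i (s x)) (carrier N)"
    proof (rule inj_onI)
      fix x y assume xy: "x \<in> carrier N" "y \<in> carrier N" "i (s x) = i (s y)"
      then have "s x = s y" using inj_onD[OF X(6)] hom_closed[OF R(3)] by blast
      then show "x = y" using R(5) xy by metis
    qed
    show "q (i (s x)) = \<zero>\<^bsub>Q\<^esub>" if "x \<in> carrier N" for x
      using Q4[of "i (s x)"] hom_closed[OF emb that] that by blast
    show "\<exists>x\<in>carrier N. e = i (s x)"
      if "e \<in> carrier J0" "q e = \<zero>\<^bsub>Q\<^esub>" for e
      using Q4[OF that(1)] that(2) by blast
  qed (use R X Q emb in auto)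
  ultimately show ?thesis unfolding id_le_one_def using I(1) by blast
qed

context finite_height_ring
begin

lemma id_le_one_injective: "injective A M \<Longrightarrow> id_le_one A M"
proof -
  assume I: "injective A M"
  have M: "M \<in> fgmod A" using I by (rule injective_fgmod)
  let ?Z = "M\<lparr>carrier := {\<zero>\<^bsub>M\<^esub>}\<rparr>"
  have Z: "?Z \<in> fgmod A" by (rule zero_fgmod[OF M])
  have "short_exact A M (\<lambda>x. x) M (\<lambda>x. \<zero>\<^bsub>M\<^esub>) ?Z"
    unfolding short_exact_def using M Z hom_id[of A M] hom_zero_map[OF Z, of M]
    by (auto simp: image_constant[OF fgmod_closed(2)[OF M]])
  moreover have "injective A ?Z" by (rule injective_zero[OF Z]) simp
  ultimately show ?thesis unfolding id_le_one_def using I by blast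
qed

lemma id_le_one_zero: "N \<in> fgmod A \<Longrightarrow> carrier N = {\<zero>\<^bsub>N\<^esub>} \<Longrightarrow> id_le_one A N"
  by (rule id_le_one_injective[OF injective_zero])

lemma inj_dim_le_1_iff:
  assumes M: "M \<in> fgmod A"
  shows "inj_dim A M \<le> 1 \<longleftrightarrow> id_le_one A M"
proof
  let ?X = "{enat n |n. \<exists>C d. injective_resolution A M n C d}"
  assume le: "inj_dim A M \<le> 1"
  have "?X \<noteq> {}"
  proof
    assume e: "?X = {}"
    have "inj_dim A M = \<infinity>" unfolding inj_dim_def e by (simp add: top_enat_def)
    then show False using le by simp
  qed
  then obtain x where "x \<in> ?X" by auto
  then have "inj_dim A M \<in> ?X" unfolding inj_dim_def by (rule wellorder_InfI)
  then obtain n C d where n: "inj_dim A M = enat n" and r: "injective_resolution A M n C d" by blast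
  note r = r[unfolded injective_resolution_def]
  have "n \<le> 1" using le n by (simp add: one_enat_def)
  then consider "n = 0" | "n = 1" by linarith
  then show "id_le_one A M"
  proof cases
    case 1
    then have h: "C 0 = M" "injective A (C (Suc 0))" "d 0 \<in> lmod_hom A (C 0) (C (Suc 0))"
      "inj_on (d 0) (carrier (C 0))" "d 0 ` carrier (C 0) = carrier (C (Suc 0))" using r by auto
    have "bij_betw (d 0) (carrier M) (carrier (C (Suc 0)))" using h by (simp add: bij_betw_def)
    then obtain g where "retract A M (C (Suc 0)) (d 0) g"
      using retract_iso[of "d 0" A M "C (Suc 0)"] h(1,3) M injective_fgmod[OF h(2)] by blast
    then have "injective A M" using injective_retract h by blast
    then show ?thesis by (rule id_le_one_injective)
  next
    case 2
    have a: "\<And>i. i \<le> n \<Longrightarrow> injective A (C (Suc i)) \<and> d i \<in> lmod_hom A (C i) (C (Suc i))"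
      and b: "\<And>i. i < n \<Longrightarrow> d i ` carrier (C i) = a_kernel (C (Suc i)) (C (Suc (Suc i))) (d (Suc i))"
      and c: "C 0 = M" "inj_on (d 0) (carrier (C 0))" "d n ` carrier (C n) = carrier (C (Suc n))"
      using r by auto
    have h: "injective A (C 1)" "injective A (C 2)" "d 0 \<in> lmod_hom A M (C 1)" "d 1 \<in> lmod_hom A (C 1) (C 2)"
      using a[of 0] a[of 1] c 2 by (simp_all add: numeral_2_eq_2)
    have e: "d 0 ` carrier M = a_kernel (C 1) (C 2) (d 1)" using b[of 0] 2 c
      by (simp add: numeral_2_eq_2)
    have c': "inj_on (d 0) (carrier M)" "d 1 ` carrier (C 1) = carrier (C 2)"
      using c 2 by (simp_all add: numeral_2_eq_2)
    have "d 1 (d 0 x) = \<zero>\<^bsub>C 2\<^esub>" if "x \<in> carrier M" for x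
    proof -
      have "d 0 x \<in> a_kernel (C 1) (C 2) (d 1)" using e that by blast
      then show ?thesis by (simp add: a_kernel_def')
    qed
    moreover have "\<exists>x\<in>carrier M. y = d 0 x"
      if "y \<in> carrier (C 1)" "d 1 y = \<zero>\<^bsub>C 2\<^esub>" for y
    proof -
      have "y \<in> d 0 ` carrier M" unfolding e using that by (simp add: a_kernel_def')
      then show ?thesis by blast
    qed
    ultimately have "short_exact A M (d 0) (C 1) (d 1) (C 2)"
      unfolding short_exact_def using M h c' injective_fgmod by blast
    then show ?thesis unfolding id_le_one_def using h by blast
  qed
next
  assume "id_le_one A M"
  then obtain i J0 g J1 where I: "injective A J0" "injective A J1"
    and s: "short_exact A M i J0 g J1"
    unfolding id_le_one_def by blast
  note X = short_exactD[OF s]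
  define C where "C = case_nat M (case_nat J0 (\<lambda>_::nat. J1))"
  define d where "d = case_nat i (\<lambda>_::nat. g)"
  have C: "C 0 = M" "C (Suc 0) = J0" "\<And>n. C (Suc (Suc n)) = J1" by (auto simp: C_def)
  have d: "d 0 = i" "\<And>n. d (Suc n) = g" by (auto simp: d_def)
  have ker: "i ` carrier M = a_kernel J0 J1 g"
  proof
    show "i ` carrier M \<subseteq> a_kernel J0 J1 g" using X(8) hom_closed[OF X(4)]
      by (auto simp: a_kernel_def')
    show "a_kernel J0 J1 g \<subseteq> i ` carrier M" using X(9) by (auto simp: a_kernel_def')
  qed
  have "injective A (C (Suc n)) \<and> d n \<in> lmod_hom A (C n) (C (Suc n))" if "n \<le> 1" for n
    using that I X by (cases n) (auto simp: C d)
  then have "injective_resolution A M 1 C d"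
    unfolding injective_resolution_def using X ker by (auto simp: C d)
  then have "enat 1 \<in> {enat n |n. \<exists>C d. injective_resolution A M n C d}" by blast
  then show "inj_dim A M \<le> 1" unfolding inj_dim_def one_enat_def by (rule Inf_lower)
qed

text \<open>Let \<open>J0 \<rightarrow> J1\<close> and \<open>L0 \<rightarrow> L1\<close> be injective resolutions of the kernel \<open>K\<close> and of \<open>E\<close>. The inclusion extends
  to maps \<open>u : J0 \<rightarrow> L0\<close> and \<open>v : J1 \<rightarrow> L1\<close>,
    and \<open>N = E/K\<close> is the homology of the complex
  \<open>J0 \<rightarrow> J1 \<oplus> L0 \<rightarrow> L1\<close> in the middle, which is exact elsewhere. The first map \<open>\<delta>\<close> splits, so \<open>N\<close> is
  resolved by a complement \<open>Q\<close> of \<open>J0\<close> in \<open>J1 \<oplus> L0\<close>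
    and by \<open>L1\<close>.\<close>

lemma id_le_one_quotient:
  assumes p: "p \<in> lmod_hom A E N" "p ` carrier E = carrier N" and N: "N \<in> fgmod A"
    and E: "id_le_one A E" and K: "id_le_one A (E\<lparr>carrier := a_kernel E N p\<rparr>)"
  shows "id_le_one A N"
proof -
  let ?K = "E\<lparr>carrier := a_kernel E N p\<rparr>"
  obtain i J0 \<pi> J1 where IJ: "injective A J0" "injective A J1"
    and sK: "short_exact A ?K i J0 \<pi> J1"
    using K unfolding id_le_one_def by blast
  obtain e L0 l L1 where IL: "injective A L0" "injective A L1" and sE: "short_exact A E e L0 l L1"
    using E unfolding id_le_one_def by blast
  note X = short_exactD[OF sK] and Y = short_exactD[OF sE]
  have eK: "e \<in> lmod_hom A ?K L0" by (rule hom_restrict_dom[OF Y(4) a_kernel_subset])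
  have KE: "k \<in> carrier E" "p k = \<zero>\<^bsub>N\<^esub>" if "k \<in> carrier ?K" for k using that
    by (auto simp: a_kernel_def')
  obtain u where u: "u \<in> lmod_hom A J0 L0" "\<And>x. x \<in> carrier ?K \<Longrightarrow> u (i x) = e x"
    using injectiveD[OF IL(1) X(4,6) eK X(1,2)] by blast
  have "l (u x) = \<zero>\<^bsub>L1\<^esub>"
    if x: "x \<in> carrier J0" "\<pi> x = \<zero>\<^bsub>J1\<^esub>" for x
    using X(9)[OF x] u(2) Y(8) KE by force
  then obtain v where v: "v \<in> lmod_hom A J1 L1" "\<And>x. x \<in> carrier J0 \<Longrightarrow> v (\<pi> x) = l (u x)"
    using factor_surj[OF X(5,7) hom_comp[OF u(1) Y(5)] X(2,3) Y(3)] by blast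
  obtain T a b c where t: "biprod A T a b c J1 L0" using biprod_exists[OF X(3) Y(2)] by blast
  note T = biprodD[OF t]
  define \<delta> where "\<delta> x = c (\<pi> x) (u x)" for x
  have \<delta>: "\<delta> \<in> lmod_hom A J0 T" unfolding \<delta>_def
    by (rule biprod_hom[OF t X(5) u(1)])
  have pu: "\<pi> x \<in> carrier J1" "u x \<in> carrier L0" if "x \<in> carrier J0" for x
    using that hom_closed[OF X(5)] hom_closed[OF u(1)] by auto
  have "inj_on \<delta> (carrier J0)"
    unfolding hom_inj_iff[OF \<delta> X(2) T(1)]
  proof (intro ballI impI)
    fix x assume x: "x \<in> carrier J0" "\<delta> x = \<zero>\<^bsub>T\<^esub>"
    have "a (\<delta> x) = \<zero>\<^bsub>J1\<^esub>" "b (\<delta> x) = \<zero>\<^bsub>L0\<^esub>"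
      using x(2) hom_zero[OF T(4) T(1,2)] hom_zero[OF T(5) T(1,3)] by auto
    then have z: "\<pi> x = \<zero>\<^bsub>J1\<^esub>" "u x = \<zero>\<^bsub>L0\<^esub>"
      using T(7,8) pu[OF x(1)] by (auto simp: \<delta>_def)
    then obtain k where k: "k \<in> carrier ?K" "x = i k" using X(9)[OF x(1)] by blast
    then have "e k = \<zero>\<^bsub>L0\<^esub>" using u(2) z by simp
    then have "k = \<zero>\<^bsub>E\<^esub>" using hom_inj_iff[OF Y(4,1,2)] Y(6) KE[OF k(1)]
      by blast
    then show "x = \<zero>\<^bsub>J0\<^esub>" using k hom_zero[OF X(4,1,2)] by simp
  qed
  then obtain \<rho> where \<rho>: "\<rho> \<in> lmod_hom A T J0" "\<And>x. x \<in> carrier J0 \<Longrightarrow> \<rho> (\<delta> x) = x"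
    using injectiveD[OF IJ(1) \<delta> _ hom_id X(2) T(1)] by blast
  let ?Q = "T\<lparr>carrier := a_kernel T J0 \<rho>\<rparr>"
  have Qf: "?Q \<in> fgmod A" by (rule kernel_fgmod[OF \<rho>(1) T(1) X(2)])
  \<comment> \<open>the projection onto the complement \<open>Q\<close> of the image of \<open>\<delta>\<close>\<close>
  define \<theta> where "\<theta> x = x \<oplus>\<^bsub>T\<^esub> \<ominus>\<^bsub>T\<^esub> \<delta> (\<rho> x)" for x
  have \<theta>0: "\<theta> \<in> lmod_hom A T T"
    unfolding \<theta>_def by (rule hom_diff_map[OF hom_id hom_comp[OF \<rho>(1) \<delta>] T(1)])
  have dr: "\<rho> x \<in> carrier J0" "\<delta> (\<rho> x) \<in> carrier T"
    if "x \<in> carrier T" for x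
    using that hom_closed[OF \<rho>(1)] hom_closed[OF \<delta>] by auto
  have "\<rho> (\<theta> x) = \<zero>\<^bsub>J0\<^esub>" if "x \<in> carrier T" for x
    using dr[OF that] that \<rho>(2) T(1) X(2)
    by (simp add: \<theta>_def hom_diff[OF \<rho>(1) T(1) X(2)])
  then have \<theta>: "\<theta> \<in> lmod_hom A T ?Q"
    using hom_closed[OF \<theta>0]
    by (intro hom_restrict_cod[OF \<theta>0]) (auto simp: a_kernel_def')
  have \<theta>Q: "\<theta> x = x" if "x \<in> carrier ?Q" for x
  proof -
    have "x \<in> carrier T" "\<rho> x = \<zero>\<^bsub>J0\<^esub>" using that
      by (auto simp: a_kernel_def')
    moreover have "\<ominus>\<^bsub>T\<^esub> \<zero>\<^bsub>T\<^esub> = \<zero>\<^bsub>T\<^esub>"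
      using fgmod_neg(1)[OF T(1), of "\<zero>\<^bsub>T\<^esub>"] T(1) by simp
    ultimately show ?thesis using hom_zero[OF \<delta> X(2) T(1)] T(1) by (simp add: \<theta>_def)
  qed
  have \<theta>\<delta>: "\<theta> (\<delta> x) = \<zero>\<^bsub>T\<^esub>"
    if "x \<in> carrier J0" for x
    using that \<rho>(2) hom_closed[OF \<delta>] T(1) by (simp add: \<theta>_def)
  have "retract A ?Q T (\<lambda>x. x) \<theta>"
    unfolding retract_def using Qf T(1) hom_incl[OF a_kernel_subset] \<theta> \<theta>Q by blast
  then have IQ: "injective A ?Q" by (rule injective_retract[OF injective_biprod[OF t IJ(2) IL(1)]])
  define w where "w x = v (a x) \<oplus>\<^bsub>L1\<^esub> \<ominus>\<^bsub>L1\<^esub> l (b x)" for x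
  have w: "w \<in> lmod_hom A T L1" unfolding w_def
    by (rule hom_diff_map[OF hom_comp[OF T(4) v(1)] hom_comp[OF T(5) Y(5)] Y(3)])
  have w\<delta>: "w (\<delta> x) = \<zero>\<^bsub>L1\<^esub>" if "x \<in> carrier J0" for x
    using pu[OF that] that T(7,8) v(2) Y(3) hom_closed[OF Y(5)] by (simp add: w_def \<delta>_def)
  have w\<theta>: "w (\<theta> x) = w x" if "x \<in> carrier T" for x
  proof -
    have "w (\<theta> x) = w x \<oplus>\<^bsub>L1\<^esub> \<ominus>\<^bsub>L1\<^esub> \<zero>\<^bsub>L1\<^esub>"
      unfolding \<theta>_def using that dr[OF that] w\<delta>
      by (simp add: hom_diff[OF w T(1) Y(3)])
    then show ?thesis
      using hom_closed[OF w that] Y(3) fgmod_diff_add[OF Y(3), of "w x" "\<zero>\<^bsub>L1\<^esub>"]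
      by simp
  qed
  have ab: "a x \<in> carrier J1" "b x \<in> carrier L0" if "x \<in> carrier T" for x
    using that hom_closed[OF T(4)] hom_closed[OF T(5)] by auto
  define \<epsilon> where "\<epsilon> x = c \<zero>\<^bsub>J1\<^esub> (e x)" for x
  have \<epsilon>: "\<epsilon> \<in> lmod_hom A E T" unfolding \<epsilon>_def
    by (rule hom_comp[OF Y(4) biprod_inr[OF t]])
  have \<epsilon>K: "\<theta> (\<epsilon> x) = \<zero>\<^bsub>T\<^esub>"
    if "x \<in> carrier ?K" for x
  proof -
    have "\<epsilon> x = \<delta> (i x)" using that u(2) X(8)
      by (simp add: \<epsilon>_def \<delta>_def)
    then show ?thesis using \<theta>\<delta> hom_closed[OF X(4) that] by simp
  qed
  have n0: "(\<lambda>x. \<theta> (\<epsilon> x)) \<in> lmod_hom A E ?Q"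
    by (rule hom_comp[OF \<epsilon> \<theta>])
  have "\<theta> (\<epsilon> x) = \<zero>\<^bsub>?Q\<^esub>"
    if "x \<in> carrier E" "p x = \<zero>\<^bsub>N\<^esub>" for x
    using \<epsilon>K[of x] that by (simp add: a_kernel_def')
  then obtain n where n: "n \<in> lmod_hom A N ?Q" "\<And>x. x \<in> carrier E \<Longrightarrow> n (p x) = \<theta> (\<epsilon> x)"
    using factor_surj[OF p n0 Y(1) N Qf] by blast
  have wQ: "w \<in> lmod_hom A ?Q L1" by (rule hom_restrict_dom[OF w a_kernel_subset])
  have "short_exact A N n ?Q w L1"
    unfolding short_exact_def
  proof (intro conjI ballI impI)
    show "inj_on n (carrier N)"
      unfolding hom_inj_iff[OF n(1) N Qf]
    proof (intro ballI impI)
      fix y assume y: "y \<in> carrier N" "n y = \<zero>\<^bsub>?Q\<^esub>"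
      then obtain x where x: "x \<in> carrier E" "y = p x" using p(2) by blast
      have c: "\<epsilon> x \<in> carrier T" using hom_closed[OF \<epsilon> x(1)] .
      have "\<theta> (\<epsilon> x) = \<zero>\<^bsub>T\<^esub>" using n(2)[OF x(1)] y x by simp
      then have eq: "\<epsilon> x = \<delta> (\<rho> (\<epsilon> x))"
        using fgmod_diff_zero[OF T(1) c] dr[OF c] by (simp add: \<theta>_def)
      let ?j = "\<rho> (\<epsilon> x)"
      have ex: "e x \<in> carrier L0" using hom_closed[OF Y(4) x(1)] .
      have j: "?j \<in> carrier J0" using dr[OF c] by simp
      have "a (\<epsilon> x) = \<zero>\<^bsub>J1\<^esub>" "b (\<epsilon> x) = e x" using T(2,7,8) ex
        by (auto simp: \<epsilon>_def)
      moreover have "a (\<delta> ?j) = \<pi> ?j" "b (\<delta> ?j) = u ?j" using T(7,8) pu[OF j]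
        by (auto simp: \<delta>_def)
      ultimately have z: "\<pi> ?j = \<zero>\<^bsub>J1\<^esub>" "u ?j = e x" using eq by metis+
      obtain k where k: "k \<in> carrier ?K" "?j = i k" using X(9)[OF j z(1)] by blast
      have "e x = e k" using z(2) u(2)[OF k(1)] k(2) by simp
      then have "x = k" using inj_onD[OF Y(6)] x(1) KE[OF k(1)] by blast
      then show "y = \<zero>\<^bsub>N\<^esub>" using x(2) KE[OF k(1)] by simp
    qed
    show "w ` carrier ?Q = carrier L1"
    proof
      show "w ` carrier ?Q \<subseteq> carrier L1" using hom_closed[OF wQ] by auto
      show "carrier L1 \<subseteq> w ` carrier ?Q"
      proof
        fix y assume y: "y \<in> carrier L1"
        then have "\<ominus>\<^bsub>L1\<^esub> y \<in> l ` carrier L0" using Y(3,7) by simp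
        then obtain z where z: "z \<in> carrier L0" "\<ominus>\<^bsub>L1\<^esub> y = l z" by blast
        have cz: "c \<zero>\<^bsub>J1\<^esub> z \<in> carrier T" using T(2,6) z by simp
        have "l z \<oplus>\<^bsub>L1\<^esub> y = \<zero>\<^bsub>L1\<^esub>" using z(2)[symmetric] y Y(3)
          by simp
        then have "\<ominus>\<^bsub>L1\<^esub> l z = y"
          by (metis z(2) fgmod_minus_equality fgmod_comm[OF Y(3)] hom_closed[OF Y(5) z(1)] y Y(3))
        then have "w (c \<zero>\<^bsub>J1\<^esub> z) = y"
          using T(2,7,8) z hom_zero[OF v(1) X(3) Y(3)] y Y(3) by (simp add: w_def)
        then have "y = w (\<theta> (c \<zero>\<^bsub>J1\<^esub> z))" using w\<theta>[OF cz] by simp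
        then show "y \<in> w ` carrier ?Q" using hom_closed[OF \<theta> cz] by blast
      qed
    qed
    show "w (n y) = \<zero>\<^bsub>L1\<^esub>" if "y \<in> carrier N" for y
    proof -
      obtain x where x: "x \<in> carrier E" "y = p x" using p(2) \<open>y \<in> carrier N\<close>
        by blast
      have "w (n y) = w (\<epsilon> x)" using n(2)[OF x(1)] x(2) w\<theta> hom_closed[OF \<epsilon> x(1)]
        by simp
      also have "\<dots> = \<zero>\<^bsub>L1\<^esub> \<oplus>\<^bsub>L1\<^esub> \<ominus>\<^bsub>L1\<^esub> \<zero>\<^bsub>L1\<^esub>"
        using T(2,7,8) hom_closed[OF Y(4) x(1)] hom_zero[OF v(1) X(3) Y(3)] Y(8)[OF x(1)]
        by (simp add: w_def \<epsilon>_def)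
      also have "\<dots> = \<zero>\<^bsub>L1\<^esub>"
        using Y(3) fgmod_neg(2)[OF Y(3), of "\<zero>\<^bsub>L1\<^esub>"] by simp
      finally show ?thesis .
    qed
    show "\<exists>y\<in>carrier N. x = n y"
      if x: "x \<in> carrier ?Q" "w x = \<zero>\<^bsub>L1\<^esub>" for x
    proof -
      have xT: "x \<in> carrier T" using x by (auto simp: a_kernel_def')
      have "a x \<in> \<pi> ` carrier J0" using ab[OF xT] X(7) by simp
      then obtain j where j: "j \<in> carrier J0" "a x = \<pi> j" by blast
      have lb: "l (b x) \<in> carrier L1" "l (u j) \<in> carrier L1"
        using ab[OF xT] pu[OF j(1)] hom_closed[OF Y(5)] by auto
      have "l (u j) = l (b x)" using x(2) v(2)[OF j(1)] j(2) fgmod_diff_zero[OF Y(3) lb(2,1)]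
        by (simp add: w_def)
      then have "l (b x \<oplus>\<^bsub>L0\<^esub> \<ominus>\<^bsub>L0\<^esub> u j) = \<zero>\<^bsub>L1\<^esub>"
        using ab[OF xT] pu[OF j(1)] lb Y(3) by (simp add: hom_diff[OF Y(5,2,3)])
      then obtain z where z: "z \<in> carrier E" "b x \<oplus>\<^bsub>L0\<^esub> \<ominus>\<^bsub>L0\<^esub> u j = e z"
        using Y(9)[of "b x \<oplus>\<^bsub>L0\<^esub> \<ominus>\<^bsub>L0\<^esub> u j"] ab[OF xT] pu[OF j(1)] Y(2)
        by auto
      have dj: "\<delta> j \<in> carrier T" using hom_closed[OF \<delta> j(1)] .
      have "x \<oplus>\<^bsub>T\<^esub> \<ominus>\<^bsub>T\<^esub> \<delta> j = \<epsilon> z"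
      proof (rule biprod_eqI[OF t])
        show "x \<oplus>\<^bsub>T\<^esub> \<ominus>\<^bsub>T\<^esub> \<delta> j \<in> carrier T" "\<epsilon> z \<in> carrier T" using xT dj T(1) hom_closed[OF \<epsilon> z(1)]
          by auto
        show "a (x \<oplus>\<^bsub>T\<^esub> \<ominus>\<^bsub>T\<^esub> \<delta> j) = a (\<epsilon> z)"
          using xT dj j pu[OF j(1)] T(2,7) hom_closed[OF Y(4) z(1)]
          by (simp add: hom_diff[OF T(4) T(1,2)] \<delta>_def \<epsilon>_def)
        show "b (x \<oplus>\<^bsub>T\<^esub> \<ominus>\<^bsub>T\<^esub> \<delta> j) = b (\<epsilon> z)"
          using xT dj j pu[OF j(1)] T(2,8) hom_closed[OF Y(4) z(1)] z(2)
          by (simp add: hom_diff[OF T(5) T(1,3)] \<delta>_def \<epsilon>_def)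
      qed
      then have "\<theta> (\<epsilon> z) = \<theta> x \<oplus>\<^bsub>T\<^esub> \<ominus>\<^bsub>T\<^esub> \<zero>\<^bsub>T\<^esub>"
        using \<theta>\<delta>[OF j(1)] xT dj by (metis hom_diff[OF \<theta>0 T(1) T(1)])
      also have "\<dots> = x"
        using \<theta>Q[OF x(1)] xT T(1) fgmod_diff_add[OF T(1), of x "\<zero>\<^bsub>T\<^esub>"]
        by simp
      finally have "x = n (p z)" using n(2)[OF z(1)] by simp
      then show ?thesis using hom_closed[OF p(1) z(1)] by blast
    qed
  qed (use N Qf Y n wQ in auto)
  then show ?thesis unfolding id_le_one_def using IQ IL(2) by blast
qed

end

section \<open>Decompositions into indecomposable modules\<close>

lemma biprod_interchange:
  assumes N: "biprod A N p q c M1 M2"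
    and M1: "biprod A M1 p1 q1 c1 U1 V1" and M2: "biprod A M2 p2 q2 c2 U2 V2"
    and U: "biprod A U pU qU cU U1 U2" and V: "biprod A V pV qV cV V1 V2"
  shows "biprod A N (\<lambda>s. cU (p1 (p s)) (p2 (q s))) (\<lambda>s. cV (q1 (p s)) (q2 (q s)))
    (\<lambda>u v. c (c1 (pU u) (pV v)) (c2 (qU u) (qV v))) U V"
proof -
  note n = biprodD[OF N] and m1 = biprodD[OF M1] and m2 = biprodD[OF M2] and u = biprodD[OF U]
    and v = biprodD[OF V]
  show ?thesis
    unfolding biprod_def
  proof (intro conjI ballI)
    show "(\<lambda>s. cU (p1 (p s)) (p2 (q s))) \<in> lmod_hom A N U"
      by (rule biprod_hom[OF U hom_comp[OF n(4) m1(4)] hom_comp[OF n(5) m2(4)]])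
    show "(\<lambda>s. cV (q1 (p s)) (q2 (q s))) \<in> lmod_hom A N V"
      by (rule biprod_hom[OF V hom_comp[OF n(4) m1(5)] hom_comp[OF n(5) m2(5)]])
    fix x y assume xy: "x \<in> carrier U" "y \<in> carrier V"
    have c: "pU x \<in> carrier U1" "qU x \<in> carrier U2" "pV y \<in> carrier V1" "qV y \<in> carrier V2"
      using xy hom_closed[OF u(4)] hom_closed[OF u(5)] hom_closed[OF v(4)] hom_closed[OF v(5)]
      by auto
    have d: "c1 (pU x) (pV y) \<in> carrier M1" "c2 (qU x) (qV y) \<in> carrier M2" using c m1(6) m2(6)
      by auto
    show "c (c1 (pU x) (pV y)) (c2 (qU x) (qV y)) \<in> carrier N" using n(6) d by blast
    show "cU (p1 (p (c (c1 (pU x) (pV y)) (c2 (qU x) (qV y))))) (p2 (q (c (c1 (pU x) (pV y)) (c2 (qU x) (qV y))))) = x"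
      using n(7,8)[OF d] m1(7)[OF c(1,3)] m2(7)[OF c(2,4)] u(9)[OF xy(1)] by simp
    show "cV (q1 (p (c (c1 (pU x) (pV y)) (c2 (qU x) (qV y))))) (q2 (q (c (c1 (pU x) (pV y)) (c2 (qU x) (qV y))))) = y"
      using n(7,8)[OF d] m1(8)[OF c(1,3)] m2(8)[OF c(2,4)] v(9)[OF xy(2)] by simp
  next
    fix s assume s: "s \<in> carrier N"
    have d: "p s \<in> carrier M1" "q s \<in> carrier M2" using s hom_closed[OF n(4)] hom_closed[OF n(5)]
      by auto
    have c: "p1 (p s) \<in> carrier U1" "q1 (p s) \<in> carrier V1" "p2 (q s) \<in> carrier U2" "q2 (q s) \<in> carrier V2"
      using d hom_closed[OF m1(4)] hom_closed[OF m1(5)] hom_closed[OF m2(4)] hom_closed[OF m2(5)]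
      by auto
    show "c (c1 (pU (cU (p1 (p s)) (p2 (q s)))) (pV (cV (q1 (p s)) (q2 (q s)))))
       (c2 (qU (cU (p1 (p s)) (p2 (q s)))) (qV (cV (q1 (p s)) (q2 (q s))))) = s"
      using u(7,8)[OF c(1,3)] v(7,8)[OF c(2,4)] m1(9)[OF d(1)] m2(9)[OF d(2)] n(9)[OF s] by simp
  qed (use n u v in auto)
qed

lemma biprod_trivial:
  assumes M: "M \<in> fgmod A" and Z: "Z \<in> fgmod A" "carrier Z = {\<zero>\<^bsub>Z\<^esub>}"
  shows "biprod A M (\<lambda>x. x) (\<lambda>x. \<zero>\<^bsub>Z\<^esub>) (\<lambda>x y. x) M Z"
  unfolding biprod_def using M Z hom_id[of A M] hom_zero_map[OF Z(1), of M] by auto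

lemma retract_biprod_zero:
  assumes b: "biprod A S p q c M N" and N: "carrier N = {\<zero>\<^bsub>N\<^esub>}"
  shows "retract A S M p (\<lambda>x. c x \<zero>\<^bsub>N\<^esub>)"
proof -
  note B = biprodD[OF b]
  have "c (p s) \<zero>\<^bsub>N\<^esub> = s" if "s \<in> carrier S" for s
    using B(9)[OF that] hom_closed[OF B(5) that] N by simp
  then show ?thesis unfolding retract_def using B biprod_inl[OF b] by blast
qed

context finite_height_ring
begin

text \<open>If every indecomposable module has one of two additive properties, then every module is the direct
  sum of a module with the first and a module with the second property.\<close>

lemma decompose:
  assumes M: "M \<in> fgmod A"
    and Pz: "\<And>N. N \<in> fgmod A \<Longrightarrow> carrier N = {\<zero>\<^bsub>N\<^esub>} \<Longrightarrow> P N"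
    and Qz: "\<And>N. N \<in> fgmod A \<Longrightarrow> carrier N = {\<zero>\<^bsub>N\<^esub>} \<Longrightarrow> Q N"
    and Ps: "\<And>S p q c U V. biprod A S p q c U V \<Longrightarrow> P U \<Longrightarrow> P V \<Longrightarrow> P S"
    and Qs: "\<And>S p q c U V. biprod A S p q c U V \<Longrightarrow> Q U \<Longrightarrow> Q V \<Longrightarrow> Q S"
    and ind: "\<And>N. N \<in> fgmod A \<Longrightarrow> indecomposable A N \<Longrightarrow> P N \<or> Q N"
  shows "\<exists>p q c U V. biprod A M p q c U V \<and> P U \<and> Q V"
proof -
  obtain \<rho> where \<rho>: "strict_rank {U. submodule U A M} \<rho>" using height[OF M] by blast
  have "\<exists>p q c U V. biprod A (M\<lparr>carrier := W\<rparr>) p q c U V \<and> P U \<and> Q V"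
    if "submodule W A M" for W
    using that
  proof (induction "\<rho> W" arbitrary: W rule: less_induct)
    case less
    let ?N = "M\<lparr>carrier := W\<rparr>"
    have N: "?N \<in> fgmod A" by (rule restrict_fgmod[OF M less.prems])
    let ?Z = "?N\<lparr>carrier := {\<zero>\<^bsub>?N\<^esub>}\<rparr>"
    have Z: "?Z \<in> fgmod A" "carrier ?Z = {\<zero>\<^bsub>?Z\<^esub>}" using zero_fgmod[OF N]
      by simp_all
    have easy: ?case if "P ?N \<or> Q ?N"
      using that biprod_trivial[OF N Z] biprod_sym[OF biprod_trivial[OF N Z]] Pz[OF Z] Qz[OF Z]
      by blast
    consider "carrier ?N = {\<zero>\<^bsub>?N\<^esub>}" | "indecomposable A ?N" | U V where "submodule U A ?N" "submodule V A ?N"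
        "U \<inter> V = {\<zero>\<^bsub>?N\<^esub>}" "U <+>\<^bsub>?N\<^esub> V = carrier ?N" "U \<noteq> {\<zero>\<^bsub>?N\<^esub>}" "V \<noteq> {\<zero>\<^bsub>?N\<^esub>}"
      unfolding indecomposable_def by blast
    then show ?case
    proof cases
      case 1 then show ?thesis using easy Pz[OF N] by blast
    next
      case 2 then show ?thesis using easy ind[OF N] by blast
    next
      case 3
      have U: "submodule U A M" "U \<subseteq> W" and V: "submodule V A M" "V \<subseteq> W"
        using 3(1,2) submodule_restrict_iff[OF M less.prems] by auto
      have "U \<noteq> W" "V \<noteq> W" using 3(3,5,6) U V by auto
      then have "\<rho> U < \<rho> W" "\<rho> V < \<rho> W" using strict_rankD[OF \<rho>] U V less.prems
        by auto
      then obtain p1 q1 c1 U1 V1 p2 q2 c2 U2 V2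
        where d1: "biprod A (M\<lparr>carrier := U\<rparr>) p1 q1 c1 U1 V1" "P U1" "Q V1"
          and d2: "biprod A (M\<lparr>carrier := V\<rparr>) p2 q2 c2 U2 V2" "P U2" "Q V2"
        using less.hyps U(1) V(1) by metis
      have fg: "?N\<lparr>carrier := U\<rparr> \<in> fgmod A" "?N\<lparr>carrier := V\<rparr> \<in> fgmod A"
        using restrict_fgmod[OF N] 3(1,2) by auto
      obtain p q where b: "biprod A ?N p q (\<lambda>x y. x \<oplus>\<^bsub>?N\<^esub> y) (M\<lparr>carrier := U\<rparr>) (M\<lparr>carrier := V\<rparr>)"
        using biprod_internal[OF N 3(1-4) fg] by auto
      obtain U' pU qU cU where bU: "biprod A U' pU qU cU U1 U2"
        using biprod_exists[OF biprodD(2)[OF d1(1)] biprodD(2)[OF d2(1)]] by blast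
      obtain V' pV qV cV where bV: "biprod A V' pV qV cV V1 V2"
        using biprod_exists[OF biprodD(3)[OF d1(1)] biprodD(3)[OF d2(1)]] by blast
      show ?thesis
        using biprod_interchange[OF b d1(1) d2(1) bU bV] Ps[OF bU d1(2) d2(2)] Qs[OF bV d1(3) d2(3)]
        by blast
    qed
  qed
  from this[OF submodule_carrier[OF M]] show ?thesis by simp
qed

lemma indecomposable_summand:
  assumes M: "M \<in> fgmod A" and nz: "carrier M \<noteq> {\<zero>\<^bsub>M\<^esub>}"
  shows "\<exists>N s r. retract A N M s r \<and> indecomposable A N"
proof -
  let ?P = "\<lambda>M. carrier M = {\<zero>\<^bsub>M\<^esub>} \<or> (\<exists>N s r. retract A N M s r \<and> indecomposable A N)"
  let ?Q = "\<lambda>M. carrier M = {\<zero>\<^bsub>M\<^esub>}"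
  have zs: "?Q S" if b: "biprod A S p q c U V" and z: "?Q U" "?Q V" for S p q c U V
  proof -
    note B = biprodD[OF b]
    have "s = \<zero>\<^bsub>S\<^esub>" if "s \<in> carrier S" for s
      using B(9)[OF that] hom_closed[OF B(4) that] hom_closed[OF B(5) that] z biprod_zero[OF b]
      by simp
    then show ?thesis using B(1) by auto
  qed
  have ps: "?P S" if b: "biprod A S p q c U V" and z: "?P U" "?P V" for S p q c U V
  proof (cases "?Q U \<and> ?Q V")
    case True then show ?thesis using zs[OF b] by blast
  next
    case False
    then obtain N s r W s' r' where "retract A N W s r" "indecomposable A N" "retract A W S s' r'"
      using z retract_biprod[OF b] by meson
    then show ?thesis using retract_trans by blast
  qed
  have triv: "\<exists>N' s r. retract A N' N s r \<and> indecomposable A N'"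
    if "N \<in> fgmod A" "indecomposable A N" for N
    using that hom_id[of A N] unfolding retract_def by blast
  have "\<exists>p q c U V. biprod A M p q c U V \<and> ?P U \<and> ?Q V"
  proof (rule decompose[OF M])
    show "?P N \<or> ?Q N" if "N \<in> fgmod A" "indecomposable A N" for N using triv[OF that]
      by blast
    show "?P S" if "biprod A S p q c U V" "?P U" "?P V" for S p q c U V using ps[OF that] .
    show "?Q S" if "biprod A S p q c U V" "?Q U" "?Q V" for S p q c U V using zs[OF that] .
  qed simp_all
  then obtain p q c U V where b: "biprod A M p q c U V" "?P U" "?Q V"
    by (elim exE conjE) (rule that)
  then show ?thesis using nz zs[OF b(1)] retract_trans[OF _ retract_biprod(1)[OF b(1)]] by blast
qed

lemma funpow_hom: "f \<in> lmod_hom A N N \<Longrightarrow> (f ^^ n) \<in> lmod_hom A N N"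
proof (induction n)
  case 0 then show ?case using hom_id[of A N] by (simp add: id_def)
next
  case (Suc n)
  then have "(\<lambda>x. f ((f ^^ n) x)) \<in> lmod_hom A N N" by (intro hom_comp[OF Suc.IH])
  then show ?case by (simp add: o_def)
qed

lemma fitting:
  assumes N: "N \<in> fgmod A" "indecomposable A N" and f: "f \<in> lmod_hom A N N"
  shows "bij_betw f (carrier N) (carrier N) \<or> (\<exists>n. \<forall>x\<in>carrier N. (f ^^ n) x = \<zero>\<^bsub>N\<^esub>)"
proof -
  obtain \<rho> where \<rho>: "strict_rank {U. submodule U A N} \<rho>" using height[OF N(1)]
    by blast
  note fn = funpow_hom[OF f]
  define I where "I n = (f ^^ n) ` carrier N" for n
  define K where "K n = a_kernel N N (f ^^ n)" for n
  have Is: "submodule (I n) A N" for n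
    unfolding I_def by (rule submodule_image[OF fn N(1) N(1) submodule_carrier[OF N(1)]])
  have Ks: "submodule (K n) A N" for n unfolding K_def by (rule submodule_kernel[OF fn N(1) N(1)])
  have Imono: "I (n + k) \<subseteq> I n" for n k
    unfolding I_def funpow_add using hom_closed[OF fn] by auto
  have Kmono: "K n \<subseteq> K (n + k)" for n k
    unfolding K_def add.commute[of n] funpow_add a_kernel_def' using hom_zero[OF fn N(1) N(1)]
    by auto
  obtain a where a: "\<And>n. \<rho> (I a) \<le> \<rho> (I n)"
    using ex_has_least_nat[of "\<lambda>_. True" 0 "\<lambda>n. \<rho> (I n)"] by auto
  have "\<rho> (K n) \<le> \<rho> (carrier N)" for n
    using strict_rank_mono[OF \<rho>, of "K n" "carrier N"] Ks submodule_carrier[OF N(1)] submodule_mem(1)[OF Ks N(1)]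
    by auto
  then obtain b where b: "\<And>n. \<rho> (K n) \<le> \<rho> (K b)"
    using ex_has_greatest_nat[of "\<lambda>_. True" 0 "\<lambda>n. \<rho> (K n)" "Suc (\<rho> (carrier N))"]
    by (auto simp: less_Suc_eq_le)
  \<comment> \<open>beyond \<open>a\<close> the images of the powers of \<open>f\<close> are constant, beyond \<open>b\<close> the kernels\<close>
  define t where "t = Suc (a + b)"
  have Ia: "I (a + k) = I a" for k
    using strict_rankD[OF \<rho>, of "I (a + k)" "I a"] Is Imono[of a k] a[of "a + k"] by auto
  have Kb: "K (b + k) = K b" for k
    using strict_rankD[OF \<rho>, of "K b" "K (b + k)"] Ks Kmono[of b k] b[of "b + k"] by auto
  have It: "I (t + t) = I t" using Ia[of "Suc b"] Ia[of "Suc b + t"] by (simp add: t_def add.assoc)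
  have Kt: "K (t + t) = K t" using Kb[of "Suc a"] Kb[of "Suc a + t"] by (simp add: t_def ac_simps)
  let ?g = "f ^^ t"
  have gg: "(f ^^ (t + t)) x = ?g (?g x)" for x by (simp add: funpow_add)
  have "K t \<inter> I t = {\<zero>\<^bsub>N\<^esub>}"
  proof
    show "{\<zero>\<^bsub>N\<^esub>} \<subseteq> K t \<inter> I t"
      using submodule_mem(2)[OF Ks N(1)] submodule_mem(2)[OF Is N(1)] by simp
    show "K t \<inter> I t \<subseteq> {\<zero>\<^bsub>N\<^esub>}"
    proof
      fix x assume x: "x \<in> K t \<inter> I t"
      then obtain y where y: "y \<in> carrier N" "x = ?g y" unfolding I_def by blast
      have "?g x = \<zero>\<^bsub>N\<^esub>" using x by (simp add: K_def a_kernel_def')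
      then have "y \<in> K (t + t)" using y gg by (simp add: K_def a_kernel_def')
      then have "y \<in> K t" using Kt by simp
      then show "x \<in> {\<zero>\<^bsub>N\<^esub>}" using y by (simp add: K_def a_kernel_def')
    qed
  qed
  moreover have "K t <+>\<^bsub>N\<^esub> I t = carrier N"
  proof
    show "K t <+>\<^bsub>N\<^esub> I t \<subseteq> carrier N"
    proof
      fix x assume "x \<in> K t <+>\<^bsub>N\<^esub> I t"
      then obtain u v where "u \<in> K t" "v \<in> I t" "x = u \<oplus>\<^bsub>N\<^esub> v"
        unfolding set_add_def' by blast
      moreover from this have "u \<in> carrier N" "v \<in> carrier N"
        using submodule_mem(1)[OF Ks N(1)] submodule_mem(1)[OF Is N(1)] by blast+
      ultimately show "x \<in> carrier N" using N(1) by simp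
    qed
    show "carrier N \<subseteq> K t <+>\<^bsub>N\<^esub> I t"
    proof
      fix x assume x: "x \<in> carrier N"
      then have "?g x \<in> I (t + t)" unfolding It by (simp add: I_def)
      then obtain y where y: "y \<in> carrier N" "?g x = ?g (?g y)" unfolding I_def gg by blast
      have gy: "?g y \<in> carrier N" "?g (?g y) \<in> carrier N" using y hom_closed[OF fn] by auto
      have "?g (x \<oplus>\<^bsub>N\<^esub> \<ominus>\<^bsub>N\<^esub> ?g y) = \<zero>\<^bsub>N\<^esub>"
        using x y gy N(1) by (simp add: hom_diff[OF fn N(1) N(1)])
      then have "x \<oplus>\<^bsub>N\<^esub> \<ominus>\<^bsub>N\<^esub> ?g y \<in> K t" using x gy N(1)
        by (simp add: K_def a_kernel_def')
      moreover have "?g y \<in> I t" using y by (simp add: I_def)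
      moreover have "x = (x \<oplus>\<^bsub>N\<^esub> \<ominus>\<^bsub>N\<^esub> ?g y) \<oplus>\<^bsub>N\<^esub> ?g y" using x gy N(1)
        by simp
      ultimately show "x \<in> K t <+>\<^bsub>N\<^esub> I t" unfolding set_add_def' by blast
    qed
  qed
  ultimately consider "K t = {\<zero>\<^bsub>N\<^esub>}" "I t = carrier N" | "I t = {\<zero>\<^bsub>N\<^esub>}"
  proof -
    assume i: "K t \<inter> I t = {\<zero>\<^bsub>N\<^esub>}"
      and s: "K t <+>\<^bsub>N\<^esub> I t = carrier N"
      and c1: "K t = {\<zero>\<^bsub>N\<^esub>} \<Longrightarrow> I t = carrier N \<Longrightarrow> thesis"
      and c2: "I t = {\<zero>\<^bsub>N\<^esub>} \<Longrightarrow> thesis"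
    have "I t \<subseteq> carrier N" using submodule_mem(1)[OF Is N(1)] .
    moreover have "K t = {\<zero>\<^bsub>N\<^esub>} \<or> I t = {\<zero>\<^bsub>N\<^esub>}"
      using N(2) Ks Is i s unfolding indecomposable_def by blast
    moreover have "I t = carrier N" if k: "K t = {\<zero>\<^bsub>N\<^esub>}"
    proof -
      have "\<zero>\<^bsub>N\<^esub> \<oplus>\<^bsub>N\<^esub> x = x" if "x \<in> I t" for x
        using that \<open>I t \<subseteq> carrier N\<close> N(1) by auto
      then have "K t <+>\<^bsub>N\<^esub> I t = I t" unfolding k set_add_def' by auto
      then show ?thesis using s by simp
    qed
    ultimately show thesis using c1 c2 by blast
  qed
  then show ?thesis
  proof cases
    case 1
    have g: "?g x = (f ^^ (a + b)) (f x)" "?g x = f ((f ^^ (a + b)) x)" for x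
      by (simp_all add: t_def funpow_swap1)
    have "inj_on f (carrier N)"
      unfolding hom_inj_iff[OF f N(1) N(1)]
    proof (intro ballI impI)
      fix x assume "x \<in> carrier N" "f x = \<zero>\<^bsub>N\<^esub>"
      then have "x \<in> K t" using g(1) hom_zero[OF fn N(1) N(1)]
        by (simp add: K_def a_kernel_def')
      then show "x = \<zero>\<^bsub>N\<^esub>" using 1 by simp
    qed
    moreover have "carrier N \<subseteq> f ` carrier N"
      using 1(2) g(2) hom_closed[OF fn] unfolding I_def by (metis image_eqI image_subsetI)
    ultimately show ?thesis using hom_closed[OF f] unfolding bij_betw_def by blast
  next
    case 2
    then have "\<forall>x\<in>carrier N. ?g x = \<zero>\<^bsub>N\<^esub>" unfolding I_def by blast
    then show ?thesis by blast
  qed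
qed

text \<open>The endomorphism ring of an indecomposable module is local.\<close>

lemma fitting_sum:
  assumes N: "N \<in> fgmod A" "indecomposable A N" and f: "f \<in> lmod_hom A N N"
    and g: "g \<in> lmod_hom A N N"
    and fg: "\<And>x. x \<in> carrier N \<Longrightarrow> f x \<oplus>\<^bsub>N\<^esub> g x = x"
  shows "bij_betw f (carrier N) (carrier N) \<or> bij_betw g (carrier N) (carrier N)"
proof (rule ccontr)
  assume c: "\<not> ?thesis"
  then obtain n k where n: "\<forall>x\<in>carrier N. (f ^^ n) x = \<zero>\<^bsub>N\<^esub>"
    and k: "\<forall>x\<in>carrier N. (g ^^ k) x = \<zero>\<^bsub>N\<^esub>"
    using fitting[OF N f] fitting[OF N g] by blast
  have inj: "x = \<zero>\<^bsub>N\<^esub>"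
    if x: "x \<in> carrier N" "g x = \<zero>\<^bsub>N\<^esub>" for x
  proof -
    have "f x = x" using fg[OF x(1)] x(2) hom_closed[OF f x(1)] N(1) by simp
    then have "(f ^^ n) x = x" by (induction n) auto
    then show ?thesis using n x(1) by simp
  qed
  have "x = \<zero>\<^bsub>N\<^esub>"
    if "x \<in> carrier N" "(g ^^ j) x = \<zero>\<^bsub>N\<^esub>" for x j
    using that
  proof (induction j arbitrary: x)
    case (Suc j)
    then have "g x = \<zero>\<^bsub>N\<^esub>" using Suc.IH[of "g x"] hom_closed[OF g]
      by (simp add: funpow_swap1)
    then show ?case using inj Suc.prems by blast
  qed simp
  then have "carrier N = {\<zero>\<^bsub>N\<^esub>}" using k N(1) by auto
  then show False using N(2) by (simp add: indecomposable_def)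
qed

text \<open>\<open>M\<close> has no nonzero direct summand in the class \<open>\<Phi>\<close>.\<close>

definition summand_free :: "('a lmod \<Rightarrow> bool) \<Rightarrow> 'a lmod \<Rightarrow> bool" where
  "summand_free \<Phi> M \<longleftrightarrow> M \<in> fgmod A \<and> (\<forall>N s r. retract A N M s r \<longrightarrow> \<Phi> N \<longrightarrow> carrier N = {\<zero>\<^bsub>N\<^esub>})"

text \<open>The classes \<open>\<Phi>\<close> for which \<open>hom_into_summand_free_zero\<close> holds. The fourth condition concerns
  quotients by a submodule of injective dimension at most one.\<close>

definition good_class :: "nat \<Rightarrow> ('a lmod \<Rightarrow> bool) \<Rightarrow> bool" where
  "good_class m \<Phi> \<longleftrightarrow>
     (\<forall>N M s r. retract A N M s r \<longrightarrow> \<Phi> M \<longrightarrow> \<Phi> N) \<and>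
     (\<forall>S p q c U V. biprod A S p q c U V \<longrightarrow> \<Phi> U \<longrightarrow> \<Phi> V \<longrightarrow> \<Phi> S) \<and>
     (\<forall>N\<in>fgmod A. carrier N = {\<zero>\<^bsub>N\<^esub>} \<longrightarrow> \<Phi> N) \<and>
     (\<forall>E\<in>fgmod A. \<forall>N\<in>fgmod A. \<forall>p\<in>lmod_hom A E N. p ` carrier E = carrier N \<longrightarrow> \<Phi> E \<longrightarrow>
        id_le_one A (E\<lparr>carrier := a_kernel E N p\<rparr>) \<longrightarrow> \<Phi> N) \<and>
     (\<forall>N\<in>fgmod A. indecomposable A N \<longrightarrow> \<not> \<Phi> N \<longrightarrow> pd_le A m N)"

lemma good_classD:
  assumes "good_class m \<Phi>"
  shows "\<And>N M s r. retract A N M s r \<Longrightarrow> \<Phi> M \<Longrightarrow> \<Phi> N"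
    "\<And>S p q c U V. biprod A S p q c U V \<Longrightarrow> \<Phi> U \<Longrightarrow> \<Phi> V \<Longrightarrow> \<Phi> S"
    "\<And>N. N \<in> fgmod A \<Longrightarrow> carrier N = {\<zero>\<^bsub>N\<^esub>} \<Longrightarrow> \<Phi> N"
    "\<And>E N p. E \<in> fgmod A \<Longrightarrow> N \<in> fgmod A \<Longrightarrow> p \<in> lmod_hom A E N \<Longrightarrow> p ` carrier E = carrier N \<Longrightarrow>
       \<Phi> E \<Longrightarrow> id_le_one A (E\<lparr>carrier := a_kernel E N p\<rparr>) \<Longrightarrow> \<Phi> N"
    "\<And>N. N \<in> fgmod A \<Longrightarrow> indecomposable A N \<Longrightarrow> \<not> \<Phi> N \<Longrightarrow> pd_le A m N"
  using assms unfolding good_class_def by metis+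

text \<open>This is the part of the Krull--Schmidt theorem that the proof needs: an indecomposable summand of
  \<open>U \<oplus> V\<close> is isomorphic to a summand of \<open>U\<close> or of \<open>V\<close>, since its endomorphism ring is local.\<close>

lemma summand_free_biprod:
  assumes good: "good_class m \<Phi>"
    and b: "biprod A S p q c U V" and U: "summand_free \<Phi> U" and V: "summand_free \<Phi> V"
  shows "summand_free \<Phi> S"
  unfolding summand_free_def
proof (intro conjI allI impI)
  note B = biprodD[OF b] and ret = good_classD(1)[OF good]
  show "S \<in> fgmod A" by (rule B(1))
  fix N s r assume R: "retract A N S s r" and \<Phi>: "\<Phi> N"
  show "carrier N = {\<zero>\<^bsub>N\<^esub>}"
  proof (rule ccontr)
    assume "carrier N \<noteq> {\<zero>\<^bsub>N\<^esub>}"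
    then obtain N1 s1 r1 where 1: "retract A N1 N s1 r1" "indecomposable A N1"
      using indecomposable_summand[OF retractD(1)[OF R]] by blast
    have \<Phi>1: "\<Phi> N1" using ret[OF 1(1) \<Phi>] .
    have nz: "carrier N1 \<noteq> {\<zero>\<^bsub>N1\<^esub>}" using 1(2)
      by (simp add: indecomposable_def)
    obtain s r where R: "retract A N1 S s r" using retract_trans[OF 1(1) R] by blast
    note R = retractD[OF R]
    let ?f = "\<lambda>x. r (c (p (s x)) \<zero>\<^bsub>V\<^esub>)"
      and ?g = "\<lambda>x. r (c \<zero>\<^bsub>U\<^esub> (q (s x)))"
    have ps: "(\<lambda>x. p (s x)) \<in> lmod_hom A N1 U"
      and qs: "(\<lambda>x. q (s x)) \<in> lmod_hom A N1 V"
      by (rule hom_comp[OF R(3) B(4)], rule hom_comp[OF R(3) B(5)])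
    have rl: "(\<lambda>x. r (c x \<zero>\<^bsub>V\<^esub>)) \<in> lmod_hom A U N1"
      and rr: "(\<lambda>x. r (c \<zero>\<^bsub>U\<^esub> x)) \<in> lmod_hom A V N1"
      by (rule hom_comp[OF biprod_inl[OF b] R(4)], rule hom_comp[OF biprod_inr[OF b] R(4)])
    have f: "?f \<in> lmod_hom A N1 N1" and g: "?g \<in> lmod_hom A N1 N1"
      by (rule hom_comp[OF ps rl], rule hom_comp[OF qs rr])
    have "?f x \<oplus>\<^bsub>N1\<^esub> ?g x = x" if x: "x \<in> carrier N1" for x
    proof -
      have sx: "s x \<in> carrier S" using hom_closed[OF R(3) x] .
      have cl: "c (p (s x)) \<zero>\<^bsub>V\<^esub> \<in> carrier S" "c \<zero>\<^bsub>U\<^esub> (q (s x)) \<in> carrier S"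
        using hom_closed[OF ps x] hom_closed[OF qs x] B(2,3,6) by auto
      show ?thesis
        using biprod_split[OF b sx] hom_add[OF R(4) cl] R(5)[OF x] by simp
    qed
    then consider "bij_betw ?f (carrier N1) (carrier N1)" | "bij_betw ?g (carrier N1) (carrier N1)"
      using fitting_sum[OF R(1) 1(2) f g] by blast
    then show False
    proof cases
      case 1
      obtain h where "retract A N1 N1 ?f h" using retract_iso[OF f 1 R(1,1)] by blast
      then have h: "h \<in> lmod_hom A N1 N1" "\<And>x. x \<in> carrier N1 \<Longrightarrow> h (?f x) = x"
        by (auto dest: retractD)
      have "retract A N1 U (\<lambda>x. p (s x)) (\<lambda>y. h (r (c y \<zero>\<^bsub>V\<^esub>)))"
        unfolding retract_def using R(1) B(2) ps hom_comp[OF rl h(1)] h(2) by blast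
      then show False using U \<Phi>1 nz unfolding summand_free_def by blast
    next
      case 2
      obtain h where "retract A N1 N1 ?g h" using retract_iso[OF g 2 R(1,1)] by blast
      then have h: "h \<in> lmod_hom A N1 N1" "\<And>x. x \<in> carrier N1 \<Longrightarrow> h (?g x) = x"
        by (auto dest: retractD)
      have "retract A N1 V (\<lambda>x. q (s x)) (\<lambda>y. h (r (c \<zero>\<^bsub>U\<^esub> y)))"
        unfolding retract_def using R(1) B(3) qs hom_comp[OF rr h(1)] h(2) by blast
      then show False using V \<Phi>1 nz unfolding summand_free_def by blast
    qed
  qed
qed

lemma summand_free_indecomposable:
  assumes good: "good_class m \<Phi>"
    and Y: "Y \<in> fgmod A" "indecomposable A Y" "\<not> \<Phi> Y"
  shows "summand_free \<Phi> Y"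
  unfolding summand_free_def
proof (intro conjI allI impI)
  fix N s r assume R: "retract A N Y s r" and \<Phi>: "\<Phi> N"
  have "\<not> (\<forall>x\<in>carrier Y. s (r x) = x)"
  proof
    assume "\<forall>x\<in>carrier Y. s (r x) = x"
    then have "retract A Y N r s" using retractD[OF R] unfolding retract_def by blast
    then show False using good_classD(1)[OF good] \<Phi> Y(3) by blast
  qed
  then show "carrier N = {\<zero>\<^bsub>N\<^esub>}" using indecomposable_retract[OF Y(2) R]
    by blast
qed (rule Y(1))

lemma summand_free_zero: "N \<in> fgmod A \<Longrightarrow> carrier N = {\<zero>\<^bsub>N\<^esub>} \<Longrightarrow> summand_free \<Phi> N"
  unfolding summand_free_def
proof (intro conjI allI impI)
  fix N' s r assume N: "N \<in> fgmod A" "carrier N = {\<zero>\<^bsub>N\<^esub>}"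
    and R: "retract A N' N s r"
  note R = retractD[OF R]
  have "x = \<zero>\<^bsub>N'\<^esub>" if "x \<in> carrier N'" for x
    using R(5)[OF that] hom_closed[OF R(3) that] N(2) hom_zero[OF R(4,2,1)] by simp
  then show "carrier N' = {\<zero>\<^bsub>N'\<^esub>}" using R(1) by auto
qed

end

section \<open>Separating modules of large projective and injective dimension\<close>

text \<open>The two conditions of an \<open>(m, 1)\<close>-almost hereditary algebra; of the global dimension only the upper
  bound is kept.\<close>

locale almost_hereditary_ring = finite_height_ring A for A :: "('a, 'z) ring_scheme" +
  fixes m :: nat
  assumes gl_dim_le: "M \<in> fgmod A \<Longrightarrow> pd_le A (Suc m) M"
    and alternative: "M \<in> fgmod A \<Longrightarrow> indecomposable A M \<Longrightarrow> pd_le A m M \<or> id_le_one A M"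
begin

lemma good_class_id1: "good_class m (id_le_one A)"
  unfolding good_class_def
proof (intro conjI allI ballI impI)
  show "id_le_one A N" if "retract A N M s r" "id_le_one A M" for N M s r
    using id_le_one_retract[OF that(2,1)] .
  show "id_le_one A S" if "biprod A S p q c U V" "id_le_one A U" "id_le_one A V" for S p q c U V
    using id_le_one_biprod[OF that] .
  show "id_le_one A N" if "N \<in> fgmod A" "carrier N = {\<zero>\<^bsub>N\<^esub>}" for N
    using id_le_one_zero[OF that] .
  show "id_le_one A N"
    if "E \<in> fgmod A" "N \<in> fgmod A" "p \<in> lmod_hom A E N" "p ` carrier E = carrier N" "id_le_one A E"
    "id_le_one A (E\<lparr>carrier := a_kernel E N p\<rparr>)" for E N p
      using id_le_one_quotient[OF that(3,4,2,5,6)] .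
  show "pd_le A m N" if "N \<in> fgmod A" "indecomposable A N" "\<not> id_le_one A N" for N
    using alternative[OF that(1,2)] that(3) by simp
qed

lemma pd_le_zero: "N \<in> fgmod A \<Longrightarrow> carrier N = {\<zero>\<^bsub>N\<^esub>} \<Longrightarrow> pd_le A n N"
  by (rule pd_le_projective[OF projective_zero])

lemma pd_le_summand_free:
  assumes \<Phi>: "good_class m \<Phi>" and Y: "summand_free \<Phi> Y"
  shows "pd_le A m Y"
proof -
  note G = good_classD[OF \<Phi>]
  have Yf: "Y \<in> fgmod A" using Y by (simp add: summand_free_def)
  have "\<exists>p q c U V. biprod A Y p q c U V \<and> pd_le A m U \<and> \<Phi> V"
  proof (rule decompose[OF Yf])
    show "pd_le A m S" if "biprod A S p q c U V" "pd_le A m U" "pd_le A m V" for S p q c U V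
      by (rule pd_le_biprod[OF that])
    show "\<Phi> S" if "biprod A S p q c U V" "\<Phi> U" "\<Phi> V" for S p q c U V
      by (rule G(2)[OF that])
    show "pd_le A m N \<or> \<Phi> N" if "N \<in> fgmod A" "indecomposable A N" for N using G(5)[OF that]
      by blast
  qed (simp_all add: pd_le_zero G(3))
  then obtain p q c U V where b: "biprod A Y p q c U V" "pd_le A m U" "\<Phi> V" by blast
  then have "carrier V = {\<zero>\<^bsub>V\<^esub>}" using Y retract_biprod(2)[OF b(1)]
    unfolding summand_free_def by blast
  then show ?thesis using pd_le_retract[OF retract_biprod_zero[OF b(1)] b(2)] by blast
qed

text \<open>The key lemma; its proof is sketched at the beginning.\<close>

lemma hom_into_summand_free_zero:
  assumes \<Phi>: "good_class m \<Phi>"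
    and X: "X \<in> fgmod A" "indecomposable A X" "\<not> pd_le A m X"
    and Y1: "summand_free \<Phi> Y1" and f1: "f1 \<in> lmod_hom A X Y1" and x1: "x1 \<in> carrier X"
  shows "f1 x1 = \<zero>\<^bsub>Y1\<^esub>"
proof (rule ccontr)
  assume nz: "f1 x1 \<noteq> \<zero>\<^bsub>Y1\<^esub>"
  note G = good_classD[OF \<Phi>]
  obtain \<rho> where \<rho>: "strict_rank {U. submodule U A X} \<rho>" using height[OF X(1)]
    by blast
  have avf: "B \<in> fgmod A" if "summand_free \<Phi> B" for B using that
    by (simp add: summand_free_def)
  define S where "S = {(Y, f). summand_free \<Phi> Y \<and> f \<in> lmod_hom A X Y}"
  obtain Yf where Yf: "Yf \<in> S"
    and min0: "\<And>z. z \<in> S \<Longrightarrow> \<rho> (a_kernel X (fst Yf) (snd Yf)) \<le> \<rho> (a_kernel X (fst z) (snd z))"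
    using ex_has_least_nat[of "\<lambda>z. z \<in> S" "(Y1, f1)" "\<lambda>z. \<rho> (a_kernel X (fst z) (snd z))"] Y1 f1
    by (auto simp: S_def)
  obtain Y f where Y_f: "Yf = (Y, f)" by (cases Yf)
  have Y: "summand_free \<Phi> Y" and f: "f \<in> lmod_hom A X Y" using Yf by (auto simp: S_def Y_f)
  have min: "\<rho> (a_kernel X Y f) \<le> \<rho> (a_kernel X B h)"
    if "summand_free \<Phi> B" "h \<in> lmod_hom A X B" for B h
    using min0[of "(B, h)"] that by (simp add: S_def Y_f)
  have Yfg: "Y \<in> fgmod A" using avf[OF Y] .
  define Ks where "Ks = a_kernel X Y f"
  have Ks: "submodule Ks A X" unfolding Ks_def by (rule submodule_kernel[OF f X(1) Yfg])
  have Ks_iff: "x \<in> Ks \<longleftrightarrow> x \<in> carrier X \<and> f x = \<zero>\<^bsub>Y\<^esub>" for x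
    by (auto simp: Ks_def a_kernel_def')
  \<comment> \<open>\<open>Ks\<close> is contained in the kernel of every map to a module without nonzero summands in \<open>\<Phi>\<close>\<close>
  have rej: "h x = \<zero>\<^bsub>B\<^esub>" if B: "summand_free \<Phi> B" and h: "h \<in> lmod_hom A X B"
    and x: "x \<in> Ks" for B h x
  proof (rule ccontr)
    assume n: "h x \<noteq> \<zero>\<^bsub>B\<^esub>"
    obtain T p q c where t: "biprod A T p q c Y B" using biprod_exists[OF Yfg avf[OF B]] by blast
    note T = biprodD[OF t]
    let ?h = "\<lambda>x. c (f x) (h x)"
    have h': "?h \<in> lmod_hom A X T" by (rule biprod_hom[OF t f h])
    have av: "summand_free \<Phi> T" by (rule summand_free_biprod[OF \<Phi> t Y B])
    have ker: "y \<in> a_kernel X T ?h \<longleftrightarrow> y \<in> Ks \<and> h y = \<zero>\<^bsub>B\<^esub>" for y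
    proof -
      have "?h y = \<zero>\<^bsub>T\<^esub> \<longleftrightarrow> f y = \<zero>\<^bsub>Y\<^esub> \<and> h y = \<zero>\<^bsub>B\<^esub>"
        if y: "y \<in> carrier X"
        using T(7,8)[OF hom_closed[OF f y] hom_closed[OF h y]] biprod_zero[OF t]
          hom_zero[OF T(4) T(1,2)] hom_zero[OF T(5) T(1,3)] by metis
      then show ?thesis by (auto simp: a_kernel_def' Ks_iff)
    qed
    have "a_kernel X T ?h \<subset> Ks" using ker x n by blast
    then have "\<rho> (a_kernel X T ?h) < \<rho> Ks"
      using strict_rankD[OF \<rho>, of "a_kernel X T ?h" Ks] submodule_kernel[OF h' X(1) T(1)] Ks
      by simp
    then show False using min[OF av h'] by (simp add: Ks_def)
  qed
  have KsX: "Ks \<noteq> carrier X" using rej[OF Y1 f1] nz x1 by blast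
  let ?K = "X\<lparr>carrier := Ks\<rparr>"
  have Kf: "?K \<in> fgmod A" by (rule restrict_fgmod[OF X(1) Ks])
  have KX: "x \<in> carrier X" if "x \<in> Ks" for x using that by (simp add: Ks_iff)
  define Im where "Im = f ` carrier X"
  have Im: "submodule Im A Y" unfolding Im_def
    by (rule submodule_image[OF f X(1) Yfg submodule_carrier[OF X(1)]])
  let ?I = "Y\<lparr>carrier := Im\<rparr>"
  have If: "?I \<in> fgmod A" by (rule restrict_fgmod[OF Yfg Im])
  have ImY: "Im \<subseteq> carrier Y" by (rule submodule_mem(1)[OF Im Yfg])
  have fI: "f \<in> lmod_hom A X ?I" by (rule hom_restrict_cod[OF f]) (simp add: Im_def)
  have fIs: "f ` carrier X = carrier ?I" by (simp add: Im_def)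
  obtain C g where C: "C \<in> fgmod A" "g \<in> lmod_hom A Y C" "g ` carrier Y = carrier C"
    "\<And>x. x \<in> carrier Y \<Longrightarrow> g x = \<zero>\<^bsub>C\<^esub> \<longleftrightarrow> x \<in> Im" using quotient_exists[OF Yfg Im]
      by blast
  have "short_exact A ?I (\<lambda>x. x) Y g C"
    unfolding short_exact_def using C If Yfg hom_incl[OF ImY] ImY by auto
  then have pdI: "pd_le A m ?I"
    by (rule pd_le_submodule[OF _ pd_le_summand_free[OF \<Phi> Y] gl_dim_le[OF C(1)]])
  have sX: "short_exact A ?K (\<lambda>x. x) X f ?I"
    unfolding short_exact_def using Kf X(1) If hom_incl[of Ks X A] KX fI fIs Ks_iff by auto
  have npdK: "\<not> pd_le A m ?K" using pd_le_extension[OF sX _ pdI] X(3) by blast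
  have "\<exists>p q c U V. biprod A ?K p q c U V \<and> id_le_one A U \<and> pd_le A m V"
  proof (rule decompose[OF Kf])
    show "id_le_one A S" if "biprod A S p q c U V" "id_le_one A U" "id_le_one A V" for S p q c U V
      by (rule id_le_one_biprod[OF that])
    show "pd_le A m S" if "biprod A S p q c U V" "pd_le A m U" "pd_le A m V" for S p q c U V
      by (rule pd_le_biprod[OF that])
    show "id_le_one A N \<or> pd_le A m N" if "N \<in> fgmod A" "indecomposable A N" for N
      using alternative[OF that] by blast
  qed (simp_all add: id_le_one_zero pd_le_zero)
  then obtain pK qK cK K1 K2 where bK: "biprod A ?K pK qK cK K1 K2" and K1: "id_le_one A K1"
    and K2: "pd_le A m K2"
    by blast
  note BK = biprodD[OF bK]
  have K1nz: "carrier K1 \<noteq> {\<zero>\<^bsub>K1\<^esub>}"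
    using pd_le_retract[OF retract_biprod_zero[OF biprod_sym[OF bK]] K2] npdK by blast
  \<comment> \<open>the inclusion of \<open>K1\<close> into \<open>X\<close>\<close>
  define \<iota> where "\<iota> z = cK z \<zero>\<^bsub>K2\<^esub>" for z
  have \<iota>K: "\<iota> \<in> lmod_hom A K1 ?K" unfolding \<iota>_def by (rule biprod_inl[OF bK])
  have \<iota>: "\<iota> \<in> lmod_hom A K1 X"
    by (rule hom_unrestrict_cod[OF \<iota>K]) (use KX in auto)
  have \<iota>_Ks: "\<iota> z \<in> Ks" if "z \<in> carrier K1" for z using hom_closed[OF \<iota>K that]
    by simp
  have pK\<iota>: "pK (\<iota> z) = z" if "z \<in> carrier K1" for z using BK(3,7) that
    by (simp add: \<iota>_def)
  obtain i J0 \<pi> J1 where inj: "injective A J0" "injective A J1"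
    and sK: "short_exact A K1 i J0 \<pi> J1"
    using K1 unfolding id_le_one_def by blast
  note XK = short_exactD[OF sK]
  obtain j where j: "j \<in> lmod_hom A X J0" "\<And>x. x \<in> Ks \<Longrightarrow> j x = i (pK x)"
    using injectiveD[OF inj(1) short_exactD(4)[OF sX] _ hom_comp[OF BK(4) XK(4)] Kf X(1)] by auto
  have j\<iota>: "j (\<iota> z) = i z" if "z \<in> carrier K1" for z
    using j(2)[OF \<iota>_Ks[OF that]] pK\<iota>[OF that] by simp
  have "\<pi> (j x) = \<zero>\<^bsub>J1\<^esub>"
    if "x \<in> carrier X" "f x = \<zero>\<^bsub>?I\<^esub>" for x
  proof -
    have "x \<in> Ks" using that by (simp add: Ks_iff)
    then show ?thesis using j(2) XK(8) hom_closed[OF BK(4)] by simp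
  qed
  then obtain \<phi>0 where \<phi>0: "\<phi>0 \<in> lmod_hom A ?I J1" "\<And>x. x \<in> carrier X \<Longrightarrow> \<phi>0 (f x) = \<pi> (j x)"
    using factor_surj[OF fI fIs hom_comp[OF j(1) XK(5)] X(1) If XK(3)] by blast
  obtain \<phi> where \<phi>: "\<phi> \<in> lmod_hom A Y J1" "\<And>y. y \<in> Im \<Longrightarrow> \<phi> y = \<phi>0 y"
    using injectiveD[OF inj(2) hom_incl[OF ImY] _ \<phi>0(1) If Yfg] by auto
  have \<phi>f: "\<phi> (f x) = \<pi> (j x)" if "x \<in> carrier X" for x
    using \<phi>(2)[of "f x"] \<phi>0(2) that by (simp add: Im_def)
  \<comment> \<open>the pullback \<open>E\<close> of \<open>\<phi>\<close> and \<open>\<pi>\<close>\<close>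
  obtain T a b c where t: "biprod A T a b c Y J0" using biprod_exists[OF Yfg XK(2)] by blast
  note T = biprodD[OF t]
  define \<delta> where "\<delta> t = \<phi> (a t) \<oplus>\<^bsub>J1\<^esub> \<ominus>\<^bsub>J1\<^esub> \<pi> (b t)" for t
  have \<delta>: "\<delta> \<in> lmod_hom A T J1" unfolding \<delta>_def
    by (rule hom_diff_map[OF hom_comp[OF T(4) \<phi>(1)] hom_comp[OF T(5) XK(5)] XK(3)])
  let ?E = "T\<lparr>carrier := a_kernel T J1 \<delta>\<rparr>"
  have Ef: "?E \<in> fgmod A" by (rule kernel_fgmod[OF \<delta> T(1) XK(3)])
  have E_iff: "e \<in> carrier ?E \<longleftrightarrow> e \<in> carrier T \<and> \<phi> (a e) = \<pi> (b e)" for e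
    using fgmod_diff_zero[OF XK(3), of "\<phi> (a e)" "\<pi> (b e)"] hom_closed[OF \<phi>(1)] hom_closed[OF XK(5)]
      hom_closed[OF T(4)] hom_closed[OF T(5)] by (auto simp: a_kernel_def' \<delta>_def)
  have ET: "e \<in> carrier T" if "e \<in> carrier ?E" for e using that E_iff by blast
  have aE: "a \<in> lmod_hom A ?E Y" and bE: "b \<in> lmod_hom A ?E J0"
    using hom_restrict_dom[OF T(4) a_kernel_subset] hom_restrict_dom[OF T(5) a_kernel_subset]
    by auto
  \<comment> \<open>the map \<open>X \<rightarrow> E\<close> over \<open>Y\<close>\<close>
  define \<kappa> where "\<kappa> x = c (f x) (j x)" for x
  have fj: "f x \<in> carrier Y" "j x \<in> carrier J0" if "x \<in> carrier X" for x
    using that hom_closed[OF f] hom_closed[OF j(1)] by auto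
  have a\<kappa>: "a (\<kappa> x) = f x" and b\<kappa>: "b (\<kappa> x) = j x"
    if "x \<in> carrier X" for x
    using T(7,8) fj[OF that] by (auto simp: \<kappa>_def)
  have \<kappa>0: "\<kappa> \<in> lmod_hom A X T" unfolding \<kappa>_def
    by (rule biprod_hom[OF t f j(1)])
  have \<kappa>: "\<kappa> \<in> lmod_hom A X ?E"
    using hom_closed[OF \<kappa>0] a\<kappa> b\<kappa> \<phi>f E_iff
    by (intro hom_restrict_cod[OF \<kappa>0]) auto
  have a_surj: "a ` carrier ?E = carrier Y"
  proof
    show "a ` carrier ?E \<subseteq> carrier Y" using hom_closed[OF aE] by auto
    show "carrier Y \<subseteq> a ` carrier ?E"
    proof
      fix y assume y: "y \<in> carrier Y"
      then have "\<phi> y \<in> \<pi> ` carrier J0" using XK(7) hom_closed[OF \<phi>(1)] by simp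
      then obtain z where z: "z \<in> carrier J0" "\<phi> y = \<pi> z" by blast
      have "c y z \<in> carrier ?E" unfolding E_iff using T(6-8)[OF y z(1)] z(2) by simp
      moreover have "y = a (c y z)" using T(7)[OF y z(1)] by simp
      ultimately show "y \<in> a ` carrier ?E" by blast
    qed
  qed
  have kerE: "\<exists>z\<in>carrier K1. b e = i z \<and> e = \<kappa> (\<iota> z)"
    if e: "e \<in> carrier ?E" "a e = \<zero>\<^bsub>Y\<^esub>" for e
  proof -
    have "\<pi> (b e) = \<zero>\<^bsub>J1\<^esub>" using e E_iff hom_zero[OF \<phi>(1) Yfg XK(3)]
      by metis
    then obtain z where z: "z \<in> carrier K1" "b e = i z" using XK(9) hom_closed[OF bE e(1)]
      by blast
    have \<iota>z: "\<iota> z \<in> carrier X" "f (\<iota> z) = \<zero>\<^bsub>Y\<^esub>"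
      using \<iota>_Ks[OF z(1)] by (auto simp: Ks_iff)
    have "e = \<kappa> (\<iota> z)"
      by (rule biprod_eqI[OF t]) (use e ET hom_closed[OF \<kappa>0] a\<kappa> b\<kappa> \<iota>z z j\<iota> in auto)
    then show ?thesis using z by blast
  qed
  have "\<exists>p q c U V. biprod A ?E p q c U V \<and> summand_free \<Phi> U \<and> \<Phi> V"
  proof (rule decompose[OF Ef])
    show "summand_free \<Phi> N \<or> \<Phi> N" if "N \<in> fgmod A" "indecomposable A N" for N
      using summand_free_indecomposable[OF \<Phi> that] by blast
    show "summand_free \<Phi> S"
      if "biprod A S p q c U V" "summand_free \<Phi> U" "summand_free \<Phi> V" for S p q c U V
      by (rule summand_free_biprod[OF \<Phi> that])
    show "\<Phi> S" if "biprod A S p q c U V" "\<Phi> U" "\<Phi> V" for S p q c U V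
      by (rule G(2)[OF that])
  qed (simp_all add: summand_free_zero G(3))
  then obtain e1 e2 cE B E' where bEE: "biprod A ?E e1 e2 cE B E'" and B: "summand_free \<Phi> B"
    and E': "\<Phi> E'" by blast
  note BE = biprodD[OF bEE]
  have e1K: "e1 (\<kappa> x) = \<zero>\<^bsub>B\<^esub>" if "x \<in> Ks" for x
    by (rule rej[OF B hom_comp[OF \<kappa> BE(4)] that])
  \<comment> \<open>the inclusion of \<open>E'\<close> into \<open>E\<close>\<close>
  define \<eta> where "\<eta> z = cE \<zero>\<^bsub>B\<^esub> z" for z
  have \<eta>: "\<eta> \<in> lmod_hom A E' ?E" unfolding \<eta>_def by (rule biprod_inr[OF bEE])
  have e2\<eta>: "e2 (\<eta> z) = z" if "z \<in> carrier E'" for z using BE(2,8) that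
    by (simp add: \<eta>_def)
  have \<eta>e2: "\<eta> (e2 (\<kappa> x)) = \<kappa> x" if "x \<in> Ks" for x
    using BE(9)[OF hom_closed[OF \<kappa> KX[OF that]]] e1K[OF that] by (simp add: \<eta>_def)
  have ker_\<eta>: "\<eta> (e2 e) = e"
    if e: "e \<in> carrier ?E" "a e = \<zero>\<^bsub>Y\<^esub>" for e
    using kerE[OF e] \<eta>e2 \<iota>_Ks by metis
  define p where "p z = a (\<eta> z)" for z
  have p: "p \<in> lmod_hom A E' Y" unfolding p_def by (rule hom_comp[OF \<eta> aE])
  define Ns where "Ns = p ` carrier E'"
  have Ns: "submodule Ns A Y" unfolding Ns_def
    by (rule submodule_image[OF p BE(3) Yfg submodule_carrier[OF BE(3)]])
  have NsY: "Ns \<subseteq> carrier Y" by (rule submodule_mem(1)[OF Ns Yfg])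
  let ?N = "Y\<lparr>carrier := Ns\<rparr>"
  have Nf: "?N \<in> fgmod A" by (rule restrict_fgmod[OF Yfg Ns])
  have pN: "p \<in> lmod_hom A E' ?N" by (rule hom_restrict_cod[OF p]) (simp add: Ns_def)
  have pNs: "p ` carrier E' = carrier ?N" by (simp add: Ns_def)
  \<comment> \<open>\<open>Y\<close> retracts onto the image of \<open>E'\<close>, because the kernel of \<open>E \<rightarrow> Y\<close> lies in \<open>E'\<close>\<close>
  have "p (e2 e) = \<zero>\<^bsub>?N\<^esub>"
    if "e \<in> carrier ?E" "a e = \<zero>\<^bsub>Y\<^esub>" for e
    using ker_\<eta>[OF that] that by (simp add: p_def)
  then obtain r where r: "r \<in> lmod_hom A Y ?N" "\<And>e. e \<in> carrier ?E \<Longrightarrow> r (a e) = p (e2 e)"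
    using factor_surj[OF aE a_surj hom_comp[OF BE(5) pN] Ef Yfg Nf] by blast
  have "r n = n" if "n \<in> Ns" for n
  proof -
    obtain z where z: "z \<in> carrier E'" "n = p z" using \<open>n \<in> Ns\<close>
      by (auto simp: Ns_def)
    have "r (a (\<eta> z)) = p (e2 (\<eta> z))" using r(2)[OF hom_closed[OF \<eta> z(1)]] .
    then show ?thesis using e2\<eta>[OF z(1)] z(2) by (simp add: p_def)
  qed
  then have retN: "retract A ?N Y (\<lambda>x. x) r"
    unfolding retract_def using Nf Yfg hom_incl[OF NsY] r(1) by simp
  let ?L = "E'\<lparr>carrier := a_kernel E' ?N p\<rparr>"
  have Lf: "?L \<in> fgmod A" by (rule kernel_fgmod[OF pN BE(3) Nf])
  have L_iff: "l \<in> carrier ?L \<longleftrightarrow> l \<in> carrier E' \<and> a (\<eta> l) = \<zero>\<^bsub>Y\<^esub>" for l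
    by (auto simp: a_kernel_def' p_def)
  have "id_le_one A ?L"
  proof -
    have b\<eta>: "(\<lambda>l. b (\<eta> l)) \<in> lmod_hom A ?L J0"
      by (rule hom_restrict_dom[OF hom_comp[OF \<eta> bE] a_kernel_subset])
    have "b (\<eta> l) \<in> i ` carrier K1" if "l \<in> carrier ?L" for l
      using that kerE[of "\<eta> l"] hom_closed[OF \<eta>] unfolding L_iff by blast
    then obtain s where s: "s \<in> lmod_hom A ?L K1" "\<And>l. l \<in> carrier ?L \<Longrightarrow> i (s l) = b (\<eta> l)"
      using factor_inj[OF XK(4,6) b\<eta> XK(1)] by blast
    have r0: "(\<lambda>z. e2 (\<kappa> (\<iota> z))) \<in> lmod_hom A K1 E'"
      by (rule hom_comp[OF \<iota> hom_comp[OF \<kappa> BE(5)]])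
    have "e2 (\<kappa> (\<iota> z)) \<in> carrier ?L" if z: "z \<in> carrier K1" for z
    proof -
      have "f (\<iota> z) = \<zero>\<^bsub>Y\<^esub>" "\<iota> z \<in> carrier X" using \<iota>_Ks[OF z]
        by (auto simp: Ks_iff)
      then show ?thesis unfolding L_iff using hom_closed[OF r0 z] \<eta>e2[OF \<iota>_Ks[OF z]] a\<kappa>
        by simp
    qed
    then have r: "(\<lambda>z. e2 (\<kappa> (\<iota> z))) \<in> lmod_hom A K1 ?L"
      by (intro hom_restrict_cod[OF r0]) auto
    have "e2 (\<kappa> (\<iota> (s l))) = l" if l: "l \<in> carrier ?L" for l
    proof -
      have l': "l \<in> carrier E'" "a (\<eta> l) = \<zero>\<^bsub>Y\<^esub>" using l L_iff by auto
      obtain z where z: "z \<in> carrier K1" "b (\<eta> l) = i z" "\<eta> l = \<kappa> (\<iota> z)"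
        using kerE[OF hom_closed[OF \<eta> l'(1)] l'(2)] by blast
      have "s l = z" using inj_onD[OF XK(6), of "s l" z] s(2)[OF l] z hom_closed[OF s(1) l] by simp
      then show ?thesis using z(3) e2\<eta>[OF l'(1)] by simp
    qed
    then have "retract A ?L K1 s (\<lambda>z. e2 (\<kappa> (\<iota> z)))"
      unfolding retract_def using Lf XK(1) s(1) r by blast
    then show ?thesis using id_le_one_retract[OF K1] by blast
  qed
  then have "\<Phi> ?N" using G(4)[OF BE(3) Nf pN pNs E'] by blast
  then have "carrier ?N = {\<zero>\<^bsub>?N\<^esub>}" using Y retN unfolding summand_free_def
    by blast
  then have a\<eta>: "a (\<eta> z) = \<zero>\<^bsub>Y\<^esub>" if "z \<in> carrier E'" for z
    using that by (auto simp: Ns_def p_def)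
  \<comment> \<open>hence \<open>E'\<close> is the kernel of \<open>E \<rightarrow> Y\<close>, and \<open>X \<rightarrow> E \<rightarrow> E'\<close> retracts \<open>X\<close> onto \<open>K1\<close>\<close>
  have e2\<kappa>: "(\<lambda>x. e2 (\<kappa> x)) \<in> lmod_hom A X E'"
    by (rule hom_comp[OF \<kappa> BE(5)])
  have h0: "(\<lambda>x. b (\<eta> (e2 (\<kappa> x)))) \<in> lmod_hom A X J0"
    by (rule hom_comp[OF e2\<kappa> hom_comp[OF \<eta> bE]])
  have "b (\<eta> (e2 (\<kappa> x))) \<in> i ` carrier K1" if x: "x \<in> carrier X" for x
    using kerE[OF hom_closed[OF \<eta> hom_closed[OF e2\<kappa> x]] a\<eta>[OF hom_closed[OF e2\<kappa> x]]]
    by blast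
  then obtain s where s: "s \<in> lmod_hom A X K1" "\<And>x. x \<in> carrier X \<Longrightarrow> i (s x) = b (\<eta> (e2 (\<kappa> x)))"
    using factor_inj[OF XK(4,6) h0 XK(1)] by blast
  have "s (\<iota> z) = z" if z: "z \<in> carrier K1" for z
  proof -
    have zX: "\<iota> z \<in> carrier X" using hom_closed[OF \<iota> z] .
    have "i (s (\<iota> z)) = i z"
      using s(2)[OF zX] \<eta>e2[OF \<iota>_Ks[OF z]] b\<kappa>[OF zX] j\<iota>[OF z] by simp
    then show ?thesis using inj_onD[OF XK(6), of "s (\<iota> z)" z] hom_closed[OF s(1) zX] z by simp
  qed
  then have "retract A K1 X \<iota> s" unfolding retract_def using XK(1) X(1) \<iota> s(1) by blast
  then have all: "\<forall>x\<in>carrier X. \<iota> (s x) = x" using indecomposable_retract[OF X(2)] K1nz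
    by blast
  have "carrier X \<subseteq> Ks"
  proof
    fix x assume "x \<in> carrier X"
    then show "x \<in> Ks" using all \<iota>_Ks[OF hom_closed[OF s(1)]] by metis
  qed
  then show False using KsX KX by blast
qed

text \<open>The class belonging to the next step backwards on a path through \<open>Y\<close>.\<close>

lemma good_class_hom:
  assumes \<Phi>: "good_class m \<Phi>"
    and Y: "Y \<in> fgmod A" "indecomposable A Y" "\<not> \<Phi> Y"
  shows "good_class m (\<lambda>N. N \<in> fgmod A \<and> (\<forall>h\<in>lmod_hom A N Y. \<forall>x\<in>carrier N. h x = \<zero>\<^bsub>Y\<^esub>))"
    (is "good_class m ?\<Psi>")
  unfolding good_class_def
proof (intro conjI allI ballI impI)
  fix N M s r assume R: "retract A N M s r" and M: "?\<Psi> M"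
  note R = retractD[OF R]
  show "N \<in> fgmod A" by (rule R(1))
  fix h x assume h: "h \<in> lmod_hom A N Y" and x: "x \<in> carrier N"
  have "\<forall>x\<in>carrier M. h (r x) = \<zero>\<^bsub>Y\<^esub>" using M hom_comp[OF R(4) h]
    by simp
  then have "h (r (s x)) = \<zero>\<^bsub>Y\<^esub>" using hom_closed[OF R(3) x] by simp
  then show "h x = \<zero>\<^bsub>Y\<^esub>" using R(5)[OF x] by simp
next
  fix S p q c U V assume b: "biprod A S p q c U V" and U: "?\<Psi> U" and V: "?\<Psi> V"
  note B = biprodD[OF b]
  show "S \<in> fgmod A" by (rule B(1))
  fix h x assume h: "h \<in> lmod_hom A S Y" and x: "x \<in> carrier S"
  have c: "p x \<in> carrier U" "q x \<in> carrier V" using hom_closed[OF B(4) x] hom_closed[OF B(5) x]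
    by auto
  have cl: "c (p x) \<zero>\<^bsub>V\<^esub> \<in> carrier S" "c \<zero>\<^bsub>U\<^esub> (q x) \<in> carrier S" using c B(2,3,6)
    by auto
  have z: "h (c (p x) \<zero>\<^bsub>V\<^esub>) = \<zero>\<^bsub>Y\<^esub>" "h (c \<zero>\<^bsub>U\<^esub> (q x)) = \<zero>\<^bsub>Y\<^esub>"
    using U[THEN conjunct2, rule_format, OF hom_comp[OF biprod_inl[OF b] h] c(1)]
      V[THEN conjunct2, rule_format, OF hom_comp[OF biprod_inr[OF b] h] c(2)] by auto
  have "h x = h (c (p x) \<zero>\<^bsub>V\<^esub> \<oplus>\<^bsub>S\<^esub> c \<zero>\<^bsub>U\<^esub> (q x))"
    using biprod_split[OF b x] by simp
  then show "h x = \<zero>\<^bsub>Y\<^esub>" using hom_add[OF h cl] z Y(1) by simp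
next
  fix N h x assume N: "N \<in> fgmod A" "carrier N = {\<zero>\<^bsub>N\<^esub>}"
    and h: "h \<in> lmod_hom A N Y" "x \<in> carrier N"
  show "h x = \<zero>\<^bsub>Y\<^esub>" by (rule zero_module_hom[OF h(1) N(2,1) Y(1) h(2)])
next
  fix E N p h x assume p: "p \<in> lmod_hom A E N" "p ` carrier E = carrier N" and E: "?\<Psi> E"
    and h: "h \<in> lmod_hom A N Y" and x: "x \<in> carrier N"
  obtain e where "e \<in> carrier E" "x = p e" using p(2) x by blast
  then show "h x = \<zero>\<^bsub>Y\<^esub>"
    using E[THEN conjunct2, rule_format, OF hom_comp[OF p(1) h]] by simp
next
  fix N assume N: "N \<in> fgmod A" "indecomposable A N" "\<not> ?\<Psi> N"
  then obtain h x where "h \<in> lmod_hom A N Y" "x \<in> carrier N" "h x \<noteq> \<zero>\<^bsub>Y\<^esub>"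
    by blast
  then show "pd_le A m N"
    using hom_into_summand_free_zero[OF \<Phi> N(1,2) _ summand_free_indecomposable[OF \<Phi> Y]]
    by blast
qed

lemma predecessor_not_good:
  assumes ind: "ind \<subseteq> {M \<in> fgmod A. indecomposable A M}"
    and pre: "predecessor A ind M N"
    and N: "\<exists>\<Phi>. good_class m \<Phi> \<and> \<not> \<Phi> N"
  shows "\<exists>\<Phi>. good_class m \<Phi> \<and> \<not> \<Phi> M"
proof -
  obtain t C f where C: "C 0 = M" "C t = N" "\<And>i. i \<le> t \<Longrightarrow> C i \<in> ind"
    and f: "\<And>i. i < t \<Longrightarrow> f i \<in> lmod_hom A (C i) (C (Suc i)) \<and>
      (\<exists>x\<in>carrier (C i). f i x \<noteq> \<zero>\<^bsub>C (Suc i)\<^esub>)"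
    using pre unfolding predecessor_def by blast
  have "\<exists>\<Phi>. good_class m \<Phi> \<and> \<not> \<Phi> (C i)" if "i \<le> t" for i
    using that
  proof (induction rule: inc_induct)
    case base then show ?case using N C(2) by simp
  next
    case (step n)
    then obtain \<Phi> where \<Phi>: "good_class m \<Phi>" "\<not> \<Phi> (C (Suc n))" by blast
    have Y: "C (Suc n) \<in> fgmod A" "indecomposable A (C (Suc n))" using C(3)[of "Suc n"] step.hyps ind
      by auto
    show ?case using good_class_hom[OF \<Phi>(1) Y \<Phi>(2)] f[of n] step.hyps by blast
  qed
  then show ?thesis using C(1) by blast
qed

end

theorem theorem3p6:
  fixes k :: "('k, 'z) ring_scheme"
    and A :: "('k, 'a, 'y) module_scheme"
    and ind :: "'a lmod set"
    and m :: nat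
  assumes "m > 0"
    and "artin_algebra k A"
    and "almost_hereditary m A"
    and "is_ind A ind"
  shows "ind = left_part m A ind \<union> right_part A ind"
proof -
  interpret artin_algebra k A by fact
  interpret H: finite_height_ring A
  proof
    fix M :: "'a lmod" assume M: "M \<in> fgmod A"
    then show "\<exists>\<rho>. strict_rank {U. submodule U A M} \<rho>"
      using artin_algebra_finite_height[OF assms(2), of M] by (simp add: fgmod_def)
  qed
  have ind: "ind \<subseteq> {M \<in> fgmod A. indecomposable A M}" using assms(4) by (simp add: is_ind_def)
  interpret H: almost_hereditary_ring A m
  proof
    fix M :: "'a lmod" assume M: "M \<in> fgmod A"
    have "proj_dim A M \<le> gl_dim A" unfolding gl_dim_def using M by (rule SUP_upper)
    then show "pd_le A (Suc m) M"
      using assms(3) H.proj_dim_le_iff[OF M, of "Suc m"] by (simp add: almost_hereditary_def)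
    assume "indecomposable A M"
    then have "proj_dim A M \<le> enat m \<or> inj_dim A M \<le> 1"
      using assms(3) M by (simp add: almost_hereditary_def)
    then show "pd_le A m M \<or> id_le_one A M"
      using H.proj_dim_le_iff[OF M] H.inj_dim_le_1_iff[OF M] by simp
  qed
  have "M \<in> left_part m A ind" if M: "M \<in> ind" "M \<notin> right_part A ind" for M
  proof -
    obtain N where N: "predecessor A ind M N" "\<not> inj_dim A N \<le> 1" using M by (auto simp: right_part_def)
    have "N \<in> ind" using N(1) unfolding predecessor_def by blast
    then have "\<not> id_le_one A N" using N(2) ind H.inj_dim_le_1_iff by blast
    then have "\<exists>\<Phi>. H.good_class m \<Phi> \<and> \<not> \<Phi> N" using H.good_class_id1 by blast
    then have ng: "\<exists>\<Phi>. H.good_class m \<Phi> \<and> \<not> \<Phi> M" by (rule H.predecessor_not_good[OF ind N(1)])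
    have "proj_dim A L \<le> enat m" if L: "predecessor A ind L M" for L
    proof -
      have "L \<in> ind" using L unfolding predecessor_def by (metis le0)
      then have Lf: "L \<in> fgmod A" "indecomposable A L" using ind by auto
      have "pd_le A m L" using H.predecessor_not_good[OF ind L ng] H.good_classD(5) Lf by blast
      then show ?thesis using H.proj_dim_le_iff[OF Lf(1)] by simp
    qed
    then show ?thesis using M(1) by (simp add: left_part_def)
  qed
  moreover have "left_part m A ind \<union> right_part A ind \<subseteq> ind"
    by (auto simp: left_part_def right_part_def)
  ultimately show ?thesis by blast
qed

end
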